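(* Let $\chi(t)$ be the shape of an unbiased random walk on $\mathbb{Z}$, let $-e$ and $f$ be the minimum and maximum of its support, and suppose $\gcd(e,f)=1$. Let $\omega(t)$ be the shape of any random walk on $\mathbb{Z}$ with the same spectrum. Then the second walk is obtained from the first by an endomorphism of the group $(\mathbb{Z},+)$; that is, there is an integer $d$ such that $\omega(t)=\chi(t^d)$.
   Context: A random walk is the sequence of partial sums of a series $\mathsf{X}_1+\mathsf{X}_2+\cdots$ of independent identically distributed finitely supported $\mathbb{Z}$-valued random variables. Its shape is the Laurent polynomial $\chi(t)=\sum_k \kappa_k t^k$ with $\kappa_k=\Pr[\mathsf{X}_i=k]\ge 0$ (so $\chi(1)=1$), and its support is $\{k:\kappa_k>0\}$. The walk is unbiased if $E[\mathsf{X}_i]=0$, i.e. $\chi'(1)=0$. The $n$th return probability is $I_n=\Pr[\mathsf{X}_1+\cdots+\mathsf{X}_n=0]$ (the constant term of $\chi(t)^n$), and the spectrum is the sequence $I_1,I_2,I_3,\ldots$. *)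

theory Defs
  imports "HOL-Probability.Probability" "HOL-Library.Poly_Mapping"
begin

text \<open>A walk is given by its steps \<open>X 1, X 2, \<dots>\<close>; the value \<open>X 0\<close> is never used.\<close>

definition step_prob :: "'a measure \<Rightarrow> (nat \<Rightarrow> 'a \<Rightarrow> int) \<Rightarrow> int \<Rightarrow> real" where
  "step_prob M X k = measure M {x \<in> space M. X 1 x = k}"

definition walk_support :: "'a measure \<Rightarrow> (nat \<Rightarrow> 'a \<Rightarrow> int) \<Rightarrow> int set" where
  "walk_support M X = {k. step_prob M X k > 0}"

locale random_walk = prob_space M
  for M :: "'a measure" and X :: "nat \<Rightarrow> 'a \<Rightarrow> int" +
  assumes indep: "indep_vars (\<lambda>_. count_space UNIV) X {1..}"
    and ident: "\<And>i. i \<ge> 1 \<Longrightarrow>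
      distr M (count_space UNIV) (X i) = distr M (count_space UNIV) (X 1)"
    and finite_support: "finite (walk_support M X)"

text \<open>Finite support makes every step integrable, so the expectation below is genuine.\<close>

definition unbiased :: "'a measure \<Rightarrow> (nat \<Rightarrow> 'a \<Rightarrow> int) \<Rightarrow> bool" where
  "unbiased M X \<longleftrightarrow> (\<forall>i\<ge>1. prob_space.expectation M (\<lambda>x. real_of_int (X i x)) = 0)"

definition return_prob :: "'a measure \<Rightarrow> (nat \<Rightarrow> 'a \<Rightarrow> int) \<Rightarrow> nat \<Rightarrow> real" where
  "return_prob M X n = measure M {x \<in> space M. (\<Sum>i=1..n. X i x) = 0}"

text \<open>The type \<^typ>\<open>int \<Rightarrow>\<^sub>0 real\<close> with its convolution product is the ring of real Laurent
  polynomials in \<open>t\<close>; \<^term>\<open>Poly_Mapping.single k c\<close> is the monomial \<open>c t\<^sup>k\<close>.\<close>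

type_synonym laurent_poly = "int \<Rightarrow>\<^sub>0 real"

definition shape :: "'a measure \<Rightarrow> (nat \<Rightarrow> 'a \<Rightarrow> int) \<Rightarrow> laurent_poly" where
  "shape M X = (\<Sum>k\<in>walk_support M X. Poly_Mapping.single k (step_prob M X k))"

text \<open>The substitution \<open>t \<mapsto> t\<^sup>d\<close>. For \<open>d = 0\<close> all coefficients are added up at exponent \<open>0\<close>.\<close>

definition subst_power :: "int \<Rightarrow> laurent_poly \<Rightarrow> laurent_poly" where
  "subst_power d p = (\<Sum>k\<in>Poly_Mapping.keys p. Poly_Mapping.single (d * k) (Poly_Mapping.lookup p k))"

lemma (in random_walk) lookup_shape: "Poly_Mapping.lookup (shape M X) k = step_prob M X k"
proof -
  have "step_prob M X k = 0" if "k \<notin> walk_support M X"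
    using that by (simp add: walk_support_def step_prob_def not_less measure_le_0_iff)
  then show ?thesis
    using finite_support
    by (auto simp: shape_def lookup_sum lookup_single when_def)
qed

end

theory Submission
  imports Defs "HOL-Complex_Analysis.Complex_Analysis"
begin

text \<open>Let \<open>-e\<close> and \<open>f\<close> be the extreme exponents of \<open>\<chi>\<close>. For large \<open>\<lambda>\<close> the equation \<open>\<chi>(t) = \<lambda>\<close> has \<open>e\<close> small and
  \<open>f\<close> large roots, among them one small positive root \<open>t\<^sub>-\<close> and one large positive root \<open>t\<^sub>+\<close>.
  By residues, the generating function \<open>J(\<lambda>) = \<Sum> I\<^sub>n \<lambda>\<^bsup>-n-1\<^esup>\<close> is minus the logarithmic derivative of the product of
  the small roots. At \<open>\<lambda> = 1\<close> the roots \<open>t\<^sub>\<plusminus>\<close> meet in the double root \<open>t = 1\<close>, which is the only root on the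
  unit circle, so continuation around \<open>\<lambda> = 1\<close> swaps \<open>t\<^sub>-\<close> and \<open>t\<^sub>+\<close> and preserves the sets of the other small
  and of the other large roots. Comparing \<open>J\<close> before and after shows that the spectrum determines \<open>t\<^sub>+ / t\<^sub>-\<close>.

  A walk with the same spectrum is unbiased, and after dividing it by the gcd of its support the same analysis
  applies to it, with exponents \<open>e'\<close>, \<open>f'\<close> and positive roots \<open>s\<^sub>\<plusminus>\<close>. The order of growth of
  \<open>t\<^sub>+ / t\<^sub>- = s\<^sub>+ / s\<^sub>-\<close> at infinity gives \<open>1/e + 1/f = 1/e' + 1/f'\<close>. Rotating around \<open>\<infinity>\<close>, then continuing through
  \<open>\<lambda> = 1\<close> and comparing orders of growth again shows that \<open>e'\<close> or \<open>f'\<close> divides \<open>e\<close>, and likewise for \<open>f\<close>; this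
  forces \<open>{e, f} = {e', f'}\<close>. After a reflection, \<open>s\<^sub>- / t\<^sub>- = s\<^sub>+ / t\<^sub>+\<close> is a power series in \<open>\<lambda>\<^sup>-\<^sup>1\<close> because
  \<open>gcd(e, f) = 1\<close>, and comparing \<open>J\<close> at infinity shows that it is constant, so that the walks agree.\<close>

subsection \<open>Relations between branches of algebraic functions\<close>

text \<open>The real ray \<lambda> > 1 may contain critical values of \<chi>, where single roots
  stop being analytic. So apart from the two positive roots, which stay simple for \<lambda> > 1, no
  root is continued on its own. What is continued is a statement "some members of these sets of
  roots satisfy a b = c d". It needs only sets that are locally given by analytic branches, and the
  real parameter x with \<lambda> = 1 + x^2 is path enough.

  The other small roots and the other large roots never mix along this path: |\<chi>(y)| \<le>
  \<chi>(|y|) keeps them off the unit circle, provided that the walk is aperiodic. This is why the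
  second walk is divided by the gcd of its support. The contribution of the other small roots to J
  is even in x, so the part of J that is odd in x involves the positive roots alone.

  The condition gcd(e, f) = 1 enters four times: it makes the first walk aperiodic, keeps f > 1 from
  dividing e, settles the equation for the exponents, and makes the quotient of the small positive
  roots single-valued at infinity.\<close>

lemma holomorphic_local_inverse:
  assumes holf: "f holomorphic_on S" and S: "open S" "\<xi> \<in> S" and d: "deriv f \<xi> \<noteq> 0"
  obtains r G \<delta> where "r > 0" "ball \<xi> r \<subseteq> S" "\<delta> > 0" "G holomorphic_on ball (f \<xi>) \<delta>"
    "\<And>w. w \<in> ball (f \<xi>) \<delta> \<Longrightarrow> G w \<in> ball \<xi> r \<and> f (G w) = w"
    "\<And>z. z \<in> ball \<xi> r \<Longrightarrow> G (f z) = z"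
proof -
  obtain r where r: "r > 0" "ball \<xi> r \<subseteq> S" "open (f ` ball \<xi> r)" "inj_on f (ball \<xi> r)"
    using has_complex_derivative_locally_invertible[OF holf S(2,1) d] by metis
  have hol: "f holomorphic_on ball \<xi> r" using holf r(2) holomorphic_on_subset by blast
  obtain G where G: "G holomorphic_on (f ` ball \<xi> r)" "\<And>z. z \<in> ball \<xi> r \<Longrightarrow> G (f z) = z"
    using holomorphic_has_inverse[OF hol open_ball r(4)] by metis
  have "f \<xi> \<in> f ` ball \<xi> r" using r(1) by auto
  then obtain \<delta> where \<delta>: "\<delta> > 0" "ball (f \<xi>) \<delta> \<subseteq> f ` ball \<xi> r"
    using r(3) open_contains_ball by blast
  have "G w \<in> ball \<xi> r \<and> f (G w) = w" if "w \<in> ball (f \<xi>) \<delta>" for w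
  proof -
    have "w \<in> f ` ball \<xi> r" using that \<delta>(2) by blast
    then obtain z where "z \<in> ball \<xi> r" "w = f z" by blast
    then show ?thesis using G(2) by simp
  qed
  moreover have "G holomorphic_on ball (f \<xi>) \<delta>" using G(1) \<delta>(2) holomorphic_on_subset by blast
  ultimately show ?thesis using that[of r \<delta> G] r(1,2) \<delta>(1) G(2) by metis
qed

text \<open>Finite unions of zero sets, because a relation quantified over several branches is a
  disjunction of equations.\<close>

definition local_zeros :: "(complex \<Rightarrow> bool) \<Rightarrow> complex set \<Rightarrow> bool" where
  "local_zeros Q S \<longleftrightarrow> (\<forall>z\<in>S. \<exists>\<delta>>0. \<exists>G. finite G \<and> (\<forall>g\<in>G. g holomorphic_on ball z \<delta>) \<and>
     (\<forall>u\<in>ball z \<delta>. Q u = (\<exists>g\<in>G. g u = 0)))"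

text \<open>Near every real point, \<open>Q\<close> extends to a complex neighbourhood, where away from the point itself
  it says that one of finitely many holomorphic functions vanishes. The exceptional points are needed
  because roots of \<open>\<chi>(t) = \<lambda>\<close> may collide there; the local functions are permuted by continuation
  around such a point, but the relation is not affected.\<close>

definition branch_relation :: "(real \<Rightarrow> bool) \<Rightarrow> bool" where
  "branch_relation Q \<longleftrightarrow> (\<forall>x0. \<exists>r>0. \<exists>Q'.
     (\<forall>x. 0 < \<bar>x - x0\<bar> \<longrightarrow> \<bar>x - x0\<bar> < r \<longrightarrow> Q x = Q' (complex_of_real x)) \<and>
     local_zeros Q' (ball (of_real x0) r - {of_real x0}))"

definition local_branches :: "(complex \<Rightarrow> complex set) \<Rightarrow> complex set \<Rightarrow> bool" where
  "local_branches B S \<longleftrightarrow> (\<forall>z\<in>S. \<exists>\<delta>>0. \<exists>H. finite H \<and> (\<forall>h\<in>H. h holomorphic_on ball z \<delta>) \<and>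
     (\<forall>u\<in>ball z \<delta>. B u = (\<lambda>h. h u) ` H))"

text \<open>Only the set \<open>A x\<close> has to be single-valued around \<open>x0\<close>:
  turning once around \<open>x0\<close> may permute its local branches. Nothing is required of
  \<open>A x0\<close>.\<close>

definition branch_family :: "(real \<Rightarrow> complex set) \<Rightarrow> bool" where
  "branch_family A \<longleftrightarrow> (\<forall>x0. \<exists>r>0. \<exists>B.
     (\<forall>x. 0 < \<bar>x - x0\<bar> \<longrightarrow> \<bar>x - x0\<bar> < r \<longrightarrow> A x = B (complex_of_real x)) \<and>
     local_branches B (ball (of_real x0) r - {of_real x0}))"

lemma local_branches_singleton:
  assumes "g holomorphic_on S" "open S" "T \<subseteq> S"
  shows "local_branches (\<lambda>u. {g u}) T"
  unfolding local_branches_def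
proof
  fix z assume "z \<in> T"
  then obtain \<delta> where "\<delta> > 0" "ball z \<delta> \<subseteq> S" using assms(2,3) open_contains_ball by blast
  then show "\<exists>\<delta>>0. \<exists>H. finite H \<and> (\<forall>h\<in>H. h holomorphic_on ball z \<delta>) \<and> (\<forall>u\<in>ball z \<delta>. {g u} = (\<lambda>h. h u) ` H)"
    using assms(1) by (intro exI[of _ \<delta>] conjI exI[of _ "{g}"]) (auto intro: holomorphic_on_subset)
qed

text \<open>By pigeonhole one of the finitely many zero sets accumulates at \<open>c\<close>, and
  the identity theorem applies to that function.\<close>

lemma finite_union_zero_sets:
  assumes "finite G" "\<And>g. g \<in> G \<Longrightarrow> g holomorphic_on ball z \<delta>"
    and c: "c \<in> ball z \<delta>" "c islimpt {u \<in> ball z \<delta>. \<exists>g\<in>G. g u = (0::complex)}"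
  shows "\<exists>g\<in>G. \<forall>u\<in>ball z \<delta>. g u = 0"
proof -
  have eq: "{u \<in> ball z \<delta>. \<exists>g\<in>G. g u = 0} = (\<Union>g\<in>G. {u \<in> ball z \<delta>. g u = 0})" by auto
  have "\<exists>g\<in>G. c islimpt {u \<in> ball z \<delta>. g u = 0}"
  proof -
    have "c islimpt (\<Union>g\<in>G. {u \<in> ball z \<delta>. g u = 0})" using c(2) eq by simp
    with \<open>finite G\<close> show ?thesis
      by (induction G rule: finite_induct) (auto simp: islimpt_Un)
  qed
  then obtain g where g: "g \<in> G" "c islimpt {u \<in> ball z \<delta>. g u = 0}" by blast
  have "g u = 0" if "u \<in> ball z \<delta>" for u
    by (rule analytic_continuation[OF assms(2)[OF g(1)] open_ball _ _ c(1) g(2) _ that]) auto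
  then show ?thesis using g(1) by blast
qed

text \<open>The accumulation points of the truth set form an open set by the identity theorem and a
  closed set in general, and a punctured disc is connected. This is how a relation gets past an
  exceptional real point: around it.\<close>

lemma branch_relation_punctured:
  assumes Q': "local_zeros Q' (ball a r - {a})"
    and c: "c \<in> ball a r - {a}" "c islimpt {u. Q' u}" and u: "u \<in> ball a r - {a}"
  shows "Q' u"
proof -
  let ?P = "ball a r - {a}"
  have key: "\<exists>\<delta>>0. ball z \<delta> \<subseteq> ?P \<and> (\<forall>u\<in>ball z \<delta>. Q' u)" if z: "z \<in> ?P" "z islimpt {u. Q' u}" for z
  proof -
    obtain \<delta> G where d: "\<delta> > 0" "finite G" "\<forall>g\<in>G. g holomorphic_on ball z \<delta>"
       "\<forall>u\<in>ball z \<delta>. Q' u = (\<exists>g\<in>G. g u = 0)" using Q' z(1) unfolding local_zeros_def by blast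
    have "z islimpt {u \<in> ball z \<delta>. \<exists>g\<in>G. g u = 0}"
    proof -
      have "z islimpt ({u. Q' u} \<inter> ball z \<delta>)"
        using z(2) by (rule islimpt_Int_eventually) (rule eventually_at_in_open', use d(1) in auto)
      moreover have "{u. Q' u} \<inter> ball z \<delta> = {u \<in> ball z \<delta>. \<exists>g\<in>G. g u = 0}" using d(4) by auto
      ultimately show ?thesis by simp
    qed
    then obtain g where "g \<in> G" "\<forall>u\<in>ball z \<delta>. g u = 0"
      using finite_union_zero_sets[OF d(2), of z \<delta> z] d by auto
    then have "\<forall>u\<in>ball z \<delta>. Q' u" using d(4) by blast
    moreover have "open ?P" by (simp add: open_delete)
    then obtain \<delta>' where "\<delta>' > 0" "ball z \<delta>' \<subseteq> ?P" using z(1) open_contains_ball by metis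
    ultimately show ?thesis using d(1)
      by (intro exI[of _ "min \<delta> \<delta>'"]) auto
  qed
  define T where "T = {z \<in> ?P. z islimpt {u. Q' u}}"
  have conn: "connected ?P"
    by (rule connected_open_delete) auto
  have "openin (top_of_set ?P) T"
  proof -
    have "open T"
    proof (subst open_contains_ball, intro ballI)
      fix z assume z: "z \<in> T"
      then obtain \<delta> where d: "\<delta> > 0" "ball z \<delta> \<subseteq> ?P" "\<forall>u\<in>ball z \<delta>. Q' u" using key T_def by blast
      have "y islimpt {u. Q' u}" if "y \<in> ball z \<delta>" for y
      proof -
        have "y islimpt ball z \<delta>" using that by (simp add: interior_limit_point)
        then show ?thesis using d(3) by (metis islimpt_subset mem_Collect_eq subsetI)
      qed
      then have "ball z \<delta> \<subseteq> T" unfolding T_def using d(2) by blast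
      then show "\<exists>\<epsilon>>0. ball z \<epsilon> \<subseteq> T" using d(1) by blast
    qed
    then show ?thesis by (simp add: T_def open_subset openin_open_eq subset_iff)
  qed
  moreover have "closedin (top_of_set ?P) T"
  proof -
    have "T = ?P \<inter> {z. z islimpt {u. Q' u}}" by (auto simp: T_def)
    moreover have "closed {z. z islimpt {u. Q' u}}" by (rule closed_limpts)
    ultimately show ?thesis by (metis closedin_closed_Int)
  qed
  moreover have "c \<in> T" using c T_def by simp
  ultimately have "T = ?P" using conn connected_clopen by blast
  then have "u \<in> T" using u by simp
  then have "u islimpt {u. Q' u}" unfolding T_def by blast
  then obtain \<delta> where "\<delta> > 0" "\<forall>v\<in>ball u \<delta>. Q' v" using key[OF u] by blast
  then show ?thesis by simp
qed

text \<open>The set \<open>S\<close> of reals with a punctured neighbourhood on which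
  \<open>Q\<close> holds is open and closed. \<open>Q\<close> may fail at isolated points, hence a
  conclusion that leaves out \<open>x0\<close>.\<close>

lemma branch_relation_propagate:
  assumes Q: "branch_relation Q" and ab: "a < b" "\<And>x. a < x \<Longrightarrow> x < b \<Longrightarrow> Q x"
  shows "\<exists>\<epsilon>>0. \<forall>x. x0 < x \<longrightarrow> x < x0 + \<epsilon> \<longrightarrow> Q x"
proof -
  define S where "S = {x0. \<exists>\<epsilon>>0. \<forall>x. 0 < \<bar>x - x0\<bar> \<longrightarrow> \<bar>x - x0\<bar> < \<epsilon> \<longrightarrow> Q x}"
  have main: "\<exists>r>0. (\<exists>c d. c < d \<and> x0 - r < c \<and> d < x0 + r \<and> (\<forall>x. c < x \<longrightarrow> x < d \<longrightarrow> Q x)) \<longrightarrow>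
      (\<forall>x. 0 < \<bar>x - x0\<bar> \<longrightarrow> \<bar>x - x0\<bar> < r \<longrightarrow> Q x)" for x0
  proof -
    obtain r Q' where r: "r > 0" "\<forall>x. 0 < \<bar>x - x0\<bar> \<longrightarrow> \<bar>x - x0\<bar> < r \<longrightarrow> Q x = Q' (complex_of_real x)"
      and G: "local_zeros Q' (ball (of_real x0) r - {of_real x0})"
      using Q[unfolded branch_relation_def, rule_format, of x0] by blast
    have "Q x" if cd: "c < d" "x0 - r < c" "d < x0 + r" "\<forall>x. c < x \<longrightarrow> x < d \<longrightarrow> Q x"
       and x: "0 < \<bar>x - x0\<bar>" "\<bar>x - x0\<bar> < r" for c d x
    proof -
      \<comment> \<open>A subinterval on one side of \<open>x0\<close>, since \<open>Q\<close> and
        \<open>Q'\<close> are not compared at \<open>x0\<close> itself.\<close>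
      obtain m m' where m: "c < m" "m < m'" "m' < d" "m \<ge> x0 \<or> m' \<le> x0"
      proof (cases "(c + d)/2 \<ge> x0")
        case True then show ?thesis using cd(1) that[of "(c+d)/2" "((c+d)/2+d)/2"] by (auto simp: field_simps)
      next
        case False then show ?thesis using cd(1) that[of "(c+(c+d)/2)/2" "(c+d)/2"] by (auto simp: field_simps)
      qed
      define y where "y = (m + m')/2"
      have y: "m < y" "y < m'" using m by (auto simp: y_def)
      have im: "of_real y islimpt (complex_of_real ` {m<..<m'})"
      proof (rule islimpt_isCont_image)
        show "y islimpt {m<..<m'}" using y by (simp add: interior_limit_point interior_open)
        show "isCont complex_of_real y" by simp
        show "\<forall>\<^sub>F z in at y. complex_of_real z \<noteq> complex_of_real y"
          by (simp add: eventually_at_filter)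
      qed
      have sub: "complex_of_real ` {m<..<m'} \<subseteq> {u. Q' u}"
      proof clarify
        fix v assume v: "v \<in> {m<..<m'}"
        then have "Q v" "0 < \<bar>v - x0\<bar>" "\<bar>v - x0\<bar> < r" using cd m by auto
        then show "Q' (of_real v)" using r(2) by blast
      qed
      have mem: "complex_of_real v \<in> ball (of_real x0) r - {of_real x0}" if "0 < \<bar>v - x0\<bar>" "\<bar>v - x0\<bar> < r" for v
        using that by (auto simp: dist_norm norm_minus_commute simp flip: of_real_diff)
      have "Q' (of_real x)"
      proof (rule branch_relation_punctured[OF G])
        show "complex_of_real y \<in> ball (of_real x0) r - {of_real x0}"
          using y m cd by (intro mem) auto
        show "complex_of_real x \<in> ball (of_real x0) r - {of_real x0}" using x by (rule mem)
        show "of_real y islimpt {u. Q' u}" using im sub islimpt_subset by blast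
      qed
      then show ?thesis using r(2) x by blast
    qed
    then show ?thesis using r(1) by blast
  qed
  have main2: "\<exists>r>0. \<forall>y\<in>S. \<bar>y - x0\<bar> < r \<longrightarrow> x0 \<in> S" for x0
  proof -
    obtain r where r: "r > 0" "(\<exists>c d. c < d \<and> x0 - r < c \<and> d < x0 + r \<and> (\<forall>x. c < x \<longrightarrow> x < d \<longrightarrow> Q x)) \<longrightarrow>
      (\<forall>x. 0 < \<bar>x - x0\<bar> \<longrightarrow> \<bar>x - x0\<bar> < r \<longrightarrow> Q x)" using main by blast
    have "x0 \<in> S" if y: "y \<in> S" "\<bar>y - x0\<bar> < r" for y
    proof -
      obtain \<epsilon> where e: "\<epsilon> > 0" "\<forall>x. 0 < \<bar>x - y\<bar> \<longrightarrow> \<bar>x - y\<bar> < \<epsilon> \<longrightarrow> Q x" using y S_def by blast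
      define d where "d = min (y + \<epsilon>) ((y + x0 + r)/2)"
      have "y < d" "d < x0 + r" "d \<le> y + \<epsilon>" using y e(1) r(1) by (auto simp: d_def min_def)
      then have "\<forall>x. y < x \<longrightarrow> x < d \<longrightarrow> Q x" using e(2) by auto
      moreover have "x0 - r < y" using y by auto
      ultimately show ?thesis using r \<open>y < d\<close> \<open>d < x0 + r\<close> S_def by blast
    qed
    then show ?thesis using r(1) by blast
  qed
  have "open S"
  proof (subst open_contains_ball, intro ballI)
    fix x0 assume "x0 \<in> S"
    then obtain \<epsilon> where e: "\<epsilon> > 0" "\<forall>x. 0 < \<bar>x - x0\<bar> \<longrightarrow> \<bar>x - x0\<bar> < \<epsilon> \<longrightarrow> Q x" using S_def by blast
    have "y \<in> S" if "\<bar>y - x0\<bar> < \<epsilon>" "y \<noteq> x0" for y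
    proof -
      define \<eta> where "\<eta> = min (\<epsilon> - \<bar>y - x0\<bar>) \<bar>y - x0\<bar>"
      have "\<eta> > 0" using that by (auto simp: \<eta>_def)
      moreover have "Q x" if "\<bar>x - y\<bar> < \<eta>" for x
      proof -
        have "0 < \<bar>x - x0\<bar>" "\<bar>x - x0\<bar> < \<epsilon>" using that unfolding \<eta>_def by linarith+
        then show ?thesis using e(2) by blast
      qed
      ultimately show ?thesis unfolding S_def by blast
    qed
    then have "ball x0 \<epsilon> \<subseteq> S" using \<open>x0 \<in> S\<close> by (force simp: dist_real_def)
    then show "\<exists>\<epsilon>>0. ball x0 \<epsilon> \<subseteq> S" using e(1) by blast
  qed
  moreover have "closed S"
  proof -
    have "x0 \<in> S" if "x0 islimpt S" for x0
    proof -
      obtain r where r: "r > 0" "\<forall>y\<in>S. \<bar>y - x0\<bar> < r \<longrightarrow> x0 \<in> S" using main2 by blast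
      from that r(1) obtain y where "y \<in> S" "dist y x0 < r" by (meson islimpt_approachable)
      then show ?thesis using r(2) by (auto simp: dist_real_def)
    qed
    then show ?thesis by (simp add: closed_limpt)
  qed
  moreover have "(a + b)/2 \<in> S"
  proof -
    have "Q x" if "\<bar>x - (a+b)/2\<bar> < (b-a)/2" for x
      using that by (intro ab(2)) (auto simp: abs_if field_simps split: if_splits)
    then show ?thesis unfolding S_def using ab(1) by (auto intro!: exI[of _ "(b-a)/2"])
  qed
  ultimately have "S = UNIV" using clopen by blast
  then obtain \<epsilon> where "\<epsilon> > 0" "\<forall>x. 0 < \<bar>x - x0\<bar> \<longrightarrow> \<bar>x - x0\<bar> < \<epsilon> \<longrightarrow> Q x" using S_def by blast
  then show ?thesis by (intro exI[of _ \<epsilon>]) auto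
qed

text \<open>Locally the relation is the union, over all quadruples of branches, of the zero sets of
  a b - c d. Two factors on each side cover both relations continued later: the equality of the
  ratios of the positive roots, and the relation between roots of different kinds behind
  \<open>degree_dvd\<close>.\<close>

lemma branch_relation_product_eq:
  assumes "branch_family A" "branch_family B" "branch_family C" "branch_family D"
  shows "branch_relation (\<lambda>x. \<exists>a\<in>A x. \<exists>b\<in>B x. \<exists>c\<in>C x. \<exists>d\<in>D x. a * b = c * d)"
  unfolding branch_relation_def
proof (intro allI)
  fix x0 :: real
  let ?z0 = "complex_of_real x0"
  define L where "L A r B \<longleftrightarrow> r > 0 \<and> (\<forall>x. 0 < \<bar>x - x0\<bar> \<longrightarrow> \<bar>x - x0\<bar> < r \<longrightarrow> A x = B (complex_of_real x)) \<and>
     local_branches B (ball ?z0 r - {?z0})" for A r and B :: "complex \<Rightarrow> complex set"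
  have fam: "\<exists>r B. L A r B" if "branch_family A" for A
    using that[unfolded branch_family_def, rule_format, of x0] unfolding L_def by blast
  obtain r1 A' where 1: "L A r1 A'" using fam assms by blast
  obtain r2 B' where 2: "L B r2 B'" using fam assms by blast
  obtain r3 C' where 3: "L C r3 C'" using fam assms by blast
  obtain r4 D' where 4: "L D r4 D'" using fam assms by blast
  define r where "r = Min {r1,r2,r3,r4}"
  have r: "r > 0" "r \<le> r1" "r \<le> r2" "r \<le> r3" "r \<le> r4" using 1 2 3 4 by (simp_all add: r_def L_def)
  define Q' where "Q' u \<longleftrightarrow> (\<exists>a\<in>A' u. \<exists>b\<in>B' u. \<exists>c\<in>C' u. \<exists>d\<in>D' u. a * b = c * d)" for u
  have A1: "(\<exists>a\<in>A x. \<exists>b\<in>B x. \<exists>c\<in>C x. \<exists>d\<in>D x. a * b = c * d) = Q' (of_real x)"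
    if "0 < \<bar>x - x0\<bar>" "\<bar>x - x0\<bar> < r" for x
    using 1 2 3 4 that r by (auto simp: L_def Q'_def)
  have A2: "\<exists>\<delta>>0. \<exists>G. finite G \<and> (\<forall>g\<in>G. g holomorphic_on ball z \<delta>) \<and> (\<forall>u\<in>ball z \<delta>. Q' u = (\<exists>g\<in>G. g u = 0))"
    if z: "z \<in> ball ?z0 r - {?z0}" for z
  proof -
    define M where "M B \<delta> H \<longleftrightarrow> \<delta> > 0 \<and> finite H \<and> (\<forall>h\<in>H. h holomorphic_on ball z \<delta>) \<and>
       (\<forall>u\<in>ball z \<delta>. B u = (\<lambda>h. h u) ` H)" for B :: "complex \<Rightarrow> complex set" and \<delta> H
    have "\<exists>\<delta> H. M B \<delta> H" if "L A s B" "r \<le> s" for A s B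
    proof -
      have "z \<in> ball ?z0 s - {?z0}" using z that(2) by auto
      then show ?thesis using that(1) unfolding L_def M_def local_branches_def by blast
    qed
    then obtain d1 H1 d2 H2 d3 H3 d4 H4 where H: "M A' d1 H1" "M B' d2 H2" "M C' d3 H3" "M D' d4 H4"
      using 1 2 3 4 r by meson
    define \<delta> where "\<delta> = Min {d1,d2,d3,d4}"
    have d: "\<delta> > 0" "\<delta> \<le> d1" "\<delta> \<le> d2" "\<delta> \<le> d3" "\<delta> \<le> d4" using H by (simp_all add: \<delta>_def M_def)
    define G where "G = (\<lambda>(a,b,c,d). \<lambda>u. a u * b u - c u * d u) ` (H1 \<times> H2 \<times> H3 \<times> H4)"
    have "finite G" using H by (auto simp: G_def M_def)
    moreover have "g holomorphic_on ball z \<delta>" if g: "g \<in> G" for g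
    proof -
      obtain a b c d' where g': "a \<in> H1" "b \<in> H2" "c \<in> H3" "d' \<in> H4" "g = (\<lambda>u. a u * b u - c u * d' u)"
        using g by (auto simp: G_def)
      have "a holomorphic_on ball z \<delta>" using H(1) d g'(1) unfolding M_def
        by (meson holomorphic_on_subset subset_ball)
      moreover have "b holomorphic_on ball z \<delta>" using H(2) d g'(2) unfolding M_def
        by (meson holomorphic_on_subset subset_ball)
      moreover have "c holomorphic_on ball z \<delta>" using H(3) d g'(3) unfolding M_def
        by (meson holomorphic_on_subset subset_ball)
      moreover have "d' holomorphic_on ball z \<delta>" using H(4) d g'(4) unfolding M_def
        by (meson holomorphic_on_subset subset_ball)
      ultimately show ?thesis unfolding g'(5) by (intro holomorphic_intros)
    qed
    moreover have "Q' u = (\<exists>g\<in>G. g u = 0)" if u: "u \<in> ball z \<delta>" for u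
    proof -
      have "A' u = (\<lambda>h. h u) ` H1" "B' u = (\<lambda>h. h u) ` H2" "C' u = (\<lambda>h. h u) ` H3" "D' u = (\<lambda>h. h u) ` H4"
        using H u d unfolding M_def by auto
      then show ?thesis by (simp add: Q'_def G_def)
    qed
    ultimately show ?thesis using d(1) by blast
  qed
  show "\<exists>r>0. \<exists>Q'. (\<forall>x. 0 < \<bar>x - x0\<bar> \<longrightarrow> \<bar>x - x0\<bar> < r \<longrightarrow>
       (\<exists>a\<in>A x. \<exists>b\<in>B x. \<exists>c\<in>C x. \<exists>d\<in>D x. a * b = c * d) = Q' (complex_of_real x)) \<and>
     local_zeros Q' (ball ?z0 r - {?z0})"
    unfolding local_zeros_def
    by (rule exI[of _ r], rule conjI[OF r(1)], rule exI[of _ Q'], intro conjI allI ballI impI)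
      (erule (1) A1, erule A2)
qed

lemma islimpt_of_real_pos:
  assumes "0 < \<epsilon>" shows "0 islimpt complex_of_real ` {0<..<\<epsilon>}"
proof -
  have "complex_of_real 0 islimpt complex_of_real ` {0<..<\<epsilon>}"
    by (rule islimpt_isCont_image) (use assms in \<open>auto simp: islimpt_greaterThanLessThan1 eventually_at_filter\<close>)
  then show ?thesis by simp
qed

lemma power_in_ball: "w \<in> ball 0 \<rho> \<Longrightarrow> \<rho> < 1 \<Longrightarrow> 0 < a \<Longrightarrow> w ^ a \<in> ball (0::complex) \<rho>"
proof -
  assume w: "w \<in> ball 0 \<rho>" "\<rho> < 1" "0 < a"
  then have "norm w ^ a \<le> norm w ^ 1" by (intro power_decreasing) auto
  then show ?thesis using w by (simp add: norm_power)
qed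

subsection \<open>The shape of an unbiased walk\<close>

definition cpoly :: "real poly \<Rightarrow> complex poly" where
  "cpoly p = map_poly of_real p"

lemma coeff_cpoly [simp]: "coeff (cpoly p) k = of_real (coeff p k)"
  by (simp add: cpoly_def coeff_map_poly)

lemma degree_cpoly [simp]: "degree (cpoly p) = degree p"
  by (simp add: cpoly_def degree_map_poly)

lemma poly_cpoly: "poly (cpoly p) z = (\<Sum>k\<le>degree p. of_real (coeff p k) * z ^ k)"
  by (simp add: poly_altdef)

lemma poly_cpoly_of_real: "poly (cpoly p) (of_real t) = of_real (poly p t)"
  by (simp add: poly_altdef)

text \<open>In the intended use \<open>p\<close> is \<chi> multiplied by t^e, an ordinary polynomial
  with nonzero constant term, and \<open>degree p - e\<close> is f.\<close>

definition chi :: "real poly \<Rightarrow> nat \<Rightarrow> complex \<Rightarrow> complex" where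
  "chi p e z = poly (cpoly p) z / z ^ e"

definition rchi :: "real poly \<Rightarrow> nat \<Rightarrow> real \<Rightarrow> real" where
  "rchi p e t = poly p t / t ^ e"

lemma chi_of_real: "chi p e (of_real t) = of_real (rchi p e t)"
  by (simp add: chi_def rchi_def poly_cpoly_of_real)

lemma power_divide_eq_powi:
  assumes "z \<noteq> (0::'a::field)"
  shows "z ^ k / z ^ e = z powi (int k - int e)"
  using assms by (simp add: power_int_diff)

lemma chi_eq_sum:
  assumes "z \<noteq> 0"
  shows "chi p e z = (\<Sum>k\<le>degree p. of_real (coeff p k) * z powi (int k - int e))"
  by (simp add: chi_def poly_cpoly sum_divide_distrib power_divide_eq_powi[OF assms, symmetric])

lemma rchi_eq_sum:
  assumes "t \<noteq> 0"
  shows "rchi p e t = (\<Sum>k\<le>degree p. coeff p k * t powi (int k - int e))"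
  by (simp add: rchi_def poly_altdef sum_divide_distrib power_divide_eq_powi[OF assms, symmetric])

lemma poly_pderiv_1: "poly (pderiv p) 1 = (\<Sum>k\<le>degree p. coeff p k * real k)"
proof (cases "degree p")
  case 0
  then show ?thesis by (auto elim!: degree_eq_zeroE)
next
  case (Suc m)
  have "poly (pderiv p) 1 = (\<Sum>i\<le>m. coeff (pderiv p) i)"
    by (simp add: poly_altdef degree_pderiv Suc)
  also have "\<dots> = (\<Sum>i\<le>m. of_nat (Suc i) * coeff p (Suc i))"
    by (simp add: coeff_pderiv)
  also have "\<dots> = (\<Sum>i\<le>Suc m. of_nat i * coeff p i)"
    by (simp only: sum.atMost_Suc_shift)
  finally show ?thesis by (simp add: Suc mult.commute)
qed

text \<open>Parametrising by \<open>x\<close> with \<open>\<lambda> = 1 + x\<^sup>2\<close> resolves the square root singularity at \<open>\<lambda> = 1\<close>: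
  the positive roots of \<open>\<chi>(t) = \<lambda>\<close> are \<open>tau p e x\<close> and \<open>tau p e (- x)\<close>, and \<open>x \<mapsto> - x\<close>
  is the continuation once around \<open>\<lambda> = 1\<close>.\<close>

definition tau :: "real poly \<Rightarrow> nat \<Rightarrow> real \<Rightarrow> real" where
  "tau p e x = (THE t. t > 0 \<and> rchi p e t = 1 + x\<^sup>2 \<and> sgn (t - 1) = sgn x)"

text \<open>\<open>unbiased\<close> is \<chi>'(1) = 0 expressed through p. \<open>aperiodic\<close>
  is the form in which "the support of \<chi> has gcd 1" is used: no other point of the unit circle
  makes all monomials of \<chi> equal to 1.\<close>

locale walk_poly =
  fixes p :: "real poly" and e :: nat
  assumes coeff_nonneg: "\<And>k. coeff p k \<ge> 0"
    and total: "poly p 1 = 1"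
    and unbiased: "poly (pderiv p) 1 = real e"
    and const_pos: "coeff p 0 > 0"
    and e_pos: "0 < e"
    and e_less: "e < degree p"
    and aperiodic: "\<And>y::complex. norm y = 1 \<Longrightarrow> (\<And>k. coeff p k \<noteq> 0 \<Longrightarrow> y ^ k = y ^ e) \<Longrightarrow> y = 1"
begin

lemma p_nonzero: "p \<noteq> 0"
  using const_pos by auto

lemma lead_pos: "coeff p (degree p) > 0"
  using coeff_nonneg[of "degree p"] p_nonzero by (simp add: less_le)

lemma sum_coeff: "(\<Sum>k\<le>degree p. coeff p k) = 1"
  using total by (simp add: poly_altdef)

lemma sum_coeff_drift: "(\<Sum>k\<le>degree p. coeff p k * (int k - int e)) = 0"
proof -
  have "(\<Sum>k\<le>degree p. coeff p k * (int k - int e))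
      = (\<Sum>k\<le>degree p. coeff p k * real k) - real e * (\<Sum>k\<le>degree p. coeff p k)"
    by (simp add: algebra_simps sum_subtractf sum_distrib_left)
  then show ?thesis using unbiased sum_coeff by (simp add: poly_pderiv_1)
qed

lemma norm_chi_le:
  assumes "z \<noteq> 0" shows "norm (chi p e z) \<le> rchi p e (norm z)"
proof -
  have "norm (chi p e z) \<le> (\<Sum>k\<le>degree p. norm (of_real (coeff p k) * z powi (int k - int e)))"
    unfolding chi_eq_sum[OF assms] by (rule norm_sum)
  also have "\<dots> = rchi p e (norm z)"
    using assms by (subst rchi_eq_sum) (auto simp: norm_mult norm_power_int coeff_nonneg)
  finally show ?thesis .
qed

text \<open>Equality in the triangle inequality puts all terms on the positive axis: the direction
  \<open>u\<close> of \<open>z\<close>, raised to any exponent in the support, gives 1, and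
  \<open>aperiodic\<close> applies.\<close>

lemma chi_eq_rchi_norm:
  assumes z: "z \<noteq> 0" and eq: "chi p e z = of_real (rchi p e (norm z))"
  shows "z = of_real (norm z)"
proof -
  define t where "t = norm z"
  define u where "u = z / of_real t"
  have t: "t > 0" using z by (simp add: t_def)
  have u: "norm u = 1" "u \<noteq> 0" "z = of_real t * u" using z by (auto simp: u_def t_def norm_divide)
  define a where "a k = coeff p k * t powi (int k - int e)" for k
  have a0: "a k \<ge> 0" for k using coeff_nonneg t by (simp add: a_def)
  have "chi p e z = (\<Sum>k\<le>degree p. of_real (a k) * u powi (int k - int e))"
    using z u(2) t by (simp add: chi_eq_sum u(3) power_int_mult_distrib a_def mult.assoc)
  moreover have "rchi p e t = (\<Sum>k\<le>degree p. a k)" using t by (simp add: rchi_eq_sum a_def)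
  ultimately have "Re (\<Sum>k\<le>degree p. of_real (a k) * u powi (int k - int e)) = (\<Sum>k\<le>degree p. a k)"
    using eq by (metis Re_complex_of_real t_def)
  then have "(\<Sum>k\<le>degree p. a k * Re (u powi (int k - int e))) = (\<Sum>k\<le>degree p. a k)"
    by simp
  then have "(\<Sum>k\<le>degree p. a k * (1 - Re (u powi (int k - int e)))) = 0"
    by (simp add: algebra_simps sum_subtractf)
  moreover have nu: "norm (u powi m) = 1" for m using u by (simp add: norm_power_int)
  have "0 \<le> a k * (1 - Re (u powi (int k - int e)))" for k
    using a0 complex_Re_le_cmod[of "u powi (int k - int e)"] nu by simp
  ultimately have z0: "a k * (1 - Re (u powi (int k - int e))) = 0" if "k \<le> degree p" for k
    using that by (subst (asm) sum_nonneg_eq_0_iff) auto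
  have "u ^ k = u ^ e" if k: "coeff p k \<noteq> 0" for k
  proof -
    have "a k \<noteq> 0" using k t by (simp add: a_def)
    then have "Re (u powi (int k - int e)) = 1" using z0[of k] k by (simp add: le_degree)
    then have "u powi (int k - int e) = 1" using nu[of "int k - int e"]
      by (metis cmod_eq_Re complex_eq_iff one_complex.simps cmod_power2 add_cancel_right_right power2_eq_iff power_one power_zero_numeral zero_eq_power2)
    then have "u ^ k / u ^ e = 1" using u(2) by (simp add: power_divide_eq_powi)
    then show ?thesis using u(2) by (simp add: field_simps)
  qed
  then have "u = 1" by (rule aperiodic[OF u(1)])
  then show ?thesis using u(3) t_def by simp
qed

text \<open>This is t \<chi>'(t), the derivative of \<chi> with respect to log t; its monotonicity
  is convexity of \<chi> in log t.\<close>

definition drift :: "real \<Rightarrow> real" where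
  "drift t = (\<Sum>k\<le>degree p. coeff p k * (int k - int e) * t powi (int k - int e))"

lemma drift_1: "drift 1 = 0"
  using sum_coeff_drift by (simp add: drift_def)

lemma rchi_deriv:
  assumes "t > 0"
  shows "(rchi p e has_real_derivative drift t / t) (at t)"
proof -
  have "((\<lambda>t. \<Sum>k\<le>degree p. coeff p k * t powi (int k - int e)) has_real_derivative
      (\<Sum>k\<le>degree p. coeff p k * ((int k - int e) * t powi (int k - int e - 1)))) (at t)"
    using assms by (auto intro!: derivative_eq_intros sum.cong)
  also have "(\<Sum>k\<le>degree p. coeff p k * ((int k - int e) * t powi (int k - int e - 1))) = drift t / t"
    using assms by (simp add: drift_def sum_divide_distrib power_int_diff mult.assoc)
  finally show ?thesis
  proof (rule has_field_derivative_transform_within_open)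
    show "open {0::real<..}" by simp
    show "t \<in> {0<..}" using assms by simp
    show "\<And>x. x \<in> {0<..} \<Longrightarrow> (\<Sum>k\<le>degree p. coeff p k * x powi (int k - int e)) = rchi p e x"
      by (simp add: rchi_eq_sum)
  qed
qed

text \<open>For t > 0 each m t^m is nondecreasing whatever the sign of m, and the lowest term m = -e
  makes it strict. So \<chi> falls up to t = 1 and rises afterwards, which leaves exactly two
  positive roots for each \<lambda> > 1.\<close>

lemma drift_strict_mono:
  assumes "0 < s" "s < t"
  shows "drift s < drift t"
  unfolding drift_def
proof (rule sum_strict_mono_ex1)
  have mono: "(int k - int e) * s powi (int k - int e) \<le> (int k - int e) * t powi (int k - int e)" for k
  proof (cases "k \<ge> e")
    case True
    then have "s powi (int k - int e) \<le> t powi (int k - int e)"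
      using assms by (intro power_int_mono) auto
    then show ?thesis using True by (intro mult_left_mono) auto
  next
    case False
    then have "t powi (int k - int e) \<le> s powi (int k - int e)"
      using assms by (intro power_int_antimono) auto
    then show ?thesis using False by (intro mult_left_mono_neg) auto
  qed
  show "\<forall>k\<in>{..degree p}. coeff p k * (int k - int e) * s powi (int k - int e)
      \<le> coeff p k * (int k - int e) * t powi (int k - int e)"
    using mult_left_mono[OF mono coeff_nonneg] by (simp add: mult.assoc)
  have "t powi (- int e) < s powi (- int e)"
    using assms e_pos by (simp add: power_int_minus field_simps power_strict_mono)
  then have "coeff p 0 * (int 0 - int e) * s powi (int 0 - int e) < coeff p 0 * (int 0 - int e) * t powi (int 0 - int e)"
    using const_pos e_pos by (intro mult_strict_left_mono_neg) (auto simp: mult_pos_neg)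
  then show "\<exists>k\<in>{..degree p}. coeff p k * (int k - int e) * s powi (int k - int e)
      < coeff p k * (int k - int e) * t powi (int k - int e)"
    by (intro bexI[of _ 0]) auto
qed simp

lemma drift_neg: "0 < t \<Longrightarrow> t < 1 \<Longrightarrow> drift t < 0"
  using drift_strict_mono[of t 1] drift_1 by simp

lemma drift_pos: "1 < t \<Longrightarrow> drift t > 0"
  using drift_strict_mono[of 1 t] drift_1 by simp

lemma rchi_1: "rchi p e 1 = 1"
  using total by (simp add: rchi_def)

lemma rchi_cont: "0 < t \<Longrightarrow> isCont (rchi p e) t"
  using rchi_deriv DERIV_isCont by blast

lemma rchi_decreasing:
  assumes "0 < s" "s < t" "t \<le> 1"
  shows "rchi p e t < rchi p e s"
proof (rule DERIV_neg_imp_decreasing_open[OF assms(2)])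
  fix x assume "s < x" "x < t"
  then show "\<exists>y. (rchi p e has_real_derivative y) (at x) \<and> y < 0"
    using rchi_deriv[of x] drift_neg[of x] assms by (intro exI[of _ "drift x / x"]) (auto simp: divide_neg_pos)
next
  show "continuous_on {s..t} (rchi p e)"
    using rchi_cont assms by (intro continuous_at_imp_continuous_on) auto
qed

lemma rchi_increasing:
  assumes "1 \<le> s" "s < t"
  shows "rchi p e s < rchi p e t"
proof (rule DERIV_pos_imp_increasing_open[OF assms(2)])
  fix x assume "s < x" "x < t"
  then show "\<exists>y. (rchi p e has_real_derivative y) (at x) \<and> 0 < y"
    using rchi_deriv[of x] drift_pos[of x] assms by (intro exI[of _ "drift x / x"]) auto
next
  show "continuous_on {s..t} (rchi p e)"
    using rchi_cont assms by (intro continuous_at_imp_continuous_on) auto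
qed

lemma rchi_gt_1: "0 < t \<Longrightarrow> t \<noteq> 1 \<Longrightarrow> rchi p e t > 1"
  using rchi_decreasing[of t 1] rchi_increasing[of 1 t] rchi_1 by (cases "t < 1") auto

lemma rchi_ge_term:
  assumes "t > 0" "k \<le> degree p"
  shows "coeff p k * t powi (int k - int e) \<le> rchi p e t"
  using assms coeff_nonneg by (subst rchi_eq_sum) (auto intro!: member_le_sum mult_nonneg_nonneg)

lemma rchi_attains_below:
  assumes "y \<ge> 1" shows "\<exists>t. 0 < t \<and> t \<le> 1 \<and> rchi p e t = y"
proof -
  \<comment> \<open>Small enough for the lowest term alone to reach \<open>y\<close>: for s \<le> 1
    that term is at least \<open>coeff p 0 / s\<close>.\<close>
  define s where "s = min 1 (coeff p 0 / y)"
  have s: "0 < s" "s \<le> 1" "s \<le> coeff p 0 / y" using const_pos assms by (auto simp: s_def)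
  have "s powi (- int e) \<ge> s powi (-1)"
    using s e_pos by (simp add: power_int_minus) (metis One_nat_def Suc_leI le_imp_inverse_le less_eq_real_def power_decreasing power_one_right zero_less_power)
  then have "coeff p 0 * s powi (- int e) \<ge> coeff p 0 * (1/s)" 
    using const_pos by (intro mult_left_mono) (auto simp: power_int_minus divide_inverse)
  moreover have "coeff p 0 * (1/s) \<ge> y" using s assms const_pos by (simp add: field_simps)
  ultimately have "rchi p e s \<ge> y" using rchi_ge_term[OF s(1), of 0] by simp
  then have "\<exists>t. s \<le> t \<and> t \<le> 1 \<and> rchi p e t = y"
    using s assms rchi_1 rchi_cont by (intro IVT2) auto
  then obtain t where "s \<le> t" "t \<le> 1" "rchi p e t = y" by blast
  then show ?thesis using s(1) by (intro exI[of _ t]) auto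
qed

lemma rchi_attains_above:
  assumes "y \<ge> 1" shows "\<exists>t\<ge>1. rchi p e t = y"
proof -
  define s where "s = max 1 (y / coeff p (degree p))"
  have s: "1 \<le> s" "s \<ge> y / coeff p (degree p)" by (auto simp: s_def)
  have "s powi (int (degree p) - int e) \<ge> s powi 1"
    using s e_less by (intro power_int_increasing) auto
  then have "coeff p (degree p) * s powi (int (degree p) - int e) \<ge> coeff p (degree p) * s" 
    using lead_pos by (intro mult_left_mono) auto
  moreover have "coeff p (degree p) * s \<ge> y" using s lead_pos by (simp add: field_simps)
  ultimately have "rchi p e s \<ge> y" using rchi_ge_term[of s "degree p"] s by simp
  then have "\<exists>t. 1 \<le> t \<and> t \<le> s \<and> rchi p e t = y"
    using s assms rchi_1 rchi_cont by (intro IVT) auto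
  then show ?thesis by auto
qed

lemma rchi_inj_side:
  assumes "0 < s" "0 < t" "sgn (s - 1) = sgn (t - 1)" "rchi p e s = rchi p e t"
  shows "s = t"
proof (rule ccontr)
  assume ne: "s \<noteq> t"
  have "(s < 1 \<and> t < 1) \<or> (s = 1 \<and> t = 1) \<or> (s > 1 \<and> t > 1)"
    using assms(3) by (auto simp: sgn_real_def split: if_splits)
  then show False
    using ne assms rchi_decreasing[of s t] rchi_decreasing[of t s] rchi_increasing[of s t] rchi_increasing[of t s]
    by (cases "s < t") auto
qed

lemma tau_ex1: "\<exists>!t. t > 0 \<and> rchi p e t = 1 + x\<^sup>2 \<and> sgn (t - 1) = sgn x"
proof (rule ex_ex1I)
  consider "x < 0" | "x = 0" | "x > 0" by linarith
  then show "\<exists>t. t > 0 \<and> rchi p e t = 1 + x\<^sup>2 \<and> sgn (t - 1) = sgn x"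
  proof cases
    case 1
    obtain t where t: "0 < t" "t \<le> 1" "rchi p e t = 1 + x\<^sup>2" using rchi_attains_below[of "1 + x\<^sup>2"] by auto
    then have "t \<noteq> 1" using 1 rchi_1 by auto
    then show ?thesis using t 1 by (intro exI[of _ t]) (auto simp: sgn_real_def)
  next
    case 2 then show ?thesis using rchi_1 by (intro exI[of _ 1]) auto
  next
    case 3
    obtain t where t: "1 \<le> t" "rchi p e t = 1 + x\<^sup>2" using rchi_attains_above[of "1 + x\<^sup>2"] by auto
    then have "t \<noteq> 1" using 3 rchi_1 by auto
    then show ?thesis using t 3 by (intro exI[of _ t]) (auto simp: sgn_real_def)
  qed
qed (use rchi_inj_side in auto)

lemma tau_pos: "tau p e x > 0" and rchi_tau: "rchi p e (tau p e x) = 1 + x\<^sup>2"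
  and sgn_tau: "sgn (tau p e x - 1) = sgn x"
  using theI'[OF tau_ex1[of x]] unfolding tau_def by blast+

lemma tau_eqI: "t > 0 \<Longrightarrow> rchi p e t = 1 + x\<^sup>2 \<Longrightarrow> sgn (t - 1) = sgn x \<Longrightarrow> tau p e x = t"
  unfolding tau_def by (rule the1_equality[OF tau_ex1]) auto

lemma tau_0: "tau p e 0 = 1"
  by (rule tau_eqI) (auto simp: rchi_1)

lemma tau_lt_1: "x < 0 \<Longrightarrow> tau p e x < 1" and tau_gt_1: "x > 0 \<Longrightarrow> tau p e x > 1"
  using sgn_tau[of x] by (auto simp: sgn_real_def split: if_splits)

lemma tau_surj:
  assumes "t > 0" shows "\<exists>x. tau p e x = t \<and> (1 + x\<^sup>2 = rchi p e t)"
proof -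
  define x where "x = sgn (t - 1) * sqrt (rchi p e t - 1)"
  have "rchi p e t \<ge> 1" using rchi_gt_1[of t] rchi_1 assms by (cases "t = 1") auto
  then have x2: "1 + x\<^sup>2 = rchi p e t"
    using rchi_1 by (cases "t = 1") (auto simp: x_def power_mult_distrib sgn_real_def)
  have "sgn (t - 1) = sgn x"
    using rchi_gt_1[of t] assms by (cases "t = 1") (auto simp: x_def sgn_mult)
  then show ?thesis using x2 tau_eqI[of t x] assms by auto
qed

lemma pos_root_eq_tau:
  assumes "t > 0" "rchi p e t = 1 + x\<^sup>2" shows "t = tau p e x \<or> t = tau p e (- x)"
proof -
  obtain y where y: "tau p e y = t" "1 + y\<^sup>2 = rchi p e t" using tau_surj[OF assms(1)] by blast
  then have "y = x \<or> y = - x" using assms(2) by (simp add: power2_eq_iff)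
  then show ?thesis using y by auto
qed

lemma tau_strict_mono: "x < y \<Longrightarrow> tau p e x < tau p e y"
proof -
  assume xy: "x < y"
  show ?thesis
  proof (cases "x < 0 \<and> 0 < y \<or> x = 0 \<or> y = 0")
    case True
    then show ?thesis using tau_lt_1[of x] tau_gt_1[of y] tau_0 xy by auto
  next
    case False
    then consider "y < 0" | "0 < x" using xy by linarith
    then show ?thesis
    proof cases
      case 1
      then have "y\<^sup>2 < x\<^sup>2" using xy power_strict_mono[of "- y" "- x" 2] by simp
      then show ?thesis using 1 xy rchi_tau[of x] rchi_tau[of y] tau_lt_1[of x] tau_lt_1[of y] tau_pos
         rchi_decreasing[of "tau p e y" "tau p e x"]
        by (cases "tau p e y" "tau p e x" rule: linorder_cases) auto
    next
      case 2
      then have "x\<^sup>2 < y\<^sup>2" using xy by (simp add: power_strict_mono)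
      then show ?thesis using 2 xy rchi_tau[of x] rchi_tau[of y] tau_gt_1[of x] tau_gt_1[of y] tau_pos
         rchi_increasing[of "tau p e y" "tau p e x"]
        by (cases "tau p e y" "tau p e x" rule: linorder_cases) auto
    qed
  qed
qed

text \<open>An increasing function onto an open half-line has no jumps.\<close>

lemma tau_cont: "isCont (tau p e) x"
proof -
  have "range (tau p e) = {0<..}" using tau_surj tau_pos by (fastforce simp: image_iff)
  then have "continuous_on UNIV (tau p e)"
    using tau_strict_mono by (intro continuous_onI_mono) (auto simp: less_eq_real_def)
  then show ?thesis by (simp add: continuous_on_eq_continuous_at)
qed

end

subsection \<open>Local structure of the roots\<close>

lemma of_real_in_ball: "complex_of_real t \<in> ball (of_real a) r \<longleftrightarrow> \<bar>t - a\<bar> < r"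
  by (simp add: dist_real_def abs_minus_commute)

lemma of_real_in_ball_1: "complex_of_real t \<in> ball 1 r \<longleftrightarrow> \<bar>t - 1\<bar> < r"
  using of_real_in_ball[of t 1 r] by simp

lemma uniform_radius:
  assumes "finite A" "\<And>a. a \<in> A \<Longrightarrow> \<exists>r>0. P a r"
    and mono: "\<And>a r s. a \<in> A \<Longrightarrow> P a r \<Longrightarrow> 0 < s \<Longrightarrow> s \<le> r \<Longrightarrow> P a s"
  shows "\<exists>r>(0::real). \<forall>a\<in>A. P a r"
  using assms
proof (induction A rule: finite_induct)
  case empty then show ?case by (intro exI[of _ 1]) auto
next
  case (insert a A)
  have "\<exists>r>0. \<forall>a\<in>A. P a r"
    by (rule insert.IH) (use insert.prems in \<open>blast+\<close>)
  then obtain r where r: "r > 0" "\<forall>a\<in>A. P a r" by blast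
  obtain s where s: "s > 0" "P a s" using insert.prems(1) by blast
  have "P b (min r s)" if "b \<in> insert a A" for b
  proof (cases "b = a")
    case True then show ?thesis using insert.prems(2)[of b s "min r s"] r s by auto
  next
    case False then show ?thesis using insert.prems(2)[of b r "min r s"] r s that by auto
  qed
  then show ?case using r s by (intro exI[of _ "min r s"]) auto
qed

lemma one_plus_square_near:
  assumes "\<delta> > 0"
  shows "\<exists>r>0. \<forall>u. dist u z < r \<longrightarrow> dist (1 + u\<^sup>2) (1 + (z::complex)\<^sup>2) < \<delta>"
proof -
  have "isCont (\<lambda>u::complex. 1 + u\<^sup>2) z" by (intro continuous_intros)
  then show ?thesis using assms by (auto simp: continuous_at_eps_delta)
qed

section \<open>The positive roots as analytic functions of x\<close>

context walk_poly
begin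

lemma has_deriv_chi:
  assumes "z \<noteq> 0"
  shows "(chi p e has_field_derivative
    (\<Sum>k\<le>degree p. of_real (coeff p k * (int k - int e)) * z powi (int k - int e - 1))) (at z)"
proof -
  have "((\<lambda>z. \<Sum>k\<le>degree p. of_real (coeff p k) * z powi (int k - int e)) has_field_derivative
    (\<Sum>k\<le>degree p. of_real (coeff p k * (int k - int e)) * z powi (int k - int e - 1))) (at z)"
    using assms by (auto intro!: derivative_eq_intros sum.cong)
  then show ?thesis
  proof (rule has_field_derivative_transform_within_open)
    show "open (- {0::complex})" by auto
  qed (use assms in \<open>auto simp: chi_eq_sum\<close>)
qed

lemma chi_holomorphic: "chi p e holomorphic_on - {0}"
  unfolding holomorphic_on_def using has_deriv_chi field_differentiable_at_within field_differentiable_def by blast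

lemma deriv_chi:
  "z \<noteq> 0 \<Longrightarrow> deriv (chi p e) z = (\<Sum>k\<le>degree p. of_real (coeff p k * (int k - int e)) * z powi (int k - int e - 1))"
  using has_deriv_chi DERIV_imp_deriv by blast

lemma deriv_chi_of_real:
  assumes "t > 0" shows "deriv (chi p e) (of_real t) = of_real (drift t / t)"
proof -
  have "drift t / t = (\<Sum>k\<le>degree p. coeff p k * (int k - int e) * t powi (int k - int e - 1))"
    using assms by (simp add: drift_def sum_divide_distrib power_int_diff mult.assoc)
  then show ?thesis using assms by (simp add: deriv_chi)
qed

lemma deriv_chi_tau_nz: "x \<noteq> 0 \<Longrightarrow> deriv (chi p e) (of_real (tau p e x)) \<noteq> 0"
proof -
  assume "x \<noteq> 0"
  then have "drift (tau p e x) \<noteq> 0"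
    using drift_neg[of "tau p e x"] drift_pos[of "tau p e x"] tau_pos[of x] tau_lt_1[of x] tau_gt_1[of x]
    by (cases "x < 0") auto
  then show ?thesis using deriv_chi_of_real[OF tau_pos, of x] tau_pos[of x] by simp
qed

text \<open>Since the drift vanishes, \<chi>''(1) is the variance of a step, positive because -e
  lies in the support. So t = 1 is exactly a double root for \<lambda> = 1.\<close>

lemma deriv2_chi_1: "deriv (deriv (chi p e)) 1 \<noteq> 0"
proof -
  let ?D = "\<lambda>z::complex. \<Sum>k\<le>degree p. of_real (coeff p k * (int k - int e)) * z powi (int k - int e - 1)"
  have "(?D has_field_derivative
    (\<Sum>k\<le>degree p. of_real (coeff p k * (int k - int e)) * (of_int (int k - int e - 1) * 1 powi (int k - int e - 1 - 1)))) (at 1)"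
    by (auto intro!: derivative_eq_intros sum.cong)
  then have "(deriv (chi p e) has_field_derivative
    (\<Sum>k\<le>degree p. of_real (coeff p k * (int k - int e)) * (of_int (int k - int e - 1) * 1 powi (int k - int e - 1 - 1)))) (at 1)"
  proof (rule has_field_derivative_transform_within_open)
    show "open (- {0::complex})" by auto
  qed (auto simp: deriv_chi)
  then have "deriv (deriv (chi p e)) 1 = (\<Sum>k\<le>degree p. of_real (coeff p k * (int k - int e)) * of_int (int k - int e - 1))"
    by (simp add: DERIV_imp_deriv)
  also have "\<dots> = of_real (\<Sum>k\<le>degree p. coeff p k * (int k - int e) * (int k - int e - 1))"
    by simp
  also have "(\<Sum>k\<le>degree p. coeff p k * (int k - int e) * (int k - int e - 1))
     = (\<Sum>k\<le>degree p. coeff p k * (int k - int e)^2) - (\<Sum>k\<le>degree p. coeff p k * (int k - int e))"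
    by (simp add: sum_subtractf[symmetric] algebra_simps power2_eq_square)
  also have "\<dots> = (\<Sum>k\<le>degree p. coeff p k * (int k - int e)^2)" using sum_coeff_drift by simp
  finally have eq: "deriv (deriv (chi p e)) 1 = of_real (\<Sum>k\<le>degree p. coeff p k * (int k - int e)^2)" .
  have "(\<Sum>k\<le>degree p. coeff p k * (int k - int e)^2) > 0"
    by (rule sum_pos2[of _ 0]) (use coeff_nonneg const_pos e_pos in auto)
  then show ?thesis unfolding eq of_real_eq_0_iff by (rule less_imp_neq[THEN not_sym])
qed

text \<open>\<chi>(t) - 1 has a double zero at 1 and is therefore the square of a local coordinate
  \<open>Q\<close>; the extension of \<open>tau\<close> is the local inverse of \<open>Q\<close>.
  The last clause says that no further roots come near 1.\<close>

lemma tau_extends_0: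
  "\<exists>r>0. \<exists>g \<eta>. \<eta> > 0 \<and> g holomorphic_on ball 0 r \<and> inj_on g (ball 0 r) \<and>
     (\<forall>x. \<bar>x\<bar> < r \<longrightarrow> g (of_real x) = of_real (tau p e x)) \<and>
     (\<forall>z\<in>ball 0 r. g z \<noteq> 0 \<and> chi p e (g z) = 1 + z\<^sup>2) \<and>
     (\<forall>x y. \<bar>x\<bar> < r \<longrightarrow> dist y 1 < \<eta> \<longrightarrow> chi p e y = of_real (1 + x\<^sup>2) \<longrightarrow>
        y = of_real (tau p e x) \<or> y = of_real (tau p e (- x)))"
proof -
  have hol: "chi p e holomorphic_on ball 1 1"
    by (rule holomorphic_on_subset[OF chi_holomorphic]) auto
  have d1: "deriv (chi p e) 1 = 0" using deriv_chi_of_real[of 1] drift_1 by simp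
  have d2: "(deriv ^^ 2) (chi p e) 1 \<noteq> 0" using deriv2_chi_1 by (simp add: numeral_2_eq_2)
  have chi1: "chi p e 1 = 1" using chi_of_real[of p e 1] rchi_1 by simp
  have i0: "(deriv ^^ i) (chi p e) 1 = 0" if "0 < i" "i < 2" for i
  proof -
    have "i = 1" using that by simp
    then show ?thesis using d1 by simp
  qed
  have m1: "(1::complex) \<in> ball 1 1" by simp
  obtain h r0 where h: "r0 > 0" "h holomorphic_on ball 1 r0"
     "\<And>w. w \<in> ball 1 r0 \<Longrightarrow> chi p e w - chi p e 1 = (w - 1)^2 * h w" "\<And>w. w \<in> ball 1 r0 \<Longrightarrow> h w \<noteq> 0"
    by (rule holomorphic_factor_order_of_zero[OF hol open_ball m1 pos2 d2 i0]) (assumption | rule that)+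
  have hcont: "isCont h 1"
    using h(1,2) holomorphic_on_imp_continuous_on continuous_on_interior by force
  have hreal: "h (of_real t) = of_real ((rchi p e t - 1) / (t - 1)\<^sup>2)" if "\<bar>t - 1\<bar> < r0" "t \<noteq> 1" for t
  proof -
    have "complex_of_real t \<in> ball 1 r0"
      using that by (simp only: of_real_in_ball_1)
    from h(3)[OF this] have "of_real (rchi p e t - 1) = of_real ((t - 1)\<^sup>2) * h (of_real t)"
      by (simp add: chi1 chi_of_real)
    then show ?thesis using that by (simp add: field_simps)
  qed
  \<comment> \<open>As a limit of values at real points, \<open>h 1\<close> is real and nonnegative.
    As it is also nonzero, the principal square root of \<open>h\<close> is analytic near 1 and
    positive at real points, so that \<open>Q\<close> has the sign of t - 1 there and its inverse is
    \<open>tau\<close>, not the mirror image of \<open>tau\<close>.\<close>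
  have h1: "h 1 \<in> {z. Im z = 0} \<inter> {z. Re z \<ge> 0}"
  proof (rule Lim_in_closed_set)
    show "closed ({z. Im z = 0} \<inter> {z. Re z \<ge> 0})"
      by (intro closed_Int closed_Collect_eq closed_Collect_le continuous_intros)
    show "((\<lambda>t. h (complex_of_real t)) \<longlongrightarrow> h 1) (at 1)"
    proof (rule isCont_tendsto_compose[OF hcont])
      have "(complex_of_real \<longlongrightarrow> of_real 1) (at 1)" by (intro tendsto_intros)
      then show "(complex_of_real \<longlongrightarrow> 1) (at 1)" by simp
    qed
    show "\<forall>\<^sub>F t in at 1. h (complex_of_real t) \<in> {z. Im z = 0} \<inter> {z. Re z \<ge> 0}"
      unfolding eventually_at
    proof (intro exI[of _ "min r0 1"] conjI ballI impI)
      show "min r0 1 > 0" using h(1) by simp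
      fix t :: real assume t: "t \<noteq> 1 \<and> dist t 1 < min r0 1"
      then have "rchi p e t > 1" by (intro rchi_gt_1) (auto simp: dist_real_def)
      then show "h (complex_of_real t) \<in> {z. Im z = 0} \<inter> {z. Re z \<ge> 0}"
        using hreal[of t] t by (auto simp: dist_real_def)
    qed
  qed auto
  have "Re (h 1) > 0"
  proof -
    have "h 1 \<noteq> 0" using h by simp
    then show ?thesis using h1 by (auto simp: complex_eq_iff less_le)
  qed
  moreover have "open {z. Re z > 0}" by (simp add: open_halfspace_Re_gt)
  ultimately obtain r1 where r1: "r1 > 0" "\<And>w. dist w 1 < r1 \<Longrightarrow> Re (h w) > 0"
    using hcont continuous_at_open[of 1 h] by (metis (no_types, lifting) continuous_at_eps_delta mem_Collect_eq open_dist)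
  define R where "R = Min {r0, r1, 1}"
  have R: "R > 0" "R \<le> r0" "R \<le> r1" "R \<le> 1" using h(1) r1(1) by (auto simp: R_def)
  define Q where "Q w = (w - 1) * csqrt (h w)" for w
  have holh: "h holomorphic_on ball 1 R" using h(2) R by (meson holomorphic_on_subset subset_ball)
  have nonpos: "h w \<notin> \<real>\<^sub>\<le>\<^sub>0" if "w \<in> ball 1 R" for w
    using r1(2)[of w] that R by (auto simp: complex_nonpos_Reals_iff dist_commute)
  have holQ: "Q holomorphic_on ball 1 R" unfolding Q_def
    using nonpos by (intro holomorphic_intros holh) auto
  have Q2: "(Q w)\<^sup>2 = chi p e w - 1" if "w \<in> ball 1 R" for w
    using h(3)[of w] that R chi1 by (simp add: Q_def power_mult_distrib)
  have dQ: "deriv Q 1 \<noteq> 0"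
  proof -
    have "(\<lambda>w. csqrt (h w)) holomorphic_on ball 1 R"
      using nonpos by (intro holomorphic_intros holh) auto
    then have "((\<lambda>w. csqrt (h w)) has_field_derivative deriv (\<lambda>w. csqrt (h w)) 1) (at 1)"
      using R by (intro holomorphic_derivI[of _ "ball 1 R"]) auto
    moreover have "Q = (\<lambda>w. (w - 1) * csqrt (h w))" by (simp add: fun_eq_iff Q_def)
    ultimately have "(Q has_field_derivative (1 - 0) * csqrt (h 1) + deriv (\<lambda>w. csqrt (h w)) 1 * (1 - 1)) (at 1)"
      using DERIV_mult[OF DERIV_diff[OF DERIV_ident DERIV_const]] by blast
    then have "deriv Q 1 = csqrt (h 1)" by (simp add: DERIV_imp_deriv)
    then show ?thesis using h(4)[of 1] h(1) by simp
  qed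
  have c1: "(1::complex) \<in> ball 1 R" using R(1) by simp
  obtain \<eta> G \<delta> where G: "\<eta> > 0" "ball (1::complex) \<eta> \<subseteq> ball 1 R" "G holomorphic_on ball (Q 1) \<delta>" "\<delta> > 0"
    "\<And>w. w \<in> ball (Q 1) \<delta> \<Longrightarrow> G w \<in> ball 1 \<eta> \<and> Q (G w) = w" "\<And>z. z \<in> ball 1 \<eta> \<Longrightarrow> G (Q z) = z"
    by (rule holomorphic_local_inverse[OF holQ open_ball c1 dQ], rule that, assumption+)
  have Q1: "Q 1 = 0" by (simp add: Q_def)
  obtain r2 where r2: "r2 > 0" "\<And>x. \<bar>x\<bar> < r2 \<Longrightarrow> \<bar>tau p e x - 1\<bar> < \<eta>"
    using tau_cont[of 0] G(1) by (auto simp: continuous_at_eps_delta tau_0 dist_real_def)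
  define r where "r = min r2 \<delta>"
  have r: "r > 0" "r \<le> r2" "r \<le> \<delta>" using r2 G by (auto simp: r_def)
  have Qtau: "Q (of_real (tau p e x)) = of_real x" if x: "\<bar>x\<bar> < r2" for x
  proof (cases "x = 0")
    case True then show ?thesis by (simp add: tau_0 Q1)
  next
    case False
    let ?t = "tau p e x"
    have t: "?t \<noteq> 1" using sgn_tau[of x] False by (auto simp: sgn_real_def split: if_splits)
    have near: "\<bar>?t - 1\<bar> < \<eta>" using r2(2)[OF x] .
    have inb: "complex_of_real ?t \<in> ball 1 \<eta>"
      using near by (simp only: of_real_in_ball_1)
    have "complex_of_real ?t \<in> ball 1 R" using inb G(2) by blast
    then have "complex_of_real ?t \<in> ball 1 r0" using R(2) by auto
    then have "\<bar>?t - 1\<bar> < r0"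
      by (simp only: of_real_in_ball_1)
    then have "h (of_real ?t) = of_real (x\<^sup>2 / (?t - 1)\<^sup>2)" using hreal[of ?t] t by (simp add: rchi_tau)
    then have "csqrt (h (of_real ?t)) = of_real (sqrt (x\<^sup>2 / (?t - 1)\<^sup>2))"
      by (simp only: csqrt_of_real_nonneg) simp
    then have "csqrt (h (of_real ?t)) = of_real (\<bar>x\<bar> / \<bar>?t - 1\<bar>)"
      by (simp add: real_sqrt_divide)
    then have "Q (of_real ?t) = of_real ((?t - 1) * (\<bar>x\<bar> / \<bar>?t - 1\<bar>))"
      by (simp add: Q_def)
    also have "(?t - 1) * (\<bar>x\<bar> / \<bar>?t - 1\<bar>) = sgn (?t - 1) * \<bar>x\<bar>"
      using t by (auto simp: sgn_real_def abs_if field_simps)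
    also have "\<dots> = x" by (simp add: sgn_tau sgn_mult_abs)
    finally show ?thesis .
  qed
  have Gtau: "G (of_real x) = of_real (tau p e x)" if x: "\<bar>x\<bar> < r2" for x
  proof -
    have "complex_of_real (tau p e x) \<in> ball 1 \<eta>"
      using r2(2)[OF x] by (simp only: of_real_in_ball_1)
    then show ?thesis using G(6) Qtau[OF x] by metis
  qed
  have c1: "G holomorphic_on ball 0 r"
    using G(3) r(3) by (metis Q1 holomorphic_on_subset subset_ball)
  have c2: "inj_on G (ball 0 r)"
  proof (rule inj_on_inverseI)
    show "Q (G z) = z" if "z \<in> ball 0 r" for z using G(5)[of z] that r Q1 by auto
  qed
  have c3: "G z \<noteq> 0 \<and> chi p e (G z) = 1 + z\<^sup>2" if "z \<in> ball 0 r" for z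
  proof -
    have *: "G z \<in> ball 1 \<eta>" "Q (G z) = z" using G(5)[of z] that r Q1 by auto
    then have "G z \<in> ball 1 R" using G(2) by blast
    then show ?thesis using Q2[of "G z"] * R(4) by auto
  qed
  have c4: "y = of_real (tau p e x) \<or> y = of_real (tau p e (- x))"
    if "\<bar>x\<bar> < r" "dist y 1 < \<eta>" "chi p e y = of_real (1 + x\<^sup>2)" for x y
  proof -
    have y: "y \<in> ball 1 \<eta>" using that by (simp add: dist_commute)
    then have "(Q y)\<^sup>2 = (of_real x)\<^sup>2" using Q2[of y] G(2) that by auto
    then have "Q y = of_real x \<or> Q y = of_real (- x)" by (simp add: power2_eq_iff)
    then show ?thesis using G(6)[OF y] Gtau[of x] Gtau[of "- x"] that r by auto
  qed
  have c5: "\<forall>x. \<bar>x\<bar> < r \<longrightarrow> G (of_real x) = of_real (tau p e x)" using Gtau r by auto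
  show ?thesis
    by (rule exI[of _ r], rule conjI[OF r(1)], rule exI[of _ G], rule exI[of _ \<eta>])
      (intro conjI G(1) c1 c2 c5, use c3 c4 in \<open>blast+\<close>)
qed

text \<open>Away from x = 0 the root is simple, so \<open>chi p e\<close> is itself locally
  invertible, and its inverse is composed with u \<mapsto> 1 + u^2.\<close>

lemma tau_extends:
  "\<exists>r>0. \<exists>g \<eta>. \<eta> > 0 \<and> g holomorphic_on ball (of_real x0) r \<and>
     (\<forall>x. \<bar>x - x0\<bar> < r \<longrightarrow> g (of_real x) = of_real (tau p e x)) \<and>
     (\<forall>x y. \<bar>x - x0\<bar> < r \<longrightarrow> dist y (of_real (tau p e x0)) < \<eta> \<longrightarrow> chi p e y = of_real (1 + x\<^sup>2) \<longrightarrow>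
        y = of_real (tau p e x) \<or> y = of_real (tau p e (- x)))"
proof (cases "x0 = 0")
  case True
  obtain r g \<eta> where rg: "r > 0" "\<eta> > 0" "g holomorphic_on ball 0 r"
     "\<forall>x. \<bar>x\<bar> < r \<longrightarrow> g (of_real x) = of_real (tau p e x)"
     "\<forall>x y. \<bar>x\<bar> < r \<longrightarrow> dist y 1 < \<eta> \<longrightarrow> chi p e y = of_real (1 + x\<^sup>2) \<longrightarrow>
        y = of_real (tau p e x) \<or> y = of_real (tau p e (- x))"
    using tau_extends_0 by blast
  show ?thesis unfolding True
    by (rule exI[of _ r], rule conjI[OF rg(1)], rule exI[of _ g], rule exI[of _ \<eta>]) (use rg in \<open>simp add: tau_0\<close>)
next
  case False
  let ?t = "complex_of_real (tau p e x0)"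
  have chit: "chi p e ?t = 1 + (of_real x0)\<^sup>2" by (simp add: chi_of_real rchi_tau)
  have t0: "?t \<in> - {0}" using tau_pos[of x0] by simp
  obtain \<eta> G \<delta> where G: "\<eta> > 0" "ball ?t \<eta> \<subseteq> - {0}" "\<delta> > 0" "G holomorphic_on ball (chi p e ?t) \<delta>"
    "\<And>w. w \<in> ball (chi p e ?t) \<delta> \<Longrightarrow> G w \<in> ball ?t \<eta> \<and> chi p e (G w) = w"
    "\<And>z. z \<in> ball ?t \<eta> \<Longrightarrow> G (chi p e z) = z"
    using holomorphic_local_inverse[OF chi_holomorphic _ t0 deriv_chi_tau_nz[OF False]]
    by (metis open_Compl closed_singleton)
  obtain r1 where r1: "r1 > 0" "\<And>u. dist u (of_real x0) < r1 \<Longrightarrow> dist (1 + u\<^sup>2) (1 + (complex_of_real x0)\<^sup>2) < \<delta>"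
    using one_plus_square_near[OF G(3)] by blast
  obtain r2 where r2: "r2 > 0" "\<And>x. \<bar>x - x0\<bar> < r2 \<Longrightarrow> \<bar>tau p e x - tau p e x0\<bar> < \<eta>"
    using tau_cont[of x0] G(1) by (auto simp: continuous_at_eps_delta dist_real_def)
  define r where "r = min r1 r2"
  have r: "r > 0" "r \<le> r1" "r \<le> r2" using r1 r2 by (auto simp: r_def)
  have im: "(\<lambda>u. 1 + u\<^sup>2) ` ball (of_real x0) r \<subseteq> ball (chi p e ?t) \<delta>"
    using r1(2) r(2) by (auto simp: chit dist_commute)
  have c1: "(\<lambda>u. G (1 + u\<^sup>2)) holomorphic_on ball (of_real x0) r"
    using holomorphic_on_compose_gen[OF _ G(4) im] by (simp add: o_def holomorphic_intros)
  have Gt: "G (of_real (1 + x\<^sup>2)) = of_real (tau p e x)" if "\<bar>x - x0\<bar> < r" for x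
  proof -
    have "complex_of_real (tau p e x) \<in> ball ?t \<eta>"
      using r2(2)[of x] that r by (simp add: dist_real_def abs_minus_commute)
    then show ?thesis using G(6) by (metis chi_of_real rchi_tau)
  qed
  have c3: "y = of_real (tau p e x)"
    if "\<bar>x - x0\<bar> < r" "dist y ?t < \<eta>" "chi p e y = of_real (1 + x\<^sup>2)" for x y
    using G(6)[of y] Gt[of x] that by (simp add: dist_commute)
  have c2: "\<forall>x. \<bar>x - x0\<bar> < r \<longrightarrow> G (1 + (of_real x)\<^sup>2) = of_real (tau p e x)" using Gt by simp
  show ?thesis
    by (rule exI[of _ r], rule conjI[OF r(1)], rule exI[of _ "\<lambda>u. G (1 + u\<^sup>2)"], rule exI[of _ \<eta>])
      (intro conjI G(1) c1 c2, use c3 in blast)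
qed

lemma branch_family_tau: "branch_family (\<lambda>x. {complex_of_real (tau p e x)})"
  unfolding branch_family_def
proof
  fix x0
  obtain r g where r: "r > 0" "g holomorphic_on ball (of_real x0) r"
     "\<forall>x. \<bar>x - x0\<bar> < r \<longrightarrow> g (of_real x) = of_real (tau p e x)"
    using tau_extends[of x0] by blast
  have "local_branches (\<lambda>u. {g u}) (ball (of_real x0) r - {of_real x0})"
    by (rule local_branches_singleton[OF r(2)]) auto
  then show "\<exists>r>0. \<exists>B. (\<forall>x. 0 < \<bar>x - x0\<bar> \<longrightarrow> \<bar>x - x0\<bar> < r \<longrightarrow> {complex_of_real (tau p e x)} = B (complex_of_real x)) \<and>
     local_branches B (ball (of_real x0) r - {of_real x0})"
    using r by (intro exI[of _ r] conjI exI[of _ "\<lambda>u. {g u}"]) simp_all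
qed

lemma branch_family_tau_minus: "branch_family (\<lambda>x. {complex_of_real (tau p e (- x))})"
  unfolding branch_family_def
proof
  fix x0
  obtain r g where r: "r > 0" "g holomorphic_on ball (of_real (- x0)) r"
     "\<forall>x. \<bar>x - (- x0)\<bar> < r \<longrightarrow> g (of_real x) = of_real (tau p e x)"
    using tau_extends[of "- x0"] by blast
  have "(\<lambda>u. - u) ` ball (of_real x0) r \<subseteq> ball (complex_of_real (- x0)) r"
    by (auto simp: dist_norm norm_minus_commute)
  then have "g \<circ> (\<lambda>u. - u) holomorphic_on ball (of_real x0) r"
    by (intro holomorphic_on_compose_gen[OF _ r(2)] holomorphic_intros)
  then have "local_branches (\<lambda>u. {(g \<circ> (\<lambda>u. - u)) u}) (ball (of_real x0) r - {of_real x0})"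
    by (rule local_branches_singleton) auto
  moreover have "\<forall>x. 0 < \<bar>x - x0\<bar> \<longrightarrow> \<bar>x - x0\<bar> < r \<longrightarrow> {complex_of_real (tau p e (- x))} = {(g \<circ> (\<lambda>u. - u)) (of_real x)}"
  proof (intro allI impI)
    fix x assume "\<bar>x - x0\<bar> < r"
    then have "\<bar>- x - (- x0)\<bar> < r" by linarith
    then show "{complex_of_real (tau p e (- x))} = {(g \<circ> (\<lambda>u. - u)) (of_real x)}"
      using r(3)[rule_format, of "- x"] by simp
  qed
  ultimately show "\<exists>r>0. \<exists>B. (\<forall>x. 0 < \<bar>x - x0\<bar> \<longrightarrow> \<bar>x - x0\<bar> < r \<longrightarrow> {complex_of_real (tau p e (- x))} = B (complex_of_real x)) \<and>
     local_branches B (ball (of_real x0) r - {of_real x0})"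
    using r(1) by (intro exI[of _ r] conjI exI[of _ "\<lambda>u. {(g \<circ> (\<lambda>u. - u)) u}"])
qed

section \<open>Roots of \<chi>(y) = w: finiteness, bounds, continuity\<close>

definition roots :: "complex \<Rightarrow> complex set" where
  "roots w = {y. y \<noteq> 0 \<and> chi p e y = w}"

lemma finite_roots: "finite (roots w)"
proof -
  let ?P = "cpoly p - monom w e"
  have "coeff ?P (degree p) \<noteq> 0" using e_less p_nonzero by simp
  then have "?P \<noteq> 0" by (metis coeff_0)
  then have "finite {y. poly ?P y = 0}" by (rule poly_roots_finite)
  moreover have "roots w \<subseteq> {y. poly ?P y = 0}"
    by (auto simp: roots_def chi_def poly_monom field_simps)
  ultimately show ?thesis by (rule finite_subset[rotated])
qed

definition crit_values :: "complex set" where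
  "crit_values = {w. \<exists>y \<in> roots w. deriv (chi p e) y = 0}"

text \<open>Critical points are zeros of z p'(z) - e p(z), a nonzero polynomial since its constant
  term is -e p(0).\<close>

lemma finite_crit_values: "finite crit_values"
proof -
  let ?D = "monom 1 1 * pderiv (cpoly p) - smult (of_nat e) (cpoly p)"
  have "coeff ?D 0 \<noteq> 0" using const_pos e_pos by (simp add: coeff_mult)
  then have "?D \<noteq> 0" by auto
  then have fin: "finite {y. poly ?D y = 0}" by (rule poly_roots_finite)
  have "crit_values \<subseteq> chi p e ` {y. poly ?D y = 0}"
  proof
    fix w assume "w \<in> crit_values"
    then obtain y where y: "y \<noteq> 0" "chi p e y = w" "deriv (chi p e) y = 0" by (auto simp: crit_values_def roots_def)
    have "(chi p e has_field_derivative
       (poly (pderiv (cpoly p)) y * y ^ e - poly (cpoly p) y * (of_nat e * y ^ (e - 1))) / (y ^ e * y ^ e)) (at y)"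
      unfolding chi_def using y(1) by (auto intro!: derivative_eq_intros)
    then have "poly (pderiv (cpoly p)) y * y ^ e = poly (cpoly p) y * (of_nat e * y ^ (e - 1))"
      using y(1,3) DERIV_imp_deriv by fastforce
    moreover obtain m where m: "e = Suc m" using e_pos by (cases e) auto
    ultimately have "(y * poly (pderiv (cpoly p)) y - of_nat e * poly (cpoly p) y) * y ^ m = 0"
      by (simp add: algebra_simps)
    then have "y * poly (pderiv (cpoly p)) y - of_nat e * poly (cpoly p) y = 0" using y(1) by simp
    then have "poly ?D y = 0" by (simp add: poly_monom)
    then show "w \<in> chi p e ` {y. poly ?D y = 0}" using y(2) by blast
  qed
  then show ?thesis using fin finite_subset by blast
qed

lemma norm_lower_terms_le:
  assumes "degree p = Suc m" "1 \<le> norm y"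
  shows "norm (\<Sum>k\<le>m. of_real (coeff p k) * y ^ k :: complex) \<le> norm y ^ m"
proof -
  have "norm (\<Sum>k\<le>m. of_real (coeff p k) * y ^ k) \<le> (\<Sum>k\<le>m. coeff p k * norm y ^ k)"
    by (rule order_trans[OF norm_sum]) (simp add: norm_mult norm_power coeff_nonneg)
  also have "\<dots> \<le> (\<Sum>k\<le>m. coeff p k * norm y ^ m)"
    using assms coeff_nonneg by (intro sum_mono mult_left_mono power_increasing) auto
  also have "\<dots> = (\<Sum>k\<le>m. coeff p k) * norm y ^ m" by (simp add: sum_distrib_right)
  also have "\<dots> \<le> 1 * norm y ^ m"
    using sum_coeff assms lead_pos by (intro mult_right_mono) auto
  finally show ?thesis by simp
qed

lemma root_bounded:
  assumes "y \<in> roots w" shows "norm y \<le> max 1 ((1 + norm w) / coeff p (degree p))"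
proof (cases "norm y \<le> 1")
  case False
  let ?n = "degree p" and ?c = "coeff p"
  obtain m where m: "?n = Suc m" using e_less by (cases ?n) auto
  have y1: "norm y \<ge> 1" "y \<noteq> 0" using False by auto
  have eq: "poly (cpoly p) y = w * y ^ e" using assms by (auto simp: roots_def chi_def field_simps)
  have "of_real (?c ?n) * y ^ ?n = w * y ^ e - (\<Sum>k\<le>m. of_real (?c k) * y ^ k)"
    using eq by (simp add: poly_cpoly m algebra_simps)
  moreover have "norm (of_real (?c ?n) * y ^ ?n) = ?c ?n * norm y ^ ?n"
    using lead_pos by (simp add: norm_mult norm_power)
  ultimately have "?c ?n * norm y ^ ?n = norm (w * y ^ e - (\<Sum>k\<le>m. of_real (?c k) * y ^ k))"
    by simp
  also have "\<dots> \<le> norm (w * y ^ e) + norm (\<Sum>k\<le>m. of_real (?c k) * y ^ k)" by (rule norm_triangle_ineq4)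
  also have "norm (\<Sum>k\<le>m. of_real (?c k) * y ^ k) \<le> norm y ^ m" by (rule norm_lower_terms_le[OF m y1(1)])
  also have "norm (w * y ^ e) \<le> norm w * norm y ^ m"
    using y1 e_less m by (auto simp: norm_mult norm_power intro!: mult_left_mono power_increasing)
  finally have "?c ?n * norm y * norm y ^ m \<le> (1 + norm w) * norm y ^ m" using m by (simp add: algebra_simps)
  then have "?c ?n * norm y \<le> 1 + norm w" using y1 by simp
  then show ?thesis using lead_pos by (simp add: field_simps le_max_iff_disj)
qed simp

text \<open>Half of the continuity of roots, without multiplicities: for w near w0 no root appears
  away from the roots for w0. At a root y for w the quantity |p(y) - w0 y^e| equals |w - w0| |y|^e,
  whereas it is bounded below on the compact set \<open>C\<close>.\<close>

lemma roots_near: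
  assumes "\<epsilon> > 0"
  shows "\<exists>\<delta>>0. \<forall>w y. dist w w0 < \<delta> \<longrightarrow> y \<in> roots w \<longrightarrow> (\<exists>y0\<in>roots w0. dist y y0 < \<epsilon>)"
proof -
  \<comment> \<open>Bounds the roots for all w at distance at most 1 from \<open>w0\<close>.\<close>
  define R where "R = max 1 ((2 + norm w0) / coeff p (degree p))"
  define C where "C = cball 0 R - (\<Union>y0\<in>roots w0. ball y0 \<epsilon>)"
  have "compact C" unfolding C_def by (intro compact_diff compact_cball) auto
  have R1: "R \<ge> 1" by (simp add: R_def)
  define F where "F y = norm (poly (cpoly p) y - w0 * y ^ e)" for y
  have "continuous_on C F" unfolding F_def by (intro continuous_intros)
  have F0: "F y > 0" if "y \<in> C" for y
  proof -
    have "y \<notin> roots w0" using that assms by (auto simp: C_def)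
    then have "poly (cpoly p) y - w0 * y ^ e \<noteq> 0"
      using const_pos e_pos
      by (cases "y = 0") (auto simp: roots_def chi_def poly_0_coeff_0 zero_power field_simps)
    then show ?thesis by (simp add: F_def)
  qed
  have "\<exists>m>0. \<forall>y\<in>C. m \<le> F y"
  proof (cases "C = {}")
    case False
    then obtain c where "c \<in> C" "\<forall>y\<in>C. F c \<le> F y"
      using continuous_attains_inf[OF \<open>compact C\<close> _ \<open>continuous_on C F\<close>] by blast
    then show ?thesis using F0 by blast
  qed (auto intro: exI[of _ 1])
  then obtain m where m: "m > 0" "\<forall>y\<in>C. m \<le> F y" by blast
  define \<delta> where "\<delta> = min 1 (m / R ^ e)"
  have "\<delta> > 0" using m R1 by (simp add: \<delta>_def)
  moreover have "\<exists>y0\<in>roots w0. dist y y0 < \<epsilon>" if w: "dist w w0 < \<delta>" and y: "y \<in> roots w" for w y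
  proof (rule ccontr)
    assume "\<not> ?thesis"
    then have far: "y \<notin> (\<Union>y0\<in>roots w0. ball y0 \<epsilon>)" by (auto simp: dist_commute)
    have "norm w \<le> norm w0 + 1" using w norm_triangle_ineq2[of w w0] by (simp add: \<delta>_def dist_norm)
    then have "(1 + norm w) / coeff p (degree p) \<le> (2 + norm w0) / coeff p (degree p)"
      using lead_pos by (intro divide_right_mono) auto
    then have yR: "norm y \<le> R" using root_bounded[OF y] by (auto simp: R_def)
    then have "m \<le> F y" using m far by (auto simp: C_def)
    also have "F y = norm ((w - w0) * y ^ e)"
      using y by (auto simp: F_def roots_def chi_def field_simps)
    also have "\<dots> \<le> norm (w - w0) * R ^ e" using yR by (auto simp: norm_mult norm_power intro!: mult_left_mono power_mono)
    also have "\<dots> < m"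
    proof -
      have "norm (w - w0) < m / R ^ e" using w by (simp add: \<delta>_def dist_norm)
      then show ?thesis using R1 by (simp add: field_simps)
    qed
    finally show False by simp
  qed
  ultimately show ?thesis by blast
qed

text \<open>For real x the roots in \<open>V\<close> cannot be exchanged with the others:
  \<open>V'\<close> is open and disjoint from \<open>V\<close>, and by \<open>tau_extends\<close>
  only positive roots come near a positive root. Stated for an abstract splitting so that it serves
  both the small and the large roots.\<close>

lemma branch_family_roots_in:
  assumes V: "open V" "open V'" "V \<inter> V' = {}" "V \<inter> of_real ` {0<..} = {}"
    and cover: "\<And>x::real. roots (of_real (1 + x\<^sup>2)) \<subseteq> V \<union> V' \<union> of_real ` {0<..}"
  shows "branch_family (\<lambda>x. roots (of_real (1 + x\<^sup>2)) \<inter> V)"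
  unfolding branch_family_def
proof
  fix x0 :: real
  let ?z0 = "complex_of_real x0"
  define w0 where "w0 = 1 + ?z0\<^sup>2"
  define Z0 where "Z0 = roots w0"
  have w0: "w0 = of_real (1 + x0\<^sup>2)" by (simp add: w0_def)
  have finZ0: "finite Z0" by (simp add: Z0_def finite_roots)
  \<comment> \<open>What a radius around \<open>y0\<close> must achieve: the disc stays inside
    \<open>V\<close> or \<open>V'\<close>, only positive roots come near a positive root for real x,
    and distinct roots at \<open>x0\<close> are 4 \<epsilon> apart, which excludes the chain of
    three distances below \<epsilon> that occurs further down.\<close>
  define P where "P y0 \<epsilon> \<longleftrightarrow> (y0 \<in> V \<longrightarrow> ball y0 \<epsilon> \<subseteq> V) \<and> (y0 \<in> V' \<longrightarrow> ball y0 \<epsilon> \<subseteq> V') \<and>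
     (y0 \<in> of_real ` {0<..} \<longrightarrow> (\<forall>x y. \<bar>x - x0\<bar> < \<epsilon> \<longrightarrow> dist y y0 < \<epsilon> \<longrightarrow> chi p e y = of_real (1 + x\<^sup>2) \<longrightarrow>
        y \<in> of_real ` {0<..})) \<and> (\<forall>y1\<in>Z0. y1 \<noteq> y0 \<longrightarrow> 4 * \<epsilon> \<le> dist y0 y1)" for y0 \<epsilon>
  have "\<exists>\<epsilon>>0. \<forall>y0\<in>Z0. P y0 \<epsilon>"
  proof (rule uniform_radius[OF finZ0])
    fix y0 assume y0: "y0 \<in> Z0"
    have 1: "\<exists>\<epsilon>>0. y0 \<in> V \<longrightarrow> ball y0 \<epsilon> \<subseteq> V"
      using V(1) open_contains_ball[of V] by (cases "y0 \<in> V") (auto intro: exI[of _ 1])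
    have 2: "\<exists>\<epsilon>>0. y0 \<in> V' \<longrightarrow> ball y0 \<epsilon> \<subseteq> V'"
      using V(2) open_contains_ball[of V'] by (cases "y0 \<in> V'") (auto intro: exI[of _ 1])
    have 3: "\<exists>\<epsilon>>0. y0 \<in> of_real ` {0<..} \<longrightarrow> (\<forall>x y. \<bar>x - x0\<bar> < \<epsilon> \<longrightarrow> dist y y0 < \<epsilon> \<longrightarrow> chi p e y = of_real (1 + x\<^sup>2) \<longrightarrow>
        y \<in> of_real ` {0<..})"
    proof (cases "y0 \<in> of_real ` {0<..}")
      case True
      then obtain t where t: "t > 0" "y0 = of_real t" by auto
      have "chi p e y0 = of_real (1 + x0\<^sup>2)" using y0 by (simp add: Z0_def roots_def w0)
      then have "rchi p e t = 1 + x0\<^sup>2" unfolding t(2) chi_of_real of_real_eq_iff .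
      then have "t = tau p e x0 \<or> t = tau p e (- x0)" using pos_root_eq_tau t(1) by blast
      then obtain x1 where x1: "x1 = x0 \<or> x1 = - x0" "t = tau p e x1" by blast
      obtain r \<eta> where r: "r > 0" "\<eta> > 0" "\<forall>x y. \<bar>x - x1\<bar> < r \<longrightarrow> dist y (of_real (tau p e x1)) < \<eta> \<longrightarrow> chi p e y = of_real (1 + x\<^sup>2) \<longrightarrow>
        y = of_real (tau p e x) \<or> y = of_real (tau p e (- x))" using tau_extends[of x1] by blast
      have "y \<in> of_real ` {0<..}" if "\<bar>x - x0\<bar> < min r \<eta>" "dist y y0 < min r \<eta>" "chi p e y = of_real (1 + x\<^sup>2)" for x y
      proof -
        define x' where "x' = (if x1 = x0 then x else - x)"
        have "\<bar>x' - x1\<bar> < r" "chi p e y = of_real (1 + x'\<^sup>2)" using that x1(1) by (auto simp: x'_def)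
        then have "y = of_real (tau p e x') \<or> y = of_real (tau p e (- x'))" using r(3) that t(2) x1(2) by auto
        then show ?thesis using tau_pos by auto
      qed
      then show ?thesis using r(1,2) by (intro exI[of _ "min r \<eta>"]) auto
    qed (auto intro: exI[of _ 1])
    have 4: "\<exists>\<epsilon>>0. \<forall>y1\<in>Z0. y1 \<noteq> y0 \<longrightarrow> 4 * \<epsilon> \<le> dist y0 y1"
    proof -
      obtain d where "d > 0" "\<forall>y\<in>Z0. y \<noteq> y0 \<longrightarrow> d \<le> dist y0 y" using finite_set_avoid[OF finZ0, of y0] by blast
      then show ?thesis by (intro exI[of _ "d/4"]) auto
    qed
    obtain e1 where e1: "e1 > 0" "y0 \<in> V \<longrightarrow> ball y0 e1 \<subseteq> V" using 1 by blast
    obtain e2 where e2: "e2 > 0" "y0 \<in> V' \<longrightarrow> ball y0 e2 \<subseteq> V'" using 2 by blast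
    obtain e3 where e3: "e3 > 0" "y0 \<in> of_real ` {0<..} \<longrightarrow> (\<forall>x y. \<bar>x - x0\<bar> < e3 \<longrightarrow> dist y y0 < e3 \<longrightarrow> chi p e y = of_real (1 + x\<^sup>2) \<longrightarrow>
        y \<in> of_real ` {0<..})" using 3 by blast
    obtain e4 where e4: "e4 > 0" "\<forall>y1\<in>Z0. y1 \<noteq> y0 \<longrightarrow> 4 * e4 \<le> dist y0 y1" using 4 by blast
    note ee = e1(1) e2(1) e3(1) e4(1) e1(2) e2(2) e3(2) e4(2)
    have m: "Min {e1,e2,e3,e4} \<le> e1" "Min {e1,e2,e3,e4} \<le> e2" "Min {e1,e2,e3,e4} \<le> e3" "Min {e1,e2,e3,e4} \<le> e4"
      by auto
    have "P y0 (Min {e1,e2,e3,e4})" unfolding P_def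
    proof (intro conjI impI allI ballI)
      show "ball y0 (Min {e1,e2,e3,e4}) \<subseteq> V" if "y0 \<in> V" using ee(5) that m(1) by (meson order_trans subset_ball)
      show "ball y0 (Min {e1,e2,e3,e4}) \<subseteq> V'" if "y0 \<in> V'" using ee(6) that m(2) by (meson order_trans subset_ball)
      show "y \<in> of_real ` {0<..}" if "y0 \<in> of_real ` {0<..}" "\<bar>x - x0\<bar> < Min {e1,e2,e3,e4}" "dist y y0 < Min {e1,e2,e3,e4}"
         "chi p e y = of_real (1 + x\<^sup>2)" for x y
        using ee(7) that m(3) by (meson less_le_trans)
      show "4 * Min {e1,e2,e3,e4} \<le> dist y0 y1" if "y1 \<in> Z0" "y1 \<noteq> y0" for y1
        using ee(8)[rule_format, OF that] m(4) by linarith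
    qed
    then show "\<exists>\<epsilon>>0. P y0 \<epsilon>" using ee(1-4) by (intro exI[of _ "Min {e1,e2,e3,e4}"]) simp
  next
    fix y0 r s assume P: "P y0 r" and s: "0 < s" "s \<le> r"
    note P = P[unfolded P_def]
    have sub: "ball y0 s \<subseteq> ball y0 r" by (rule subset_ball[OF s(2)])
    show "P y0 s" unfolding P_def
    proof (intro conjI impI allI ballI)
      show "ball y0 s \<subseteq> V" if "y0 \<in> V" using P that sub by blast
      show "ball y0 s \<subseteq> V'" if "y0 \<in> V'" using P that sub by blast
      show "y \<in> of_real ` {0<..}" if "y0 \<in> of_real ` {0<..}" "\<bar>x - x0\<bar> < s" "dist y y0 < s"
         "chi p e y = of_real (1 + x\<^sup>2)" for x y
        using P that s(2) less_le_trans by blast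
      show "4 * s \<le> dist y0 y1" if "y1 \<in> Z0" "y1 \<noteq> y0" for y1
      proof -
        have "4 * r \<le> dist y0 y1" using P that by blast
        then show ?thesis using s(2) by linarith
      qed
    qed
  qed
  then obtain \<epsilon> where eps: "\<epsilon> > 0" "\<And>y0. y0 \<in> Z0 \<Longrightarrow> P y0 \<epsilon>" by blast
  obtain \<delta>0 where d0: "\<delta>0 > 0" "\<And>w y. dist w w0 < \<delta>0 \<Longrightarrow> y \<in> roots w \<Longrightarrow> \<exists>y0\<in>Z0. dist y y0 < \<epsilon>"
    using roots_near[OF eps(1), of w0] unfolding Z0_def by blast
  obtain r1 where r1: "r1 > 0" "\<And>u. dist u ?z0 < r1 \<Longrightarrow> dist (1 + u\<^sup>2) w0 < \<delta>0"
    using one_plus_square_near[OF d0(1)] unfolding w0_def by blast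
  \<comment> \<open>Only finitely many parameters give a critical value, so a small punctured disc
    around \<open>?z0\<close> contains none.\<close>
  have "finite {z::complex. 1 + z\<^sup>2 \<in> crit_values}"
  proof -
    have "finite {z::complex. 1 + z\<^sup>2 = w}" for w
    proof -
      have "{z::complex. 1 + z\<^sup>2 = w} \<subseteq> {csqrt (w - 1), - csqrt (w - 1)}"
      proof
        fix z assume "z \<in> {z::complex. 1 + z\<^sup>2 = w}"
        then have "z\<^sup>2 = (csqrt (w - 1))\<^sup>2" by (auto simp: algebra_simps)
        then show "z \<in> {csqrt (w - 1), - csqrt (w - 1)}" by (simp only: power2_eq_iff) simp
      qed
      then show ?thesis using finite_subset by blast
    qed
    moreover have "{z::complex. 1 + z\<^sup>2 \<in> crit_values} = (\<Union>w\<in>crit_values. {z. 1 + z\<^sup>2 = w})" by auto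
    ultimately show ?thesis using finite_crit_values by auto
  qed
  then obtain r2 where r2: "r2 > 0" "\<And>z. 1 + z\<^sup>2 \<in> crit_values \<Longrightarrow> z \<noteq> ?z0 \<Longrightarrow> r2 \<le> dist ?z0 z"
    using finite_set_avoid[of "{z::complex. 1 + z\<^sup>2 \<in> crit_values}" ?z0] by auto
  define r where "r = Min {r1, r2, \<epsilon>}"
  have r: "r > 0" "r \<le> r1" "r \<le> r2" "r \<le> \<epsilon>" using r1 r2 eps by (auto simp: r_def)
  \<comment> \<open>For complex u the hypothesis \<open>cover\<close> gives no control over where
    the roots lie, so small discs around the roots at \<open>x0\<close> that lie in \<open>V\<close>
    take the place of \<open>V\<close>.\<close>
  define W where "W = (\<Union>y0\<in>Z0 \<inter> V. ball y0 \<epsilon>)"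
  have openW: "open W" by (auto simp: W_def)
  define B where "B u = roots (1 + u\<^sup>2) \<inter> W" for u
  have real: "roots (of_real (1 + x\<^sup>2)) \<inter> V = B (of_real x)" if x: "\<bar>x - x0\<bar> < r" for x
  proof -
    have "dist (complex_of_real x) ?z0 < r1" using x r by (simp add: dist_real_def)
    then have near: "\<exists>y0\<in>Z0. dist y y0 < \<epsilon>" if "y \<in> roots (of_real (1 + x\<^sup>2))" for y
      using r1(2)[of "of_real x"] d0(2)[of "of_real (1 + x\<^sup>2)" y] that by simp
    have "y \<in> W" if y: "y \<in> roots (of_real (1 + x\<^sup>2))" "y \<in> V" for y
    proof -
      obtain y0 where y0: "y0 \<in> Z0" "dist y y0 < \<epsilon>" using near y by blast
      have Py: "P y0 \<epsilon>" using eps y0 by blast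
      have "y0 \<in> V \<union> V' \<union> of_real ` {0<..}" using cover[of x0] y0(1) unfolding Z0_def w0 by blast
      moreover have "y0 \<notin> V'"
      proof
        assume "y0 \<in> V'"
        then have "ball y0 \<epsilon> \<subseteq> V'" using Py unfolding P_def by blast
        then have "y \<in> V'" using y0(2) by (auto simp: dist_commute)
        then show False using y(2) V(3) by blast
      qed
      moreover have "y0 \<notin> of_real ` {0<..}"
      proof
        assume "y0 \<in> of_real ` {0<..}"
        moreover have "\<bar>x - x0\<bar> < \<epsilon>" "chi p e y = of_real (1 + x\<^sup>2)" using x r(4) y(1) by (auto simp: roots_def)
        ultimately have "y \<in> of_real ` {0<..}" using Py y0(2) unfolding P_def by blast
        then show False using V(4) y(2) by blast
      qed
      ultimately show ?thesis using y0 by (auto simp: W_def dist_commute)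
    qed
    moreover have "W \<subseteq> V" using eps(2) unfolding W_def P_def by blast
    ultimately show ?thesis by (auto simp: B_def)
  qed
  have loc: "\<exists>\<delta>>0. \<exists>H. finite H \<and> (\<forall>h\<in>H. h holomorphic_on ball z \<delta>) \<and> (\<forall>u\<in>ball z \<delta>. B u = (\<lambda>h. h u) ` H)"
    if z: "z \<in> ball ?z0 r - {?z0}" for z
  proof -
    define w1 where "w1 = 1 + z\<^sup>2"
    have ncrit: "w1 \<notin> crit_values" using r2(2)[of z] z r by (auto simp: w1_def)
    have w1near: "dist w1 w0 < \<delta>0" using r1(2)[of z] z r by (auto simp: w1_def dist_commute)
    define good where "good y r G \<longleftrightarrow> ball y r \<subseteq> W - {0} \<and> G holomorphic_on ball w1 r \<and>
      (\<forall>w\<in>ball w1 r. G w \<in> W - {0} \<and> chi p e (G w) = w) \<and> (\<forall>v\<in>ball y r. G (chi p e v) = v)" for y r G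
    have "\<exists>r>0. \<exists>G. good y r G" if y: "y \<in> B z" for y
    proof -
      have y': "y \<noteq> 0" "chi p e y = w1" "y \<in> W" "deriv (chi p e) y \<noteq> 0"
        using y ncrit by (auto simp: B_def roots_def w1_def crit_values_def)
      have "chi p e holomorphic_on W - {0}" by (rule holomorphic_on_subset[OF chi_holomorphic]) auto
      moreover have "open (W - {0})" using openW by (simp add: open_delete)
      ultimately obtain s G \<delta> where G: "s > 0" "ball y s \<subseteq> W - {0}" "\<delta> > 0" "G holomorphic_on ball w1 \<delta>"
        "\<And>w. w \<in> ball w1 \<delta> \<Longrightarrow> G w \<in> ball y s \<and> chi p e (G w) = w"
        "\<And>z. z \<in> ball y s \<Longrightarrow> G (chi p e z) = z"
        using holomorphic_local_inverse[of "chi p e" "W - {0}" y] y' by (metis DiffI singletonD)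
      have "good y (min s \<delta>) G" unfolding good_def
      proof (intro conjI ballI)
        show "ball y (min s \<delta>) \<subseteq> W - {0}" by (rule order_trans[OF _ G(2)]) auto
        show "G holomorphic_on ball w1 (min s \<delta>)" using G(4) by (rule holomorphic_on_subset) auto
        show "G w \<in> W - {0}" if "w \<in> ball w1 (min s \<delta>)" for w
        proof -
          have "w \<in> ball w1 \<delta>" using that by simp
          then show ?thesis using G(5) G(2) by blast
        qed
        show "chi p e (G w) = w" if "w \<in> ball w1 (min s \<delta>)" for w using G(5)[of w] that by auto
        show "G (chi p e v) = v" if "v \<in> ball y (min s \<delta>)" for v using G(6)[of v] that by auto
      qed
      then show ?thesis using G(1,3) by (intro exI[of _ "min s \<delta>"]) auto
    qed
    moreover have "finite (B z)" by (simp add: B_def finite_roots)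
    ultimately have "\<exists>s>0. \<forall>y\<in>B z. \<exists>G. good y s G"
    proof (intro uniform_radius)
      fix y s s' assume "y \<in> B z" "\<exists>G. good y s G" "0 < s'" "s' \<le> s"
      then obtain G where "good y s G" by blast
      then have "good y s' G" using \<open>s' \<le> s\<close> unfolding good_def
        by (meson holomorphic_on_subset subset_ball subset_iff)
      then show "\<exists>G. good y s' G" by blast
    qed auto
    then obtain s where s: "s > 0" "\<forall>y\<in>B z. \<exists>G. good y s G" by blast
    then obtain G where G: "\<And>y. y \<in> B z \<Longrightarrow> good y s (G y)" by metis
    have "min s \<epsilon> > 0" using s eps by simp
    then obtain \<delta>1 where d1: "\<delta>1 > 0" "\<And>w y. dist w w1 < \<delta>1 \<Longrightarrow> y \<in> roots w \<Longrightarrow> \<exists>y1\<in>roots w1. dist y y1 < min s \<epsilon>"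
      using roots_near[of "min s \<epsilon>" w1] by blast
    have "min \<delta>1 s > 0" using d1 s by simp
    then obtain \<delta> where \<delta>: "\<delta> > 0" "\<And>u. dist u z < \<delta> \<Longrightarrow> dist (1 + u\<^sup>2) w1 < min \<delta>1 s"
      using one_plus_square_near[of "min \<delta>1 s" z] unfolding w1_def by blast
    define H where "H = (\<lambda>y u. G y (1 + u\<^sup>2)) ` B z"
    have "finite H" using \<open>finite (B z)\<close> by (simp add: H_def)
    moreover have "h holomorphic_on ball z \<delta>" if h: "h \<in> H" for h
    proof -
      obtain y where y: "y \<in> B z" "h = (\<lambda>u. G y (1 + u\<^sup>2))" using h unfolding H_def by blast
      have im: "(\<lambda>u. 1 + u\<^sup>2) ` ball z \<delta> \<subseteq> ball w1 s" using \<delta>(2) by (auto simp: dist_commute)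
      have "G y holomorphic_on ball w1 s" using G[OF y(1)] by (simp add: good_def)
      then show ?thesis unfolding y(2)
        using holomorphic_on_compose_gen[OF _ _ im, of "G y"] by (simp add: o_def holomorphic_intros)
    qed
    moreover have "B u = (\<lambda>h. h u) ` H" if u: "u \<in> ball z \<delta>" for u
    proof -
      have uw: "dist (1 + u\<^sup>2) w1 < \<delta>1" "dist (1 + u\<^sup>2) w1 < s" using \<delta>(2)[of u] u by (auto simp: dist_commute)
      have "G y (1 + u\<^sup>2) \<in> B u" if "y \<in> B z" for y
        using G[OF that] uw by (auto simp: good_def B_def roots_def dist_commute)
      \<comment> \<open>Every root in \<open>W\<close> comes from a branch: it is close to some root
        \<open>y1\<close> for \<open>z\<close>, and \<open>y1\<close> is again in \<open>W\<close>
        because the clusters around different roots at \<open>x0\<close> are far apart.\<close>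
      moreover have "\<exists>y1\<in>B z. y = G y1 (1 + u\<^sup>2)" if y: "y \<in> B u" for y
      proof -
        have yr: "y \<in> roots (1 + u\<^sup>2)" "y \<in> W" using y by (auto simp: B_def)
        obtain y1 where y1: "y1 \<in> roots w1" "dist y y1 < min s \<epsilon>" using d1(2)[OF uw(1) yr(1)] by blast
        obtain y0 where y0: "y0 \<in> Z0" "dist y1 y0 < \<epsilon>" using d0(2)[OF w1near y1(1)] by blast
        obtain y2 where y2: "y2 \<in> Z0" "y2 \<in> V" "dist y2 y < \<epsilon>" using yr(2) by (auto simp: W_def)
        have "dist y0 y2 \<le> dist y0 y1 + dist y1 y + dist y y2"
          using dist_triangle[of y0 y2 y] dist_triangle[of y0 y y1] by linarith
        then have "dist y0 y2 < 4 * \<epsilon>" using y0(2) y1(2) y2(3) eps(1) by (simp add: dist_commute)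
        then have "y2 = y0" using eps(2)[OF y0(1)] y2(1) unfolding P_def by force
        then have "y1 \<in> W" using y0 y2 by (auto simp: W_def dist_commute)
        then have y1B: "y1 \<in> B z" using y1(1) by (simp add: B_def w1_def)
        have "G y1 (chi p e y) = y" using G[OF y1B] y1(2) by (auto simp: good_def dist_commute)
        then have "y = G y1 (1 + u\<^sup>2)" using yr(1) by (simp add: roots_def)
        then show ?thesis using y1B by blast
      qed
      ultimately show ?thesis unfolding H_def image_image by blast
    qed
    ultimately show ?thesis using \<delta>(1) by (intro exI[of _ \<delta>] exI[of _ H] conjI ballI) blast+
  qed
  show "\<exists>r>0. \<exists>B. (\<forall>x. 0 < \<bar>x - x0\<bar> \<longrightarrow> \<bar>x - x0\<bar> < r \<longrightarrow> roots (of_real (1 + x\<^sup>2)) \<inter> V = B (complex_of_real x)) \<and>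
     local_branches B (ball (of_real x0) r - {of_real x0})"
    unfolding local_branches_def
    by (rule exI[of _ r], rule conjI[OF r(1)], rule exI[of _ B], intro conjI allI ballI impI)
      (erule real, erule loc)
qed

section \<open>Small and large roots off the positive axis\<close>

definition other_small :: "real \<Rightarrow> complex set" where
  "other_small x = roots (of_real (1 + x\<^sup>2)) \<inter> (ball 0 1 - of_real ` {0..})"

definition other_large :: "real \<Rightarrow> complex set" where
  "other_large x = roots (of_real (1 + x\<^sup>2)) \<inter> (- cball 0 1 - of_real ` {0..})"

text \<open>Removing the closed half-line makes the two regions open; nothing is lost, since 0 is
  never a root.\<close>

lemma closed_of_real_image: "closed (complex_of_real ` {0..})"
proof -
  have "complex_of_real ` {0..} = {z. Im z = 0} \<inter> {z. Re z \<ge> 0}"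
    by (auto simp: complex_eq_iff image_iff)
  then show ?thesis by (simp add: closed_Int closed_Collect_eq closed_Collect_le continuous_intros)
qed

text \<open>On the unit circle |\<chi>(y)| \<le> \<chi>(1) = 1 \<le> 1 + x^2, so x = 0 and equality
  holds in the triangle inequality. Hence no root crosses the circle except through 1.\<close>

lemma unit_root:
  assumes "y \<in> roots (of_real (1 + x\<^sup>2))" "norm y = 1" shows "y = 1"
proof -
  have y: "y \<noteq> 0" "chi p e y = of_real (1 + x\<^sup>2)" using assms by (auto simp: roots_def)
  have "\<bar>1 + x\<^sup>2\<bar> \<le> 1" using norm_chi_le[OF y(1)] unfolding y(2) norm_of_real assms(2) rchi_1 .
  then have "1 + x\<^sup>2 = 1" using zero_le_power2[of x] by linarith
  then have "chi p e y = of_real (rchi p e (norm y))" using y(2) by (simp add: assms(2) rchi_1)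
  then show ?thesis using chi_eq_rchi_norm[OF y(1)] assms(2) by simp
qed

lemma roots_cover:
  "roots (of_real (1 + x\<^sup>2)) \<subseteq> (ball 0 1 - of_real ` {0..}) \<union> (- cball 0 1 - of_real ` {0..}) \<union> of_real ` {0<..}"
proof
  fix y assume y: "y \<in> roots (of_real (1 + x\<^sup>2))"
  then have y0: "y \<noteq> 0" by (simp add: roots_def)
  show "y \<in> (ball 0 1 - of_real ` {0..}) \<union> (- cball 0 1 - of_real ` {0..}) \<union> of_real ` {0<..}"
  proof (cases "y \<in> of_real ` {0..}")
    case True
    then obtain t where "t \<ge> 0" "y = of_real t" by auto
    then have "y \<in> of_real ` {0<..}" using y0 by (auto simp: less_le)
    then show ?thesis by blast
  next
    case False
    have "norm y \<noteq> 1"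
    proof
      assume "norm y = 1"
      then have "y = of_real 1" using unit_root[OF y] by simp
      then show False using False by (metis atLeast_iff image_eqI zero_le_one)
    qed
    then show ?thesis using False by auto
  qed
qed

lemma branch_family_other_small: "branch_family other_small"
  unfolding other_small_def
proof (rule branch_family_roots_in[where V' = "- cball 0 1 - of_real ` {0..}"])
  show "open (ball 0 1 - complex_of_real ` {0..})" by (intro open_Diff open_ball closed_of_real_image)
  show "open (- cball 0 1 - complex_of_real ` {0..})" by (intro open_Diff open_Compl closed_cball closed_of_real_image)
qed (use roots_cover in auto)

lemma branch_family_other_large: "branch_family other_large"
  unfolding other_large_def
proof (rule branch_family_roots_in[where V' = "ball 0 1 - of_real ` {0..}"])
  show "open (ball 0 1 - complex_of_real ` {0..})" by (intro open_Diff open_ball closed_of_real_image)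
  show "open (- cball 0 1 - complex_of_real ` {0..})" by (intro open_Diff open_Compl closed_cball closed_of_real_image)
  show "roots (complex_of_real (1 + x\<^sup>2)) \<subseteq> - cball 0 1 - complex_of_real ` {0..} \<union> (ball 0 1 - complex_of_real ` {0..}) \<union> complex_of_real ` {0<..}" for x
    using roots_cover[of x] by blast
qed auto

text \<open>On the closed unit disc |p(y)| \<le> p(1) = 1. So the small roots are
  O(|w|^(-1/e)).\<close>

lemma small_root_bound:
  assumes "y \<in> roots w" "norm y \<le> 1" shows "norm w * norm y ^ e \<le> 1"
proof -
  have y: "y \<noteq> 0" "chi p e y = w" using assms by (auto simp: roots_def)
  have "norm w \<le> rchi p e (norm y)" using norm_chi_le[OF y(1)] y(2) by simp
  also have "\<dots> \<le> 1 / norm y ^ e"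
  proof -
    have "poly p (norm y) \<le> (\<Sum>k\<le>degree p. coeff p k * 1)" unfolding poly_altdef
      using assms coeff_nonneg by (intro sum_mono mult_left_mono power_le_one) auto
    then show ?thesis unfolding rchi_def using sum_coeff by (intro divide_right_mono) auto
  qed
  finally show ?thesis using y(1) by (simp add: pos_le_divide_eq)
qed

text \<open>Beyond radius \<open>2 / coeff p (degree p)\<close> the lower terms of p amount to at
  most half of the leading one, so |y|^f is at most a constant times 1 + x^2; and 1 + x^2 is at most
  the f-th power of \<open>tau p e x\<close>, where f = \<open>degree p - e\<close>.\<close>

lemma large_root_bound:
  assumes "y \<in> roots (of_real (1 + x\<^sup>2))" "x \<ge> 0"
  shows "norm y \<le> 2 / coeff p (degree p) * tau p e x"
proof (cases "norm y \<le> 2 / coeff p (degree p)")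
  case True
  have "tau p e x \<ge> 1" using tau_gt_1[of x] tau_0 assms(2) by (cases "x = 0") auto
  then have "2 / coeff p (degree p) * 1 \<le> 2 / coeff p (degree p) * tau p e x"
    using lead_pos by (intro mult_left_mono) auto
  then show ?thesis using True by simp
next
  case False
  let ?n = "degree p" and ?c = "coeff p"
  define a where "a = 2 / ?c ?n"
  define t where "t = tau p e x"
  obtain m where m: "?n = Suc m" using e_less by (cases ?n) auto
  have t1: "t \<ge> 1" using tau_gt_1[of x] tau_0 assms(2) by (cases "x = 0") (auto simp: t_def)
  have cn: "?c ?n \<le> 1" using sum_coeff m by (metis (no_types, lifting) add_increasing coeff_nonneg order_refl sum.atMost_Suc sum_nonneg)
  have a: "a \<ge> 2" using cn lead_pos by (simp add: a_def field_simps)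
  have na: "norm y > a" using False by (simp add: a_def)
  have y1: "norm y \<ge> 1" "y \<noteq> 0" using na a by auto
  have "norm (poly (cpoly p) y) \<ge> ?c ?n * norm y ^ ?n - norm y ^ m"
  proof -
    have "poly (cpoly p) y = of_real (?c ?n) * y ^ ?n + (\<Sum>k\<le>m. of_real (?c k) * y ^ k)"
      by (simp add: poly_cpoly m)
    then have "norm (poly (cpoly p) y) \<ge> norm (of_real (?c ?n) * y ^ ?n) - norm (\<Sum>k\<le>m. of_real (?c k) * y ^ k)"
      by (simp only: norm_diff_ineq)
    moreover have "norm (\<Sum>k\<le>m. of_real (?c k) * y ^ k) \<le> norm y ^ m" by (rule norm_lower_terms_le[OF m y1(1)])
    ultimately show ?thesis using lead_pos by (simp add: norm_mult norm_power)
  qed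
  moreover have "norm y ^ m \<le> ?c ?n / 2 * norm y ^ ?n"
  proof -
    have "1 \<le> ?c ?n / 2 * norm y" using na lead_pos by (simp add: a_def field_simps)
    then have "1 * norm y ^ m \<le> ?c ?n / 2 * norm y * norm y ^ m" by (intro mult_right_mono) auto
    then show ?thesis by (simp add: m mult.assoc)
  qed
  ultimately have lower: "?c ?n / 2 * norm y ^ ?n \<le> norm (poly (cpoly p) y)" by linarith
  have "poly (cpoly p) y = of_real (1 + x\<^sup>2) * y ^ e" using assms(1) y1(2) by (auto simp: roots_def chi_def field_simps)
  then have "norm (poly (cpoly p) y) = \<bar>1 + x\<^sup>2\<bar> * norm y ^ e"
    by (simp only: norm_mult norm_of_real norm_power)
  then have "norm (poly (cpoly p) y) = (1 + x\<^sup>2) * norm y ^ e" using zero_le_power2[of x] by simp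
  also have "1 + x\<^sup>2 \<le> t ^ (?n - e)"
  proof -
    have "1 + x\<^sup>2 = poly p t / t ^ e" using rchi_tau[of x] by (simp add: rchi_def t_def)
    also have "poly p t \<le> (\<Sum>k\<le>?n. ?c k * t ^ ?n)" unfolding poly_altdef
      using t1 coeff_nonneg by (intro sum_mono mult_left_mono power_increasing) auto
    also have "\<dots> = t ^ ?n" using sum_coeff by (simp add: sum_distrib_right[symmetric])
    finally show ?thesis using t1 e_less by (simp add: power_diff divide_right_mono)
  qed
  finally have "?c ?n / 2 * norm y ^ ?n \<le> t ^ (?n - e) * norm y ^ e" 
    using lower by (simp add: mult_right_mono)
  moreover have "norm y ^ ?n = norm y ^ (?n - e) * norm y ^ e" using e_less by (simp flip: power_add)
  ultimately have "?c ?n / 2 * norm y ^ (?n - e) * norm y ^ e \<le> t ^ (?n - e) * norm y ^ e" by (simp add: mult.assoc)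
  then have "?c ?n / 2 * norm y ^ (?n - e) \<le> t ^ (?n - e)" using y1 by simp
  then have "norm y ^ (?n - e) \<le> a * t ^ (?n - e)" using lead_pos by (simp add: a_def field_simps)
  also have "\<dots> \<le> a ^ (?n - e) * t ^ (?n - e)"
  proof (intro mult_right_mono)
    have "a ^ 1 \<le> a ^ (?n - e)" using a e_less by (intro power_increasing) auto
    then show "a \<le> a ^ (?n - e)" by simp
  qed (use t1 in auto)
  finally have "norm y ^ (?n - e) \<le> (a * t) ^ (?n - e)" by (simp add: power_mult_distrib)
  then have "norm y \<le> a * t" using a t1 e_less by (subst (asm) power_mono_iff) auto
  then show ?thesis by (simp add: a_def t_def)
qed

end

subsection \<open>The generating function of the return probabilities\<close>

text \<open>The coefficient of t^(n e) in p^n is the constant term of \<chi>^n.\<close>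

definition return_coeff :: "real poly \<Rightarrow> nat \<Rightarrow> nat \<Rightarrow> real" where
  "return_coeff p e n = coeff (p ^ n) (n * e)"

definition J :: "real poly \<Rightarrow> nat \<Rightarrow> complex \<Rightarrow> complex" where
  "J p e w = suminf (\<lambda>n. of_real (return_coeff p e n) / w ^ Suc n)"

lemma cpoly_power: "cpoly p ^ n = cpoly (p ^ n)"
proof (induction n)
  case (Suc n)
  have "cpoly (p * q) = cpoly p * cpoly q" for q
    by (rule poly_eqI) (simp add: coeff_mult)
  then show ?case using Suc by simp
qed (simp add: cpoly_def)

lemma higher_deriv_poly: "(deriv ^^ k) (poly Q) = poly ((pderiv ^^ k) (Q :: complex poly))"
proof (induction k)
  case (Suc k)
  have "deriv (poly R) = poly (pderiv R)" for R :: "complex poly"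
    by (intro ext DERIV_imp_deriv poly_DERIV)
  then show ?case using Suc by simp
qed simp

lemma contour_integral_poly_over_power:
  fixes Q :: "complex poly"
  assumes "r > 0"
  shows "((\<lambda>z. poly Q z / z ^ Suc k) has_contour_integral (2 * pi * \<i> * coeff Q k)) (circlepath 0 r)"
proof -
  have "(deriv ^^ k) (poly Q) 0 = fact k * coeff Q k"
    unfolding higher_deriv_poly poly_0_coeff_0 coeff_higher_pderiv by (simp add: pochhammer_fact)
  moreover have "((\<lambda>u. poly Q u / (u - 0) ^ Suc k) has_contour_integral
      2 * pi * \<i> / fact k * (deriv ^^ k) (poly Q) 0) (circlepath 0 r)"
    using assms by (intro Cauchy_has_contour_integral_higher_derivative_circlepath)
      (auto intro!: continuous_intros holomorphic_intros)
  ultimately show ?thesis by (simp add: mult.assoc)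
qed

section \<open>Residue formulas for J\<close>

context walk_poly
begin

text \<open>This is \<open>1 / (z (w - \<chi>(z)))\<close>, written so that it is also correct at \<open>z = 0\<close>.\<close>

definition resolvent :: "complex \<Rightarrow> complex \<Rightarrow> complex" where
  "resolvent w z = z ^ (e - 1) / (w * z ^ e - poly (cpoly p) z)"

lemma resolvent_denom_zero_iff: "w * z ^ e - poly (cpoly p) z = 0 \<longleftrightarrow> z \<in> roots w"
proof (cases "z = 0")
  case True
  then show ?thesis using const_pos e_pos by (auto simp: roots_def poly_0_coeff_0 zero_power)
next
  case False
  then show ?thesis by (auto simp: roots_def chi_def field_simps)
qed

lemma resolvent_eq: "z \<noteq> 0 \<Longrightarrow> resolvent w z = 1 / (z * (w - chi p e z))"
proof -
  assume z: "z \<noteq> 0"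
  obtain m where m: "e = Suc m" using e_pos by (cases e) auto
  have "w * z ^ e - poly (cpoly p) z = z ^ m * (z * (w - chi p e z))"
    using z by (simp add: chi_def m field_simps)
  then show ?thesis unfolding resolvent_def using z by (simp add: m)
qed

lemma norm_chi_unit: "norm z = 1 \<Longrightarrow> norm (chi p e z) \<le> 1"
  using norm_chi_le[of z] rchi_1 by (cases "z = 0") auto

lemma resolvent_holomorphic: "resolvent w holomorphic_on - roots w"
  unfolding resolvent_def
  by (intro holomorphic_intros) (use resolvent_denom_zero_iff in auto)

text \<open>The constant term of \<chi>^n is a contour integral of \<chi>^n / z, and the geometric
  series in \<chi> / w sums to \<open>resolvent w\<close>; on the unit circle |\<chi>| \<le> 1 <
  |w|.\<close>

lemma J_sums:
  assumes w: "norm w > 1"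
  shows "(\<lambda>n. of_real (return_coeff p e n) / w ^ Suc n) sums
    (contour_integral (circlepath 0 1) (resolvent w) / (2 * pi * \<i>))"
proof -
  let ?c = "circlepath 0 1"
  have w0: "w \<noteq> 0" using w by auto
  have noroot: "z \<notin> roots w" if "norm z = 1" for z
    using norm_chi_unit[OF that] w by (auto simp: roots_def)
  have int: "(resolvent w has_contour_integral contour_integral ?c (resolvent w)) ?c"
  proof (rule has_contour_integral_integral)
    have "continuous_on (- roots w) (resolvent w)"
      by (rule holomorphic_on_imp_continuous_on[OF resolvent_holomorphic])
    then show "resolvent w contour_integrable_on ?c"
      by (intro contour_integrable_continuous_circlepath) (rule continuous_on_subset, use noroot in auto)
  qed
  define T where "T n z = poly (cpoly (p ^ n)) z / z ^ Suc (n * e) / w ^ Suc n" for n z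
  have T: "(T n has_contour_integral (2 * pi * \<i>) * (of_real (return_coeff p e n) / w ^ Suc n)) ?c" for n
    unfolding T_def return_coeff_def
    using has_contour_integral_div[OF contour_integral_poly_over_power[of 1 "cpoly (p ^ n)" "n * e"], of "w ^ Suc n"] by simp
  have rem: "resolvent w z - (\<Sum>n<N. T n z) = (chi p e z / w) ^ N * resolvent w z" if z: "norm z = 1" for z N
  proof -
    have z0: "z \<noteq> 0" using z by auto
    have ne: "w - chi p e z \<noteq> 0" using norm_chi_unit[OF z] w by auto
    have Tn: "T n z = (chi p e z / w) ^ n * (1 / (z * w))" for n
      using z0 w0 unfolding T_def chi_def
      by (simp add: cpoly_power[symmetric] power_divide power_mult_distrib power_mult[symmetric] mult.commute[of e])
    have q: "chi p e z / w \<noteq> 1" using ne w0 by auto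
    have "(\<Sum>n<N. T n z) = (\<Sum>n<N. (chi p e z / w) ^ n) * (1 / (z * w))"
      unfolding Tn sum_distrib_right ..
    also have "(\<Sum>n<N. (chi p e z / w) ^ n) = (1 - (chi p e z / w) ^ N) / (1 - chi p e z / w)"
      by (simp only: sum_gp_strict q if_False)
    also have "1 - chi p e z / w = (w - chi p e z) / w" using w0 by (simp add: field_simps)
    also have "(1 - (chi p e z / w) ^ N) / ((w - chi p e z) / w) * (1 / (z * w))
       = (1 - (chi p e z / w) ^ N) * resolvent w z"
      using w0 z0 ne by (simp add: resolvent_eq[OF z0])
    finally show ?thesis by (simp add: algebra_simps)
  qed
  obtain B where B: "B \<ge> 0" "\<And>z. norm z = 1 \<Longrightarrow> norm (resolvent w z) \<le> B"
  proof -
    have "norm (resolvent w z) \<le> 1 / (norm w - 1)" if z: "norm z = 1" for z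
    proof -
      have "norm w - 1 \<le> norm (w - chi p e z)"
        using norm_triangle_ineq2[of w "chi p e z"] norm_chi_unit[OF z] by linarith
      moreover have "z \<noteq> 0" using z by auto
      ultimately show ?thesis using w z
        by (simp add: resolvent_eq norm_divide norm_mult frac_le)
    qed
    then show ?thesis using that[of "1 / (norm w - 1)"] w by auto
  qed
  define S where "S N = (\<Sum>n<N. of_real (return_coeff p e n) / w ^ Suc n)" for N
  have bound: "norm (contour_integral ?c (resolvent w) - 2 * pi * \<i> * S N) \<le> (B / norm w ^ N) * (2 * pi * 1)" for N
  proof (rule has_contour_integral_bound_circlepath)
    have "((\<lambda>z. \<Sum>n<N. T n z) has_contour_integral (\<Sum>n<N. (2 * pi * \<i>) * (of_real (return_coeff p e n) / w ^ Suc n))) ?c"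
      by (intro has_contour_integral_sum T) auto
    then have "((\<lambda>z. \<Sum>n<N. T n z) has_contour_integral (2 * pi * \<i> * S N)) ?c"
      by (simp add: S_def sum_distrib_left)
    from has_contour_integral_diff[OF int this]
    show "((\<lambda>z. resolvent w z - (\<Sum>n<N. T n z)) has_contour_integral (contour_integral ?c (resolvent w) - 2 * pi * \<i> * S N)) ?c" .
    show "norm (resolvent w z - (\<Sum>n<N. T n z)) \<le> B / norm w ^ N" if "norm (z - 0) = 1" for z
    proof -
      have z: "norm z = 1" using that by simp
      have "norm (resolvent w z - (\<Sum>n<N. T n z)) = norm (chi p e z) ^ N / norm w ^ N * norm (resolvent w z)"
        unfolding rem[OF z] by (simp add: norm_mult norm_power norm_divide power_divide)
      also have "\<dots> \<le> 1 / norm w ^ N * B"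
        using norm_chi_unit[OF z] B z by (intro mult_mono divide_right_mono power_le_one) auto
      finally show ?thesis by simp
    qed
  qed (use B in auto)
  have "(\<lambda>N. (B / norm w ^ N) * (2 * pi * 1)) \<longlonglongrightarrow> 0"
  proof -
    have "(\<lambda>N. B * (2 * pi) * (1 / norm w) ^ N) \<longlonglongrightarrow> B * (2 * pi) * 0"
      using w by (intro tendsto_mult_left LIMSEQ_realpow_zero) (auto simp: divide_less_eq)
    then show ?thesis by (simp add: power_divide mult.commute mult.left_commute)
  qed
  then have "(\<lambda>N. contour_integral ?c (resolvent w) - 2 * pi * \<i> * S N) \<longlonglongrightarrow> 0"
    by (rule Lim_null_comparison[rotated]) (use bound in auto)
  then have "(\<lambda>N. (contour_integral ?c (resolvent w) - (contour_integral ?c (resolvent w) - 2 * pi * \<i> * S N)) / (2 * pi * \<i>))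
     \<longlonglongrightarrow> (contour_integral ?c (resolvent w) - 0) / (2 * pi * \<i>)"
    by (intro tendsto_intros) auto
  then have "S \<longlonglongrightarrow> contour_integral ?c (resolvent w) / (2 * pi * \<i>)" by simp
  then show ?thesis unfolding sums_def S_def[abs_def] .
qed

lemma J_eq_contour_integral:
  "norm w > 1 \<Longrightarrow> J p e w = contour_integral (circlepath 0 1) (resolvent w) / (2 * pi * \<i>)"
  unfolding J_def using sums_unique[OF J_sums] by simp

lemma contour_integral_resolvent:
  assumes r: "r > 0" and no: "roots w \<inter> sphere 0 r = {}"
  shows "contour_integral (circlepath 0 r) (resolvent w) = 2 * pi * \<i> * (\<Sum>y\<in>roots w \<inter> ball 0 r. residue (resolvent w) y)"
proof -
  have "contour_integral (circlepath 0 r) (resolvent w)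
     = 2 * pi * \<i> * (\<Sum>y\<in>roots w. winding_number (circlepath 0 r) y * residue (resolvent w) y)"
    by (rule Residue_theorem[of UNIV])
      (use resolvent_holomorphic[of w] finite_roots no r in \<open>auto simp: Compl_eq_Diff_UNIV[symmetric]\<close>)
  also have "(\<Sum>y\<in>roots w. winding_number (circlepath 0 r) y * residue (resolvent w) y)
     = (\<Sum>y\<in>roots w \<inter> ball 0 r. residue (resolvent w) y)"
  proof (rule sum.mono_neutral_cong_right)
    show "winding_number (circlepath 0 r) y * residue (resolvent w) y = residue (resolvent w) y"
      if "y \<in> roots w \<inter> ball 0 r" for y
      using that winding_number_circlepath[of y 0 r] by simp
    show "\<forall>y\<in>roots w - roots w \<inter> ball 0 r. winding_number (circlepath 0 r) y * residue (resolvent w) y = 0"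
    proof
      fix y assume y: "y \<in> roots w - roots w \<inter> ball 0 r"
      then have "y \<notin> cball 0 r" using no by auto
      then have "winding_number (circlepath 0 r) y = 0"
        using r by (intro winding_number_zero_outside[of _ "cball 0 r"]) auto
      then show "winding_number (circlepath 0 r) y * residue (resolvent w) y = 0" by simp
    qed
  qed (auto simp: finite_roots)
  finally show ?thesis .
qed

text \<open>From w = \<chi>(y) one gets dw = \<chi>'(y) dy, so this is minus the logarithmic
  derivative of the root with respect to w.\<close>

lemma residue_resolvent:
  assumes y: "y \<in> roots w" and d: "deriv (chi p e) y \<noteq> 0"
  shows "residue (resolvent w) y = - 1 / (y * deriv (chi p e) y)"
proof -
  have y': "y \<noteq> 0" "chi p e y = w" using y by (auto simp: roots_def)
  have chi': "(chi p e has_field_derivative deriv (chi p e) y) (at y)"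
    using has_deriv_chi[OF y'(1)] deriv_chi[OF y'(1)] by simp
  have "((\<lambda>z. z ^ e * (w - chi p e z)) has_field_derivative
     (of_nat e * y ^ (e - 1)) * (w - chi p e y) + (0 - deriv (chi p e) y) * y ^ e) (at y)"
    by (intro DERIV_mult DERIV_diff DERIV_const chi') (auto intro!: derivative_eq_intros)
  then have "((\<lambda>z. z ^ e * (w - chi p e z)) has_field_derivative (- deriv (chi p e) y * y ^ e)) (at y)"
    using y' by simp
  then have der: "((\<lambda>z. w * z ^ e - poly (cpoly p) z) has_field_derivative (- deriv (chi p e) y * y ^ e)) (at y)"
    by (rule has_field_derivative_transform_within_open[where S = "- {0}"])
      (use y' in \<open>auto simp: chi_def field_simps\<close>)
  have "residue (\<lambda>z. z ^ (e - 1) / (w * z ^ e - poly (cpoly p) z)) y = y ^ (e - 1) / (- deriv (chi p e) y * y ^ e)"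
  proof (rule residue_simple_pole_deriv[where s = UNIV])
    show "w * y ^ e - poly (cpoly p) y = 0" using y resolvent_denom_zero_iff by simp
    show "- deriv (chi p e) y * y ^ e \<noteq> 0" using d y' by simp
  qed (use y' der in \<open>auto intro!: holomorphic_intros\<close>)
  also have "\<dots> = - 1 / (y * deriv (chi p e) y)"
  proof -
    obtain m where m: "e = Suc m" using e_pos by (cases e) auto
    show ?thesis using y' d by (simp add: m field_simps)
  qed
  finally show ?thesis unfolding resolvent_def .
qed

lemma J_eq_residues:
  assumes "norm w > 1"
  shows "J p e w = (\<Sum>y\<in>roots w \<inter> ball 0 1. residue (resolvent w) y)"
proof -
  have "roots w \<inter> sphere 0 1 = {}" using assms norm_chi_unit by (fastforce simp: roots_def)
  then show ?thesis using J_eq_contour_integral[OF assms] contour_integral_resolvent[of 1 w] by simp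
qed

text \<open>A circle that no root crosses gives an analytic function of w even where roots inside it
  collide. This handles all the small roots that are not tracked individually.\<close>

lemma contour_integral_resolvent_holomorphic:
  assumes r: "r > 0" and no: "\<And>w. w \<in> ball w0 \<delta> \<Longrightarrow> roots w \<inter> sphere 0 r = {}"
  shows "(\<lambda>w. contour_integral (circlepath 0 r) (resolvent w)) holomorphic_on ball w0 \<delta>"
proof -
  define c where "c t = circlepath 0 r t" for t
  have cn: "norm (c t) = r" for t using r by (simp add: c_def circlepath norm_mult)
  have ne: "w * c t ^ e - poly (cpoly p) (c t) \<noteq> 0" if "w \<in> ball w0 \<delta>" for w t
    using no[OF that] cn[of t] resolvent_denom_zero_iff[of w "c t"] by auto
  have contc: "continuous_on A c" for A
    unfolding c_def circlepath by (intro continuous_intros)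
  define v where "v t = 2 * pi * \<i> * r * exp (2 * of_real pi * \<i> * complex_of_real t)" for t
  have contv: "continuous_on A v" for A unfolding v_def by (intro continuous_intros)
  have eq: "contour_integral (circlepath 0 r) (resolvent w) = integral (cbox 0 1) (\<lambda>t. resolvent w (c t) * v t)" for w
    by (simp add: contour_integral_integral vector_derivative_circlepath c_def v_def)
  show ?thesis unfolding eq
  proof (rule leibniz_rule_holomorphic)
    show "((\<lambda>w. resolvent w (c t) * v t) has_field_derivative
        (- (c t ^ (e - 1) * c t ^ e) / (w * c t ^ e - poly (cpoly p) (c t))\<^sup>2) * v t) (at w within ball w0 \<delta>)"
      if "w \<in> ball w0 \<delta>" for w t
      unfolding resolvent_def using ne[OF that, of t]
      by (auto intro!: derivative_eq_intros simp: power2_eq_square)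
    show "(\<lambda>t. resolvent w (c t) * v t) integrable_on cbox 0 1" if "w \<in> ball w0 \<delta>" for w
      unfolding resolvent_def using ne[OF that]
      by (intro integrable_continuous continuous_intros contc contv) auto
    have c2: "continuous_on A (\<lambda>x. c (snd x))" for A :: "(complex \<times> real) set"
      by (rule continuous_on_compose2[OF contc[of UNIV]]) (auto intro: continuous_intros)
    have v2: "continuous_on A (\<lambda>x. v (snd x))" for A :: "(complex \<times> real) set"
      by (rule continuous_on_compose2[OF contv[of UNIV]]) (auto intro: continuous_intros)
    show "continuous_on (ball w0 \<delta> \<times> cbox 0 1)
      (\<lambda>(w, t). (- (c t ^ (e - 1) * c t ^ e) / (w * c t ^ e - poly (cpoly p) (c t))\<^sup>2) * v t)"
      unfolding case_prod_unfold using ne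
      by (intro continuous_intros c2 v2) auto
  qed auto
qed

text \<open>\<open>E\<close> collects the small roots away from 1 by a circle of radius less than 1;
  it depends on z^2 only and is therefore even. The other summand is the residue at the small
  positive root g(-x), rewritten by differentiating \<chi>(g(z)) = 1 + z^2.\<close>

lemma J_near_1:
  "\<exists>\<epsilon>>0. \<exists>g E. g holomorphic_on ball 0 \<epsilon> \<and> E holomorphic_on ball 0 \<epsilon> \<and>
     (\<forall>z\<in>ball 0 \<epsilon>. g z \<noteq> 0) \<and> deriv g 0 \<noteq> 0 \<and>
     (\<forall>x. \<bar>x\<bar> < \<epsilon> \<longrightarrow> g (of_real x) = of_real (tau p e x)) \<and>
     (\<forall>x. 0 < x \<longrightarrow> x < \<epsilon> \<longrightarrow> J p e (of_real (1 + x\<^sup>2)) =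
        E (of_real x) + deriv g (of_real (- x)) / (2 * of_real x * g (of_real (- x)))) \<and>
     (\<forall>z\<in>ball 0 \<epsilon>. E (- z) = E z)"
proof -
  obtain r0 g \<eta> where g: "r0 > 0" "\<eta> > 0" "g holomorphic_on ball 0 r0" "inj_on g (ball 0 r0)"
     "\<And>x. \<bar>x\<bar> < r0 \<Longrightarrow> g (of_real x) = of_real (tau p e x)"
     "\<And>z. z \<in> ball 0 r0 \<Longrightarrow> g z \<noteq> 0" "\<And>z. z \<in> ball 0 r0 \<Longrightarrow> chi p e (g z) = 1 + z\<^sup>2"
     and groots: "\<And>x y. \<bar>x\<bar> < r0 \<Longrightarrow> dist y 1 < \<eta> \<Longrightarrow> chi p e y = of_real (1 + x\<^sup>2) \<Longrightarrow>
        y = of_real (tau p e x) \<or> y = of_real (tau p e (- x))"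
    using tau_extends_0 by blast
  \<comment> \<open>The largest modulus of a root for \<lambda> = 1 inside the unit disc; 1/2 is
    inserted to keep the set nonempty and \<open>r\<close> positive. The radius \<open>r\<close> is
    halfway between \<open>M\<close> and 1.\<close>
  define M where "M = Max (insert (1/2) (norm ` (roots 1 \<inter> ball 0 1)))"
  have finM: "finite (insert (1/2) (norm ` (roots 1 \<inter> ball 0 1)))" using finite_roots by auto
  have M: "1/2 \<le> M" unfolding M_def by (rule Max_ge[OF finM]) simp
  have M': "norm y \<le> M" if "y \<in> roots 1" "norm y < 1" for y
    unfolding M_def by (rule Max_ge[OF finM]) (use that in auto)
  have "M < 1" unfolding M_def by (subst Max_less_iff[OF finM]) auto
  define r where "r = (M + 1) / 2"
  have r: "0 < r" "M < r" "r < 1" using M \<open>M < 1\<close> by (auto simp: r_def)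
  define P where "P y0 \<epsilon> \<longleftrightarrow> (norm y0 < 1 \<longrightarrow> ball y0 \<epsilon> \<subseteq> ball 0 r) \<and> (norm y0 > 1 \<longrightarrow> ball y0 \<epsilon> \<subseteq> - cball 0 1)
     \<and> (y0 = 1 \<longrightarrow> \<epsilon> \<le> min \<eta> (1 - r))" for y0 :: complex and \<epsilon> :: real
  have "\<exists>\<epsilon>>0. \<forall>y0\<in>roots 1. P y0 \<epsilon>"
  proof (rule uniform_radius[OF finite_roots])
    fix y0 assume y0: "y0 \<in> roots 1"
    consider "norm y0 < 1" | "norm y0 > 1" | "norm y0 = 1" by linarith
    then show "\<exists>\<epsilon>>0. P y0 \<epsilon>"
    proof cases
      case 1
      then have "y0 \<in> ball 0 r" using M'[OF y0] r by simp
      then obtain \<epsilon> where "\<epsilon> > 0" "ball y0 \<epsilon> \<subseteq> ball 0 r" using open_contains_ball open_ball by metis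
      then show ?thesis using 1 by (intro exI[of _ \<epsilon>]) (auto simp: P_def)
    next
      case 2
      then have "y0 \<in> - cball 0 1" by simp
      moreover have "open (- cball (0::complex) 1)" by (simp add: open_Compl)
      ultimately obtain \<epsilon> where "\<epsilon> > 0" "ball y0 \<epsilon> \<subseteq> - cball 0 1" using open_contains_ball by metis
      then show ?thesis using 2 by (intro exI[of _ \<epsilon>]) (auto simp: P_def)
    next
      case 3
      then show ?thesis using g(2) r by (intro exI[of _ "min \<eta> (1 - r)"]) (auto simp: P_def)
    qed
  next
    fix y0 s s' assume "y0 \<in> roots 1" "P y0 s" "0 < s'" "s' \<le> s"
    then show "P y0 s'" unfolding P_def by (meson order_trans subset_ball)
  qed
  then obtain \<epsilon>0 where e0: "\<epsilon>0 > 0" "\<And>y0. y0 \<in> roots 1 \<Longrightarrow> P y0 \<epsilon>0" by blast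
  obtain \<delta> where d: "\<delta> > 0" "\<And>w y. dist w 1 < \<delta> \<Longrightarrow> y \<in> roots w \<Longrightarrow> \<exists>y0\<in>roots 1. dist y y0 < \<epsilon>0"
    using roots_near[OF e0(1), of 1] by blast
  have one: "norm y0 = 1 \<Longrightarrow> y0 = 1" if "y0 \<in> roots 1" for y0
    using unit_root[of y0 0] that by simp
  have loc: "norm y < r \<or> norm y > 1 \<or> (dist y 1 < \<eta> \<and> norm y > r)" if wy: "dist w 1 < \<delta>" "y \<in> roots w" for w y
  proof -
    obtain y0 where y0: "y0 \<in> roots 1" "dist y y0 < \<epsilon>0" using d(2)[OF wy] by blast
    have Py: "P y0 \<epsilon>0" using e0(2) y0 by blast
    have yb: "y \<in> ball y0 \<epsilon>0" using y0 by (simp add: dist_commute)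
    consider "norm y0 < 1" | "norm y0 > 1" | "y0 = 1" using one[OF y0(1)] by linarith
    then show ?thesis
    proof cases
      case 1 then have "y \<in> ball 0 r" using Py yb unfolding P_def by blast
      then show ?thesis by simp
    next
      case 2 then have "y \<in> - cball 0 1" using Py yb unfolding P_def by blast
      then show ?thesis by simp
    next
      case 3
      then have "dist y 1 < min \<eta> (1 - r)" using Py y0(2) unfolding P_def by auto
      moreover have "1 \<le> norm y + dist y 1" using norm_triangle_sub[of 1 y] by (simp add: dist_norm norm_minus_commute)
      ultimately show ?thesis by auto
    qed
  qed
  have nor: "roots w \<inter> sphere 0 r = {}" if "dist w 1 < \<delta>" for w
    using loc[OF that] r by fastforce
  obtain r1 where r1: "r1 > 0" "\<And>u::complex. dist u 0 < r1 \<Longrightarrow> dist (1 + u\<^sup>2) 1 < \<delta>"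
    using one_plus_square_near[OF d(1), of 0] by auto
  have "1 - r > 0" using r by simp
  then obtain r2 where r2': "r2 > 0" "\<forall>x. dist x 0 < r2 \<longrightarrow> dist (tau p e x) (tau p e 0) < 1 - r"
    using tau_cont[of 0] unfolding continuous_at_eps_delta by blast
  then have r2: "r2 > 0" "\<And>x. \<bar>x\<bar> < r2 \<Longrightarrow> \<bar>tau p e x - 1\<bar> < 1 - r"
    by (simp_all add: tau_0 dist_real_def)
  define \<epsilon> where "\<epsilon> = Min {r0, r1, r2}"
  have eps: "\<epsilon> > 0" "\<epsilon> \<le> r0" "\<epsilon> \<le> r1" "\<epsilon> \<le> r2" using g r1 r2 by (auto simp: \<epsilon>_def)
  define E where "E z = contour_integral (circlepath 0 r) (resolvent (1 + z\<^sup>2)) / (2 * pi * \<i>)" for z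
  have "(\<lambda>w. contour_integral (circlepath 0 r) (resolvent w)) holomorphic_on ball 1 \<delta>"
    by (rule contour_integral_resolvent_holomorphic[OF r(1)]) (use nor in \<open>simp add: dist_commute\<close>)
  then have "(\<lambda>w. contour_integral (circlepath 0 r) (resolvent w)) \<circ> (\<lambda>z. 1 + z\<^sup>2) holomorphic_on ball 0 \<epsilon>"
  proof (rule holomorphic_on_compose_gen[rotated])
    show "(\<lambda>z::complex. 1 + z\<^sup>2) ` ball 0 \<epsilon> \<subseteq> ball 1 \<delta>"
    proof (rule image_subsetI)
      fix z :: complex assume "z \<in> ball 0 \<epsilon>"
      then have "dist z 0 < r1" using eps by simp
      then show "1 + z\<^sup>2 \<in> ball 1 \<delta>" using r1(2)[of z] by (simp only: mem_ball dist_commute)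
    qed
  qed (intro holomorphic_intros)
  then have holE: "E holomorphic_on ball 0 \<epsilon>"
    unfolding E_def by (intro holomorphic_intros) (auto simp: o_def)
  have Jx: "J p e (of_real (1 + x\<^sup>2)) = E (of_real x) + deriv g (of_real (- x)) / (2 * of_real x * g (of_real (- x)))"
    if x: "0 < x" "x < \<epsilon>" for x
  proof -
    define w where "w = complex_of_real (1 + x\<^sup>2)"
    define t where "t = complex_of_real (tau p e (- x))"
    have "norm w = 1 + x\<^sup>2" unfolding w_def norm_of_real using zero_le_power2[of x] by linarith
    then have nw: "norm w > 1" using x by simp
    have wd: "dist w 1 < \<delta>" using r1(2)[of "of_real x"] x eps by (simp add: w_def)
    have t: "t \<in> roots w" using tau_pos[of "- x"] by (simp add: t_def w_def roots_def chi_of_real rchi_tau)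
    have nt: "norm t = tau p e (- x)" using tau_pos[of "- x"] by (simp add: t_def)
    have nt': "r < norm t" "norm t < 1" using r2(2)[of "- x"] x eps tau_lt_1[of "- x"] unfolding nt by auto
    have "roots w \<inter> ball 0 1 = insert t (roots w \<inter> ball 0 r)"
    proof (intro equalityI subsetI)
      fix y assume y: "y \<in> roots w \<inter> ball 0 1"
      then consider "norm y < r" | "dist y 1 < \<eta>" using loc[OF wd, of y] by auto
      then show "y \<in> insert t (roots w \<inter> ball 0 r)"
      proof cases
        case 2
        then have "y = of_real (tau p e x) \<or> y = t"
          unfolding t_def using groots[of x y] y x eps by (auto simp: roots_def w_def)
        moreover have "norm (complex_of_real (tau p e x)) > 1" using tau_gt_1[of x] x by simp
        ultimately show ?thesis using y by auto
      qed (use y in auto)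
    qed (use t nt' r in auto)
    moreover have "t \<notin> roots w \<inter> ball 0 r" using nt' by simp
    ultimately have "J p e w = residue (resolvent w) t + (\<Sum>y\<in>roots w \<inter> ball 0 r. residue (resolvent w) y)"
      unfolding J_eq_residues[OF nw] using finite_roots by simp
    also have "(\<Sum>y\<in>roots w \<inter> ball 0 r. residue (resolvent w) y) = E (of_real x)"
      unfolding E_def using contour_integral_resolvent[OF r(1) nor[OF wd]] by (simp add: w_def)
    also have "residue (resolvent w) t = deriv g (of_real (- x)) / (2 * of_real x * g (of_real (- x)))"
    proof -
      let ?u = "complex_of_real (- x)"
      have u: "?u \<in> ball 0 r0" using x eps by simp
      have gt: "g ?u = t" unfolding t_def using g(5)[of "- x"] x eps by simp
      have dt: "deriv (chi p e) t \<noteq> 0" unfolding t_def using deriv_chi_tau_nz[of "- x"] x by simp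
      have t0: "t \<noteq> 0" using t by (simp add: roots_def)
      have "(g has_field_derivative deriv g ?u) (at ?u)"
        using g(3) u by (intro holomorphic_derivI[of _ "ball 0 r0"]) auto
      moreover have "(chi p e has_field_derivative deriv (chi p e) t) (at (g ?u))"
        unfolding gt using has_deriv_chi[OF t0] deriv_chi[OF t0] by simp
      ultimately have "((\<lambda>z. chi p e (g z)) has_field_derivative deriv (chi p e) t * deriv g ?u) (at ?u)"
        by (rule DERIV_chain2[rotated])
      moreover have "((\<lambda>z. chi p e (g z)) has_field_derivative 2 * ?u) (at ?u)"
        by (rule has_field_derivative_transform_within_open[where S = "ball 0 r0" and f = "\<lambda>z. 1 + z\<^sup>2"])
          (use g(7) u in \<open>auto intro!: derivative_eq_intros\<close>)
      ultimately have "deriv (chi p e) t * deriv g ?u = 2 * ?u" by (rule DERIV_unique)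
      then have "deriv g ?u = 2 * ?u / deriv (chi p e) t" using dt by (simp add: field_simps)
      then show ?thesis unfolding residue_resolvent[OF t dt] gt using x t0 dt by (simp add: field_simps)
    qed
    finally show ?thesis unfolding w_def by simp
  qed
  have c1: "deriv g 0 \<noteq> 0" using holomorphic_injective_imp_regular[OF g(3) open_ball g(4)] g(1) by simp
  have c2: "g holomorphic_on ball 0 \<epsilon>" using g(3) eps by (meson holomorphic_on_subset subset_ball)
  have c3: "\<forall>z\<in>ball 0 \<epsilon>. g z \<noteq> 0" "\<forall>x. \<bar>x\<bar> < \<epsilon> \<longrightarrow> g (of_real x) = of_real (tau p e x)"
    using g(5,6) eps by auto
  have c4: "\<forall>z\<in>ball 0 \<epsilon>. E (- z) = E z" by (simp add: E_def)
  show ?thesis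
    by (rule exI[of _ \<epsilon>], rule conjI[OF eps(1)], rule exI[of _ g], rule exI[of _ E])
      (intro conjI c1 c2 holE c3 c4, use Jx in blast)
qed

text \<open>The Puiseux expansion of the small roots at \<open>\<lambda> = \<infinity>\<close>, with \<open>v = \<lambda>\<^bsup>-1/e\<^esup>\<close>. Applied to the reflected
  walk it describes the reciprocals of the large roots.\<close>

definition zero_branch :: "real \<Rightarrow> (complex \<Rightarrow> complex) \<Rightarrow> bool" where
  "zero_branch \<rho> Y \<longleftrightarrow> 0 < \<rho> \<and> \<rho> < 1 \<and> Y holomorphic_on ball 0 \<rho> \<and> inj_on Y (ball 0 \<rho>) \<and> Y 0 = 0 \<and>
     (\<forall>v\<in>ball 0 \<rho> - {0}. Y v \<in> roots (1 / v ^ e) \<and> norm (Y v) < 1) \<and>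
     (\<forall>v\<in>ball 0 \<rho> - {0}. \<forall>y\<in>roots (1 / v ^ e). norm y \<le> 1 \<longrightarrow> (\<exists>u. u ^ e = 1 \<and> y = Y (u * v))) \<and>
     (\<forall>v x. 0 < v \<longrightarrow> v < \<rho> \<longrightarrow> 0 \<le> x \<longrightarrow> 1 + x\<^sup>2 = 1 / v ^ e \<longrightarrow> Y (of_real v) = of_real (tau p e (- x)))"

lemma zero_branchD:
  assumes "zero_branch \<rho> Y"
  shows "0 < \<rho>" "\<rho> < 1" "Y holomorphic_on ball 0 \<rho>" "inj_on Y (ball 0 \<rho>)"
    and "v \<in> ball 0 \<rho> - {0} \<Longrightarrow> Y v \<noteq> 0"
  using assms unfolding zero_branch_def roots_def by blast+

lemma zero_branch_mono:
  assumes Y: "zero_branch \<rho> Y" and rho: "0 < \<rho>'" "\<rho>' \<le> \<rho>"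
  shows "zero_branch \<rho>' Y"
proof -
  note Y = Y[unfolded zero_branch_def]
  have sub: "ball 0 \<rho>' \<subseteq> ball (0::complex) \<rho>" by (rule subset_ball[OF rho(2)])
  have "Y holomorphic_on ball 0 \<rho>'" using Y sub holomorphic_on_subset by blast
  moreover have "inj_on Y (ball 0 \<rho>')" using Y sub by (meson inj_on_subset)
  moreover have "\<forall>v x. 0 < v \<longrightarrow> v < \<rho>' \<longrightarrow> 0 \<le> x \<longrightarrow> 1 + x\<^sup>2 = 1 / v ^ e \<longrightarrow> Y (of_real v) = of_real (tau p e (- x))"
    using Y rho less_le_trans by blast
  moreover have "\<forall>v\<in>ball 0 \<rho>' - {0}. Y v \<in> roots (1 / v ^ e) \<and> norm (Y v) < 1" using Y sub by blast
  moreover have "\<forall>v\<in>ball 0 \<rho>' - {0}. \<forall>y\<in>roots (1 / v ^ e). norm y \<le> 1 \<longrightarrow> (\<exists>u. u ^ e = 1 \<and> y = Y (u * v))"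
    using Y sub by blast
  moreover have "\<rho>' < 1" "Y 0 = 0" using Y rho by auto
  ultimately show ?thesis using rho unfolding zero_branch_def by blast
qed

text \<open>The function \<open>h\<close>, which is z p(z)^(-1/e), satisfies h^e = 1/\<chi> and has
  a simple zero at 0; \<open>Y\<close> is its local inverse. The principal logarithm is analytic
  here because p has positive real part near 0.\<close>

lemma branch_at_zero: "\<exists>\<rho> Y. zero_branch \<rho> Y"
proof -
  define P where "P = poly (cpoly p)"
  have P0: "P 0 = of_real (coeff p 0)" by (simp add: P_def poly_0_coeff_0)
  have "isCont P 0" unfolding P_def by (rule poly_isCont)
  moreover have "Re (P 0) > 0" using const_pos P0 by simp
  moreover have "open {z. Re z > 0}" by (simp add: open_halfspace_Re_gt)
  ultimately obtain r0 where r0: "r0 > 0" "\<And>z. dist z 0 < r0 \<Longrightarrow> Re (P z) > 0"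
    using continuous_at_open[of 0 P] by (metis (no_types, lifting) continuous_at_eps_delta mem_Collect_eq open_dist)
  define r where "r = min r0 1"
  have r: "r > 0" "r \<le> r0" "r \<le> 1" using r0 by (auto simp: r_def)
  have Pne: "P z \<notin> \<real>\<^sub>\<le>\<^sub>0" "P z \<noteq> 0" if "z \<in> ball 0 r" for z
    using r0(2)[of z] that r by (auto simp: complex_nonpos_Reals_iff)
  define h where "h z = z * exp (- Ln (P z) / of_nat e)" for z
  have holP: "P holomorphic_on A" for A unfolding P_def by (intro holomorphic_intros)
  have holh: "h holomorphic_on ball 0 r"
    unfolding h_def using e_pos Pne by (intro holomorphic_intros holP) auto
  have hpow: "h z ^ e = z ^ e / P z" if z: "z \<in> ball 0 r" for z
  proof -
    have "exp (- Ln (P z) / of_nat e) ^ e = exp (of_nat e * (- Ln (P z) / of_nat e))"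
      by (simp only: exp_of_nat_mult)
    also have "\<dots> = 1 / P z" using e_pos Pne(2)[OF z] by (simp add: exp_minus field_simps)
    finally show ?thesis by (simp add: h_def power_mult_distrib)
  qed
  have h0: "h 0 = 0" by (simp add: h_def)
  have dh: "deriv h 0 \<noteq> 0"
  proof -
    have "(\<lambda>z. exp (- Ln (P z) / of_nat e)) holomorphic_on ball 0 r"
      using e_pos Pne by (intro holomorphic_intros holP) auto
    then have "((\<lambda>z. exp (- Ln (P z) / of_nat e)) has_field_derivative deriv (\<lambda>z. exp (- Ln (P z) / of_nat e)) 0) (at 0)"
      using r by (intro holomorphic_derivI[of _ "ball 0 r"]) auto
    moreover have "h = (\<lambda>z. z * exp (- Ln (P z) / of_nat e))" by (simp add: fun_eq_iff h_def)
    ultimately have "(h has_field_derivative 1 * exp (- Ln (P 0) / of_nat e) + deriv (\<lambda>z. exp (- Ln (P z) / of_nat e)) 0 * 0) (at 0)"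
      using DERIV_mult[OF DERIV_ident] by blast
    then show ?thesis by (simp add: DERIV_imp_deriv)
  qed
  have c0: "0 \<in> ball (0::complex) r" using r by simp
  obtain s Y \<delta> where Y: "s > 0" "ball (0::complex) s \<subseteq> ball 0 r" "Y holomorphic_on ball (h 0) \<delta>" "\<delta> > 0"
    "\<And>w. w \<in> ball (h 0) \<delta> \<Longrightarrow> Y w \<in> ball 0 s \<and> h (Y w) = w" "\<And>z. z \<in> ball 0 s \<Longrightarrow> Y (h z) = z"
    by (rule holomorphic_local_inverse[OF holh open_ball c0 dh], rule that, assumption+)
  define \<rho> where "\<rho> = Min {\<delta>, s, 1/2}"
  have rho: "\<rho> > 0" "\<rho> \<le> \<delta>" "\<rho> \<le> s" "\<rho> < 1" using Y by (auto simp: \<rho>_def)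
  have Yv: "Y v \<in> ball 0 s" "h (Y v) = v" "Y v \<in> ball 0 r" if "v \<in> ball 0 \<rho>" for v
  proof -
    have "v \<in> ball (h 0) \<delta>" using that rho by (simp add: h0)
    then have "Y v \<in> ball 0 s \<and> h (Y v) = v" by (rule Y(5))
    then show "Y v \<in> ball 0 s" "h (Y v) = v" by simp_all
    then show "Y v \<in> ball 0 r" using Y(2) by blast
  qed
  have chiP: "chi p e y = P y / y ^ e" for y by (simp add: chi_def P_def)
  have hchi: "h y ^ e = 1 / chi p e y" if "y \<in> ball 0 r" for y
    using hpow[OF that] by (simp add: chiP)
  have 1: "Y holomorphic_on ball 0 \<rho>" using Y(3) rho by (metis h0 holomorphic_on_subset subset_ball)
  have 2: "inj_on Y (ball 0 \<rho>)" using Yv(2) by (metis inj_onI)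
  have 3: "Y 0 = 0" using Y(6)[of 0] Y(1) h0 by simp
  have 4: "Y v \<in> roots (1 / v ^ e) \<and> norm (Y v) < 1" if v: "v \<in> ball 0 \<rho> - {0}" for v
  proof -
    have vb: "v \<in> ball 0 \<rho>" "v \<noteq> 0" using v by auto
    have "Y v \<noteq> 0" using Yv(2)[OF vb(1)] h0 vb(2) by auto
    moreover have "v ^ e = 1 / chi p e (Y v)" using hchi[OF Yv(3)[OF vb(1)]] Yv(2)[OF vb(1)] by simp
    ultimately show ?thesis using Yv(3)[OF vb(1)] r by (simp add: roots_def)
  qed
  \<comment> \<open>The bound |y| \<le> |v| puts every root of modulus at most 1 into the domain of
    the inverse, so that \<open>Y\<close> misses none of them.\<close>
  have hroot: "h y ^ e = v ^ e \<and> y \<in> ball 0 s" if v: "v \<in> ball 0 \<rho> - {0}" and y: "y \<in> roots (1 / v ^ e)" "norm y \<le> 1" for v y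
  proof -
    have "norm (1 / v ^ e) * norm y ^ e \<le> 1" by (rule small_root_bound[OF y])
    then have "norm y ^ e \<le> norm v ^ e" using v by (simp add: norm_divide norm_power field_simps)
    then have "norm y \<le> norm v" using e_pos by (subst (asm) power_mono_iff) auto
    then have ys: "y \<in> ball 0 s" using v rho by simp
    then have "y \<in> ball 0 r" using Y(2) by blast
    then show ?thesis using hchi[of y] y ys by (simp add: roots_def)
  qed
  have 5: "\<exists>u. u ^ e = 1 \<and> y = Y (u * v)" if v: "v \<in> ball 0 \<rho> - {0}" and y: "y \<in> roots (1 / v ^ e)" "norm y \<le> 1" for v y
  proof -
    have "h y ^ e = v ^ e" "y \<in> ball 0 s" using hroot[OF v y] by auto
    then have "(h y / v) ^ e = 1" "y = Y (h y / v * v)" using v Y(6)[of y] by (auto simp: power_divide)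
    then show ?thesis by blast
  qed
  have 6: "Y (of_real v) = of_real (tau p e (- x))" if v: "0 < v" "v < \<rho>" "0 \<le> x" "1 + x\<^sup>2 = 1 / v ^ e" for v x
  proof -
    let ?t = "tau p e (- x)"
    have t: "?t > 0" "?t \<le> 1" using tau_pos[of "- x"] tau_lt_1[of "- x"] tau_0 v(3)
      by (cases "x = 0"; simp)+
    have "chi p e (of_real ?t) = of_real (1 + x\<^sup>2)" by (simp only: chi_of_real rchi_tau) simp
    then have "complex_of_real ?t \<in> roots (1 / of_real v ^ e)" using t unfolding v(4) by (simp add: roots_def)
    moreover have vb: "complex_of_real v \<in> ball 0 \<rho> - {0}" using v by simp
    ultimately have hr: "h (of_real ?t) ^ e = of_real v ^ e" "complex_of_real ?t \<in> ball 0 s" 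
      using hroot[of "of_real v" "of_real ?t"] t by auto
    have pt: "poly p ?t > 0"
    proof -
      have "poly p ?t = rchi p e ?t * ?t ^ e" using t by (simp add: rchi_def)
      then show ?thesis using t by (simp add: rchi_tau add_pos_nonneg)
    qed
    have hh: "h (of_real ?t) = of_real (?t * exp (- ln (poly p ?t) / e))"
      unfolding h_def P_def poly_cpoly_of_real Ln_of_real[OF pt] by (simp add: exp_of_real[symmetric])
    have "(?t * exp (- ln (poly p ?t) / e)) ^ e = v ^ e"
      using hr(1) unfolding hh by (simp only: of_real_power[symmetric] of_real_eq_iff)
    then have "?t * exp (- ln (poly p ?t) / e) = v" using t v e_pos
      by (subst (asm) power_eq_iff_eq_base) auto
    then have "h (of_real ?t) = of_real v" using hh by simp
    then show ?thesis using Y(6)[OF hr(2)] by simp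
  qed
  show ?thesis
    unfolding zero_branch_def
    by (rule exI[of _ \<rho>], rule exI[of _ Y]) (intro conjI rho(1) rho(4) 1 2 3, use 4 5 6 in \<open>blast+\<close>)
qed

text \<open>The e small roots are Y(u v) for the e-th roots of unity u, and each summand is a
  residue rewritten by differentiating \<chi>(Y(z)) = z^(-e).\<close>

lemma J_near_infinity:
  assumes Y': "zero_branch \<rho> Y" and v: "v \<in> ball 0 \<rho> - {0}"
  shows "J p e (1 / v ^ e) = v ^ e / of_nat e * (\<Sum>u | u ^ e = 1. u * v * deriv Y (u * v) / Y (u * v))"
proof -
  have rho: "0 < \<rho>" "\<rho> < 1" and Y: "Y holomorphic_on ball 0 \<rho>" "inj_on Y (ball 0 \<rho>)"
    and Yr: "\<And>v. v \<in> ball 0 \<rho> - {0} \<Longrightarrow> Y v \<in> roots (1 / v ^ e) \<and> norm (Y v) < 1"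
    and all: "\<And>v y. v \<in> ball 0 \<rho> - {0} \<Longrightarrow> y \<in> roots (1 / v ^ e) \<Longrightarrow> norm y \<le> 1 \<Longrightarrow> \<exists>u. u ^ e = 1 \<and> y = Y (u * v)"
    using Y' unfolding zero_branch_def by blast+
  define w where "w = 1 / v ^ e"
  have v0: "v \<noteq> 0" "norm v < \<rho>" using v by auto
  have un: "norm u = 1" if "u ^ e = 1" for u :: complex
    using that e_pos by (metis norm_one norm_power norm_ge_zero power_eq_1_iff less_not_refl)
  have uv: "u * v \<in> ball 0 \<rho> - {0}" "(u * v) ^ e = v ^ e" if "u ^ e = 1" for u
    using un[OF that] v0 that by (auto simp: norm_mult power_mult_distrib)
  have "norm v ^ e < 1" using v0 rho e_pos by (simp add: power_Suc_less_one power_less_one_iff)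
  then have nw: "norm w > 1" using v0 by (simp add: w_def norm_divide norm_power)
  have eq: "roots w \<inter> ball 0 1 = (\<lambda>u. Y (u * v)) ` {u. u ^ e = 1}"
  proof (intro equalityI subsetI)
    fix y assume "y \<in> roots w \<inter> ball 0 1"
    then show "y \<in> (\<lambda>u. Y (u * v)) ` {u. u ^ e = 1}" using all[OF v, of y] by (auto simp: w_def)
  next
    fix y assume "y \<in> (\<lambda>u. Y (u * v)) ` {u. u ^ e = 1}"
    then obtain u where "u ^ e = 1" "y = Y (u * v)" by auto
    then show "y \<in> roots w \<inter> ball 0 1" using Yr[OF uv(1)[of u]] uv(2)[of u] by (simp add: w_def)
  qed
  have inj: "inj_on (\<lambda>u. Y (u * v)) {u. u ^ e = 1}"
  proof (rule inj_onI)
    fix u u' assume "u \<in> {u. u ^ e = 1}" "u' \<in> {u. u ^ e = 1}" "Y (u * v) = Y (u' * v)"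
    then have "u * v = u' * v" using Y(2) uv(1) by (auto dest: inj_onD)
    then show "u = u'" using v0 by simp
  qed
  have res: "residue (resolvent w) (Y (u * v)) = v ^ e / of_nat e * (u * v * deriv Y (u * v) / Y (u * v))"
    if u: "u ^ e = 1" for u
  proof -
    define z where "z = u * v"
    have z: "z \<in> ball 0 \<rho>" "z \<noteq> 0" "z ^ e = v ^ e" using uv[OF u] unfolding z_def[symmetric] by auto
    have yr: "Y z \<in> roots w" using Yr[of z] z by (simp add: w_def)
    then have y0: "Y z \<noteq> 0" by (simp add: roots_def)
    have "(Y has_field_derivative deriv Y z) (at z)"
      using Y(1) z by (intro holomorphic_derivI[of _ "ball 0 \<rho>"]) auto
    moreover have "(chi p e has_field_derivative deriv (chi p e) (Y z)) (at (Y z))"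
      using has_deriv_chi[OF y0] deriv_chi[OF y0] by simp
    ultimately have "((\<lambda>z. chi p e (Y z)) has_field_derivative deriv (chi p e) (Y z) * deriv Y z) (at z)"
      by (rule DERIV_chain2[rotated])
    moreover have "((\<lambda>z. chi p e (Y z)) has_field_derivative - (of_nat e * z ^ (e - 1)) / (z ^ e * z ^ e)) (at z)"
    proof (rule has_field_derivative_transform_within_open[where S = "ball 0 \<rho> - {0}" and f = "\<lambda>z. 1 / z ^ e"])
      show "((\<lambda>z. 1 / z ^ e) has_field_derivative - (of_nat e * z ^ (e - 1)) / (z ^ e * z ^ e)) (at z)"
        using z by (auto intro!: derivative_eq_intros)
      show "open (ball (0::complex) \<rho> - {0})" by (simp add: open_delete)
    qed (use z Yr in \<open>auto simp: roots_def\<close>)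
    ultimately have "deriv (chi p e) (Y z) * deriv Y z = - (of_nat e * z ^ (e - 1)) / (z ^ e * z ^ e)"
      by (rule DERIV_unique)
    moreover obtain m where m: "e = Suc m" using e_pos by (cases e) auto
    moreover have "- (of_nat e * z ^ (e - 1)) / (z ^ e * z ^ e) = - of_nat e / (z * z ^ e)"
      using z(2) unfolding m by (simp add: field_simps)
    ultimately have key: "deriv (chi p e) (Y z) * deriv Y z = - of_nat e / (z * z ^ e)"
      by simp
    have "- of_nat e / (z * z ^ e) \<noteq> 0" using z(2) e_pos by simp
    then have d: "deriv (chi p e) (Y z) \<noteq> 0" using key by auto
    have "- 1 / (Y z * deriv (chi p e) (Y z)) = z ^ e / of_nat e * (z * deriv Y z / Y z)"
    proof -
      have "deriv Y z = - of_nat e / (z * z ^ e) / deriv (chi p e) (Y z)"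
        unfolding key[symmetric] using d by simp
      then show ?thesis using d y0 z(2) e_pos by (simp add: field_simps)
    qed
    then show ?thesis using residue_resolvent[OF yr d] z(3) unfolding z_def by simp
  qed
  have "J p e w = (\<Sum>y\<in>(\<lambda>u. Y (u * v)) ` {u. u ^ e = 1}. residue (resolvent w) y)"
    unfolding J_eq_residues[OF nw] eq ..
  also have "\<dots> = (\<Sum>u | u ^ e = 1. residue (resolvent w) (Y (u * v)))"
    by (simp add: sum.reindex[OF inj])
  also have "\<dots> = (\<Sum>u | u ^ e = 1. v ^ e / of_nat e * (u * v * deriv Y (u * v) / Y (u * v)))"
    by (rule sum.cong) (use res in auto)
  finally show ?thesis by (simp add: w_def sum_distrib_left)
qed

end

subsection \<open>Unbiased walks with the same spectrum\<close>

lemma cpoly_reflect: "cpoly (reflect_poly p) = reflect_poly (cpoly p)"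
  by (rule poly_eqI) (simp add: coeff_reflect_poly)

context walk_poly
begin

lemma degree_reflect: "degree (reflect_poly p) = degree p"
  using const_pos by (intro degree_reflect_poly_eq) auto

text \<open>The steps change sign. This exchanges e and f and turns large roots into reciprocals of
  small ones, so the expansion at infinity is needed for small roots only.\<close>

lemma reflect_walk: "walk_poly (reflect_poly p) (degree p - e)"
proof
  show "coeff (reflect_poly p) k \<ge> 0" for k by (simp add: coeff_reflect_poly coeff_nonneg)
  show "poly (reflect_poly p) 1 = 1" using total poly_reflect_poly_nz[of "1::real" p] by simp
  show "coeff (reflect_poly p) 0 > 0" using lead_pos by simp
  show "0 < degree p - e" using e_less by simp
  show "degree p - e < degree (reflect_poly p)" using e_pos e_less by (simp add: degree_reflect)
  have "poly (pderiv (reflect_poly p)) 1 = (\<Sum>k\<le>degree p. coeff p (degree p - k) * real k)"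
    unfolding poly_pderiv_1 degree_reflect by (rule sum.cong) (auto simp: coeff_reflect_poly)
  also have "\<dots> = (\<Sum>k\<le>degree p. coeff p k * real (degree p - k))"
    by (rule sum.reindex_bij_witness[of _ "\<lambda>k. degree p - k" "\<lambda>k. degree p - k"]) auto
  also have "\<dots> = (\<Sum>k\<le>degree p. real (degree p) * coeff p k - coeff p k * real k)"
    by (rule sum.cong) (auto simp: of_nat_diff algebra_simps)
  also have "\<dots> = real (degree p) * (\<Sum>k\<le>degree p. coeff p k) - (\<Sum>k\<le>degree p. coeff p k * real k)"
    by (simp add: sum_subtractf sum_distrib_left)
  also have "\<dots> = real (degree p - e)"
    using sum_coeff unbiased e_less by (simp add: poly_pderiv_1 of_nat_diff)
  finally show "poly (pderiv (reflect_poly p)) 1 = real (degree p - e)" .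
  fix y :: complex assume y: "norm y = 1" and all: "\<And>k. coeff (reflect_poly p) k \<noteq> 0 \<Longrightarrow> y ^ k = y ^ (degree p - e)"
  have y0: "y \<noteq> 0" using y by auto
  show "y = 1"
  proof (rule aperiodic[OF y])
    fix k assume k: "coeff p k \<noteq> 0"
    then have kn: "k \<le> degree p" by (rule le_degree)
    then have "coeff (reflect_poly p) (degree p - k) \<noteq> 0" using k by (simp add: coeff_reflect_poly)
    then have "y ^ (degree p - k) = y ^ (degree p - e)" by (rule all)
    then have "y ^ (degree p - k) * y ^ k * y ^ e = y ^ (degree p - e) * y ^ e * y ^ k" by simp
    then have "y ^ degree p * y ^ e = y ^ degree p * y ^ k"
      using kn e_less by (simp flip: power_add)
    then show "y ^ k = y ^ e" using y0 by simp
  qed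
qed

lemma chi_reflect: "z \<noteq> 0 \<Longrightarrow> chi (reflect_poly p) (degree p - e) z = chi p e (1 / z)"
proof -
  assume z: "z \<noteq> 0"
  have "z ^ degree p = z ^ (degree p - e) * z ^ e" using e_less by (simp flip: power_add)
  then show ?thesis using z
    by (simp add: chi_def cpoly_reflect poly_reflect_poly_nz divide_inverse power_inverse)
qed

lemma rchi_reflect: "t \<noteq> 0 \<Longrightarrow> rchi (reflect_poly p) (degree p - e) t = rchi p e (1 / t)"
proof -
  assume t: "t \<noteq> 0"
  have "complex_of_real (rchi (reflect_poly p) (degree p - e) t) = of_real (rchi p e (1 / t))"
    unfolding chi_of_real[symmetric] using chi_reflect[of "of_real t"] t by simp
  then show ?thesis unfolding of_real_eq_iff .
qed

lemma roots_reflect: "y \<in> walk_poly.roots (reflect_poly p) (degree p - e) w \<longleftrightarrow> y \<noteq> 0 \<and> 1 / y \<in> roots w"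
  using chi_reflect[of y] by (auto simp: walk_poly.roots_def[OF reflect_walk] roots_def)

lemma tau_reflect: "tau (reflect_poly p) (degree p - e) x = 1 / tau p e (- x)"
proof (rule walk_poly.tau_eqI[OF reflect_walk])
  have t: "tau p e (- x) > 0" by (rule tau_pos)
  then show "1 / tau p e (- x) > 0" by simp
  show "rchi (reflect_poly p) (degree p - e) (1 / tau p e (- x)) = 1 + x\<^sup>2"
    using t by (simp add: rchi_reflect rchi_tau)
  show "sgn (1 / tau p e (- x) - 1) = sgn x"
    using sgn_tau[of "- x"] t by (auto simp: sgn_real_def field_simps split: if_splits)
qed

lemma return_coeff_reflect: "return_coeff (reflect_poly p) (degree p - e) n = return_coeff p e n"
proof -
  have "degree (p ^ n) = n * degree p" using p_nonzero by (simp add: degree_power_eq)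
  moreover have "n * degree p - n * (degree p - e) = n * e"
    using e_less by (simp flip: diff_mult_distrib2)
  ultimately show ?thesis
    by (auto simp: return_coeff_def reflect_poly_power[symmetric] coeff_reflect_poly not_less)
qed

text \<open>\<open>N\<close> will be a common multiple of several exponents: with \<lambda> = w^(-N)
  the parameter of this branch is w^(N/e), which is why \<open>a * e = N\<close>.\<close>

lemma zero_branch_real:
  assumes Y: "zero_branch \<rho> Y" and w: "0 < w" "w < \<rho>" and a: "a * e = N" "0 < a"
    and x: "0 \<le> x" "1 + x\<^sup>2 = 1 / w ^ N"
  shows "Y (of_real w ^ a) = of_real (tau p e (- x))"
proof -
  have "w ^ a \<le> w ^ 1" using w a Y unfolding zero_branch_def by (intro power_decreasing) auto
  then have "w ^ a < \<rho>" using w by simp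
  moreover have "1 + x\<^sup>2 = 1 / (w ^ a) ^ e" using x(2) unfolding a(1)[symmetric] power_mult .
  ultimately have "Y (of_real (w ^ a)) = of_real (tau p e (- x))"
    using Y w x(1) unfolding zero_branch_def by (metis zero_less_power)
  then show ?thesis by simp
qed

text \<open>The only positive small root is the value of \<open>Y\<close> at v^j, and injectivity
  prevents \<open>Y\<close> from taking it again at v^j u.\<close>

lemma zero_branch_other_small:
  assumes Y: "zero_branch \<rho> Y" and v: "0 < v" "v < \<rho>" and j: "j * e = N" "0 < j"
    and u: "u ^ e = 1" "u \<noteq> 1" "norm u = 1" and x: "0 \<le> x" "1 + x\<^sup>2 = 1 / v ^ N"
  shows "Y (of_real v ^ j * u) \<in> other_small x"
proof -
  let ?v = "complex_of_real v ^ j"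
  have rho: "\<rho> < 1" using Y unfolding zero_branch_def by simp
  have vb: "?v \<in> ball 0 \<rho>" using power_in_ball[of "of_real v" \<rho> j] v rho j by simp
  have vub: "?v * u \<in> ball 0 \<rho> - {0}" using vb u v by (auto simp: norm_mult)
  have "(?v * u) ^ e = of_real (v ^ N)"
    by (simp add: power_mult_distrib u(1) power_mult[symmetric] j(1))
  then have rw: "1 / (?v * u) ^ e = of_real (1 + x\<^sup>2)" using x(2) by simp
  have Zr: "Y (?v * u) \<in> roots (of_real (1 + x\<^sup>2))" "norm (Y (?v * u)) < 1"
    using Y vub unfolding zero_branch_def rw[symmetric] by auto
  have "Y (?v * u) \<notin> of_real ` {0..}"
  proof
    assume "Y (?v * u) \<in> of_real ` {0..}"
    then obtain t where t: "0 \<le> t" "Y (?v * u) = of_real t" by auto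
    then have t1: "0 < t" "t < 1" using Zr unfolding roots_def by (auto simp: less_le)
    have "chi p e (of_real t) = of_real (1 + x\<^sup>2)" using Zr(1) unfolding t(2) roots_def by simp
    then have "rchi p e t = 1 + x\<^sup>2" unfolding chi_of_real of_real_eq_iff .
    then have "t = tau p e x \<or> t = tau p e (- x)" using pos_root_eq_tau t1 by auto
    moreover have "tau p e x \<ge> 1" using tau_gt_1[of x] tau_0 x(1) by (cases "x = 0") auto
    ultimately have "t = tau p e (- x)" using t1 by auto
    then have "Y (?v * u) = Y ?v" using t(2) zero_branch_real[OF Y v j x] by simp
    then have "?v * u = ?v" using inj_onD[OF zero_branchD(4)[OF Y]] vb vub by blast
    then show False using u v by simp
  qed
  then show ?thesis unfolding other_small_def using Zr by simp
qed

lemma other_small_reflect: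
  assumes "y \<in> walk_poly.other_small (reflect_poly p) (degree p - e) x"
  shows "1 / y \<in> other_large x"
proof -
  have y: "y \<noteq> 0" "1 / y \<in> roots (of_real (1 + x\<^sup>2))" "norm y < 1" "y \<notin> of_real ` {0..}"
    using assms unfolding walk_poly.other_small_def[OF reflect_walk] Int_iff roots_reflect by auto
  have "1 / y \<notin> of_real ` {0..}"
  proof
    assume "1 / y \<in> of_real ` {0..}"
    then obtain t where t: "0 \<le> t" "1 / y = of_real t" by auto
    have "y = 1 / (1 / y)" by simp
    also have "\<dots> = of_real (1 / t)" unfolding t(2) by simp
    finally show False using t(1) y(4) by (metis atLeast_iff image_eqI zero_le_divide_1_iff)
  qed
  moreover have "1 < norm (1 / y)" using y(1,3) by (simp add: norm_divide)
  ultimately show ?thesis unfolding other_large_def using y(2) by simp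
qed

lemma zero_branch_deriv:
  assumes Y: "zero_branch \<rho> Y"
  shows "(Y has_field_derivative deriv Y 0) (at 0)" "deriv Y 0 \<noteq> 0" "Y 0 = 0"
  using Y holomorphic_injective_imp_regular[of Y "ball 0 \<rho>" 0] unfolding zero_branch_def
  by (auto intro!: holomorphic_derivI[of Y "ball 0 \<rho>"])

end

text \<open>A factor Y(w^m) behaves like D w^m, so the left side vanishes to order exactly a + b and
  the right side to order at least c + k.\<close>

lemma vanishing_order_le:
  fixes Y1 Y2 Y3 Y4 :: "complex \<Rightarrow> complex"
  assumes Y: "(Y1 has_field_derivative D1) (at 0)" "(Y2 has_field_derivative D2) (at 0)"
      "(Y3 has_field_derivative D3) (at 0)" "(Y4 has_field_derivative D4) (at 0)"
      "Y1 0 = 0" "Y2 0 = 0" "Y3 0 = 0" "Y4 0 = 0" "D1 \<noteq> 0" "D2 \<noteq> 0"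
    and pos: "0 < a" "0 < b" "0 < c" "0 < k"
    and ev: "eventually (\<lambda>w. Y1 (w ^ a) * Y2 (w ^ b) = Y3 (w ^ c) * Y4 (w ^ k)) (at 0)"
  shows "c + k \<le> a + b"
proof (rule ccontr)
  assume "\<not> ?thesis"
  then have lt: "a + b < c + k" by simp
  have lim: "((\<lambda>w. F (w ^ m) / w ^ m) \<longlongrightarrow> D) (at 0)"
    if "(F has_field_derivative D) (at 0)" "F 0 = 0" "0 < m" for F :: "complex \<Rightarrow> complex" and D m
  proof -
    have "((\<lambda>h. (F (0 + h) - F 0) / h) \<longlongrightarrow> D) (at 0)" using that(1) unfolding DERIV_def .
    then have "((\<lambda>h. F h / h) \<longlongrightarrow> D) (at 0)" using that(2) by simp
    moreover have "filterlim (\<lambda>w::complex. w ^ m) (at 0) (at 0)"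
    proof -
      have "((\<lambda>w::complex. w ^ m) \<longlongrightarrow> 0 ^ m) (at 0)" by (intro tendsto_intros)
      then show ?thesis using that(3)
        by (auto simp: filterlim_at eventually_at_filter zero_power)
    qed
    ultimately show ?thesis by (rule filterlim_compose)
  qed
  have "((\<lambda>w. (Y3 (w ^ c) / w ^ c) * (Y4 (w ^ k) / w ^ k) * w ^ (c + k - (a + b))) \<longlongrightarrow> D3 * D4 * 0 ^ (c + k - (a + b))) (at 0)"
    using Y pos by (intro tendsto_intros lim) auto
  then have "((\<lambda>w. (Y3 (w ^ c) / w ^ c) * (Y4 (w ^ k) / w ^ k) * w ^ (c + k - (a + b))) \<longlongrightarrow> 0) (at 0)"
    using lt by (simp add: zero_power)
  moreover have "eventually (\<lambda>w. (Y3 (w ^ c) / w ^ c) * (Y4 (w ^ k) / w ^ k) * w ^ (c + k - (a + b))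
      = (Y1 (w ^ a) / w ^ a) * (Y2 (w ^ b) / w ^ b)) (at 0)"
  proof -
    have "eventually (\<lambda>w::complex. w \<noteq> 0) (at 0)" by (simp add: eventually_at_filter)
    with ev show ?thesis
    proof eventually_elim
      case (elim w)
      have "w ^ (c + k - (a + b)) * (w ^ a * w ^ b) = w ^ c * w ^ k"
        using lt by (simp flip: power_add)
      then have pw: "w ^ (c + k - (a + b)) = w ^ c * w ^ k / (w ^ a * w ^ b)" using elim(2) by (simp add: eq_divide_eq)
      show ?case unfolding pw using elim by (simp add: field_simps)
    qed
  qed
  ultimately have "((\<lambda>w. (Y1 (w ^ a) / w ^ a) * (Y2 (w ^ b) / w ^ b)) \<longlongrightarrow> 0) (at 0)"
    by (rule Lim_transform_eventually)
  moreover have "((\<lambda>w. (Y1 (w ^ a) / w ^ a) * (Y2 (w ^ b) / w ^ b)) \<longlongrightarrow> D1 * D2) (at 0)"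
    using Y pos by (intro tendsto_intros lim) auto
  ultimately have "D1 * D2 = 0" by (rule LIM_unique[rotated])
  then show False using Y by simp
qed

text \<open>The equation is 1/d + 1/k = 1/e + 1/f. If e or f is 1, the sum exceeds 1, which forces d
  or k to be 1. Otherwise the sum is at most 1. Then neither d nor k divides both e and f, as it
  would be 1 and the sum would exceed 1. So one of them divides e and the other f; reciprocals can
  only grow in passing to divisors, and equality of the sums makes the pairs equal.\<close>

lemma egyptian_pair_unique:
  fixes e f d k :: nat
  assumes pos: "0 < e" "0 < f" "0 < d" "0 < k" and cop: "coprime e f"
    and eq: "d * k * (e + f) = e * f * (d + k)"
    and 1: "f > 1 \<Longrightarrow> d dvd e \<or> k dvd e" and 2: "e > 1 \<Longrightarrow> d dvd f \<or> k dvd f"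
  shows "(d = e \<and> k = f) \<or> (d = f \<and> k = e)"
proof -
  have ge: "a + b \<le> a * b" if ab: "2 \<le> a" "2 \<le> b" for a b :: nat
  proof -
    obtain i where "a = 2 + i" using le_Suc_ex[OF ab(1)] by blast
    moreover obtain j where "b = 2 + j" using le_Suc_ex[OF ab(2)] by blast
    ultimately show ?thesis by (simp add: algebra_simps)
  qed
  have one: "(d = 1 \<and> k = g) \<or> (d = g \<and> k = 1)" if g: "0 < g" "d * k * (1 + g) = g * (d + k)" for g
  proof -
    have "d = 1 \<or> k = 1"
    proof (rule ccontr)
      assume "\<not> ?thesis"
      then have "d + k \<le> d * k" using pos by (intro ge) auto
      then have "g * (d + k) \<le> g * (d * k)" by simp
      moreover have "0 < d * k" using pos by simp
      moreover have "d * k * (1 + g) = d * k + g * (d * k)" by (simp add: algebra_simps)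
      ultimately show False using g(2) by linarith
    qed
    then show ?thesis using g(2) by (auto simp: algebra_simps)
  qed
  consider "e = 1" | "f = 1" | "e > 1" "f > 1" using pos by linarith
  then show ?thesis
  proof cases
    case 1
    then show ?thesis using one[of f] eq pos by auto
  next
    case 2
    then show ?thesis using one[of e] eq pos by (auto simp: algebra_simps)
  next
    case 3
    have both: False if "g dvd e" "g dvd f" "0 < h" "g * h * (e + f) = e * f * (g + h)" for g h
    proof -
      have "g = 1" using cop that(1,2) by (meson coprime_common_divisor_nat)
      then have "h * (e + f) = e * f * (1 + h)" using that(4) by simp
      moreover have "h * (e + f) \<le> h * (e * f)" using ge[of e f] 3 by simp
      ultimately have "e * f * (1 + h) \<le> h * (e * f)" by simp
      then show False using pos by (simp add: algebra_simps)
    qed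
    have cross: "g = e \<and> h = f" if "g dvd e" "h dvd f" "0 < g" "0 < h" "g * h * (e + f) = e * f * (g + h)" for g h
    proof -
      have le: "g \<le> e" "h \<le> f" using that pos by (auto intro: dvd_imp_le)
      have a: "g * h * e \<le> e * f * g" "g * h * f \<le> e * f * h" using le by (auto simp: algebra_simps)
      have "g * h * e + g * h * f = e * f * g + e * f * h" using that(5) by (simp add: algebra_simps)
      then have "g * h * e = e * f * g" "g * h * f = e * f * h" using a by linarith+
      then show ?thesis using pos that by auto
    qed
    have eq': "k * d * (e + f) = e * f * (k + d)" using eq by (simp add: algebra_simps)
    show ?thesis using 1 2 3 both[of d k] both[of k d] cross[of d k] cross[of k d] eq eq' pos by auto
  qed
qed

section \<open>Two walks with the same return probabilities\<close>

locale isospectral = X: walk_poly p e + Y: walk_poly q d for p e q d +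
  assumes same_returns: "return_coeff p e n = return_coeff q d n"
begin

sublocale XR: walk_poly "reflect_poly p" "degree p - e" by (rule X.reflect_walk)
sublocale YR: walk_poly "reflect_poly q" "degree q - d" by (rule Y.reflect_walk)

lemma same_J: "J p e w = J q d w"
  by (simp add: J_def same_returns)

text \<open>With L = g'/g - h'/h, equality of J gives 2 z (E - F) + L(-z) = 0 for small positive z,
  hence on a disc. As E and F are even, L is odd. But L(z) + L(-z) is the logarithmic derivative of
  \<open>B\<close>, so \<open>B\<close> is constant with value \<open>B 0 = 1\<close>.\<close>

lemma tau_ratio_near_0: "\<exists>\<epsilon>>0. \<forall>x. 0 < x \<longrightarrow> x < \<epsilon> \<longrightarrow> tau p e x * tau q d (- x) = tau q d x * tau p e (- x)"
proof -
  obtain \<epsilon>1 g E where g: "\<epsilon>1 > 0" "g holomorphic_on ball 0 \<epsilon>1" "E holomorphic_on ball 0 \<epsilon>1"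
    "\<forall>z\<in>ball 0 \<epsilon>1. g z \<noteq> 0" "\<forall>x. \<bar>x\<bar> < \<epsilon>1 \<longrightarrow> g (of_real x) = of_real (tau p e x)"
    "\<forall>x. 0 < x \<longrightarrow> x < \<epsilon>1 \<longrightarrow> J p e (of_real (1 + x\<^sup>2)) =
        E (of_real x) + deriv g (of_real (- x)) / (2 * of_real x * g (of_real (- x)))" "\<forall>z\<in>ball 0 \<epsilon>1. E (- z) = E z"
    using X.J_near_1 by blast
  obtain \<epsilon>2 h F where h: "\<epsilon>2 > 0" "h holomorphic_on ball 0 \<epsilon>2" "F holomorphic_on ball 0 \<epsilon>2"
    "\<forall>z\<in>ball 0 \<epsilon>2. h z \<noteq> 0" "\<forall>x. \<bar>x\<bar> < \<epsilon>2 \<longrightarrow> h (of_real x) = of_real (tau q d x)"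
    "\<forall>x. 0 < x \<longrightarrow> x < \<epsilon>2 \<longrightarrow> J q d (of_real (1 + x\<^sup>2)) =
        F (of_real x) + deriv h (of_real (- x)) / (2 * of_real x * h (of_real (- x)))" "\<forall>z\<in>ball 0 \<epsilon>2. F (- z) = F z"
    using Y.J_near_1 by blast
  define \<epsilon> where "\<epsilon> = min \<epsilon>1 \<epsilon>2"
  define S where "S = ball (0::complex) \<epsilon>"
  have eps: "\<epsilon> > 0" using g h by (simp add: \<epsilon>_def)
  have S: "open S" "connected S" "convex S" "0 \<in> S" using eps by (auto simp: S_def)
  have sub: "z \<in> ball 0 \<epsilon>1" "z \<in> ball 0 \<epsilon>2" "- z \<in> S" if "z \<in> S" for z using that by (auto simp: S_def \<epsilon>_def)
  have hol: "g holomorphic_on S" "h holomorphic_on S" "E holomorphic_on S" "F holomorphic_on S"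
    using g(2,3) h(2,3) by (auto simp: S_def \<epsilon>_def intro: holomorphic_on_subset)
  have dg: "(g has_field_derivative deriv g z) (at z)" "(h has_field_derivative deriv h z) (at z)" if "z \<in> S" for z
    using hol S that by (auto intro: holomorphic_derivI)
  have holm: "(\<lambda>z. u (- z)) holomorphic_on S" if "u holomorphic_on S" for u :: "complex \<Rightarrow> complex"
  proof -
    have "u \<circ> (\<lambda>z. - z) holomorphic_on S"
      using sub(3) by (intro holomorphic_on_compose_gen[OF _ that] holomorphic_intros) auto
    then show ?thesis by (simp add: o_def)
  qed
  define L where "L z = deriv g z / g z - deriv h z / h z" for z
  have nz: "g z \<noteq> 0" "h z \<noteq> 0" if "z \<in> S" for z using g(4) h(4) sub that by auto
  have holL: "L holomorphic_on S"
    unfolding L_def using nz by (intro holomorphic_intros hol S) auto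
  define A where "A z = 2 * z * (E z - F z) + L (- z)" for z
  have holA: "A holomorphic_on S" unfolding A_def by (intro holomorphic_intros hol holm holL)
  have "A z = 0" if z: "z \<in> S" for z
  proof (rule analytic_continuation[OF holA S(1,2) _ S(4) _ _ z])
    show "complex_of_real ` {0<..<\<epsilon>} \<subseteq> S" by (auto simp: S_def)
    show "0 islimpt complex_of_real ` {0<..<\<epsilon>}" by (rule islimpt_of_real_pos) (use eps in simp)
    fix z assume "z \<in> complex_of_real ` {0<..<\<epsilon>}"
    then obtain x where x: "0 < x" "x < \<epsilon>" "z = of_real x" by auto
    have zS: "of_real x \<in> S" "- of_real x \<in> S" using x by (auto simp: S_def)
    have "E (of_real x) + deriv g (of_real (- x)) / (2 * of_real x * g (of_real (- x)))
       = F (of_real x) + deriv h (of_real (- x)) / (2 * of_real x * h (of_real (- x)))"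
      using g(6) h(6) x same_J[of "of_real (1 + x\<^sup>2)"] by (auto simp: \<epsilon>_def)
    moreover have "A z = 2 * of_real x * ((E (of_real x) + deriv g (of_real (- x)) / (2 * of_real x * g (of_real (- x))))
        - (F (of_real x) + deriv h (of_real (- x)) / (2 * of_real x * h (of_real (- x)))))"
      unfolding A_def L_def x(3) using x nz[OF zS(2)] by (simp add: field_simps)
    ultimately show "A z = 0" by simp
  qed
  then have odd: "L (- z) = - L z" if "z \<in> S" for z
  proof -
    have "A z = 0" "A (- z) = 0" using \<open>\<And>z. z \<in> S \<Longrightarrow> A z = 0\<close> that sub(3) by auto
    moreover have "E (- z) = E z" "F (- z) = F z" using g(7) h(7) sub[OF that] by auto
    then have "A z + A (- z) = L (- z) + L z" by (simp add: A_def algebra_simps)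
    ultimately show ?thesis by (simp add: eq_neg_iff_add_eq_0)
  qed
  define B where "B z = g z * h (- z) / (g (- z) * h z)" for z
  have derB: "(B has_field_derivative 0) (at z)" if z: "z \<in> S" for z
  proof -
    have z': "- z \<in> S" using sub(3) z .
    have mirror: "((\<lambda>z. u (- z)) has_field_derivative - D) (at z)"
      if "(u has_field_derivative D) (at (- z))" for u :: "complex \<Rightarrow> complex" and D
    proof -
      have "((\<lambda>z. u (- z)) has_field_derivative D * - 1) (at z)"
        by (rule DERIV_chain2[where g = uminus, OF that]) (auto intro!: derivative_eq_intros)
      then show ?thesis by simp
    qed
    note gm = mirror[OF dg(1)[OF z']] and hm = mirror[OF dg(2)[OF z']]
    have "g (- z) * h z \<noteq> 0" using nz z z' by simp
    then have "(B has_field_derivative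
       ((deriv g z * h (- z) + - deriv h (- z) * g z) * (g (- z) * h z)
         - g z * h (- z) * (- deriv g (- z) * h z + deriv h z * g (- z))) / (g (- z) * h z * (g (- z) * h z))) (at z)"
      unfolding B_def by (intro DERIV_divide DERIV_mult gm hm dg z)
    moreover have "(deriv g z * h (- z) + - deriv h (- z) * g z) * (g (- z) * h z)
         - g z * h (- z) * (- deriv g (- z) * h z + deriv h z * g (- z))
       = g z * h (- z) * (g (- z) * h z) * (L z + L (- z))"
      unfolding L_def using nz[OF z] nz[OF z'] by (simp add: field_simps)
    ultimately show ?thesis using odd[OF z] by simp
  qed
  then obtain c where c: "\<And>z. z \<in> S \<Longrightarrow> B z = c"
    using has_field_derivative_zero_constant[OF S(3), of B] by (metis has_field_derivative_at_within)
  have "B 0 = 1" using nz[OF S(4)] by (simp add: B_def)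
  then have B1: "B z = 1" if "z \<in> S" for z using c[OF that] c[OF S(4)] by simp
  have "tau p e x * tau q d (- x) = tau q d x * tau p e (- x)" if x: "0 < x" "x < \<epsilon>" for x
  proof -
    have xS: "of_real x \<in> S" "- of_real x \<in> S" using x by (auto simp: S_def)
    have "g (of_real x) * h (of_real (- x)) = h (of_real x) * g (of_real (- x))"
      using B1[OF xS(1)] nz[OF xS(1)] nz[OF xS(2)] by (simp add: B_def field_simps)
    moreover have "g (of_real x) = of_real (tau p e x)" "h (of_real (- x)) = of_real (tau q d (- x))"
      "h (of_real x) = of_real (tau q d x)" "g (of_real (- x)) = of_real (tau p e (- x))"
      using g(5)[rule_format, of x] g(5)[rule_format, of "- x"] h(5)[rule_format, of x] h(5)[rule_format, of "- x"] x
      by (auto simp: \<epsilon>_def)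
    ultimately have "complex_of_real (tau p e x * tau q d (- x)) = of_real (tau q d x * tau p e (- x))"
      by simp
    then show ?thesis by (simp only: of_real_eq_iff)
  qed
  then show ?thesis using eps by blast
qed

text \<open>Continuation of the local identity over the whole line gives it just to the right of
  \<open>x\<close>, and continuity supplies \<open>x\<close> itself.\<close>

lemma tau_ratio: "tau p e x * tau q d (- x) = tau q d x * tau p e (- x)"
proof -
  define Q where "Q x \<longleftrightarrow> (\<exists>a\<in>{complex_of_real (tau p e x)}. \<exists>b\<in>{complex_of_real (tau q d (- x))}.
     \<exists>c\<in>{complex_of_real (tau q d x)}. \<exists>k\<in>{complex_of_real (tau p e (- x))}. a * b = c * k)" for x
  have Q: "Q x \<longleftrightarrow> tau p e x * tau q d (- x) = tau q d x * tau p e (- x)" for x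
    unfolding Q_def by (simp flip: of_real_mult)
  have rel: "branch_relation Q" unfolding Q_def[abs_def]
    by (rule branch_relation_product_eq[OF X.branch_family_tau Y.branch_family_tau_minus
          Y.branch_family_tau X.branch_family_tau_minus])
  obtain \<epsilon> where "\<epsilon> > 0" "\<And>x. 0 < x \<Longrightarrow> x < \<epsilon> \<Longrightarrow> Q x" using tau_ratio_near_0 Q by blast
  then obtain \<epsilon>' where e': "\<epsilon>' > 0" "\<And>y. x < y \<Longrightarrow> y < x + \<epsilon>' \<Longrightarrow> Q y"
    using branch_relation_propagate[OF rel, of 0 \<epsilon> x] by blast
  have contm: "isCont (\<lambda>y. tau r s (- y)) x" if "\<And>x. isCont (tau r s) x" for r s
    by (rule continuous_at_compose[of x uminus "tau r s", unfolded o_def]) (use that in \<open>auto intro: continuous_intros\<close>)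
  define D where "D y = tau p e y * tau q d (- y) - tau q d y * tau p e (- y)" for y
  have "isCont D x" unfolding D_def
    by (intro continuous_intros X.tau_cont Y.tau_cont contm)
  then have "(D \<longlongrightarrow> D x) (at_right x)" by (simp add: isCont_def filterlim_at_split)
  moreover have "(D \<longlongrightarrow> 0) (at_right x)"
  proof (rule tendsto_eventually)
    show "eventually (\<lambda>y. D y = 0) (at_right x)"
      unfolding eventually_at_right_field using e' Q by (intro exI[of _ "x + \<epsilon>'"]) (auto simp: D_def)
  qed
  ultimately have "D x = 0" using tendsto_unique trivial_limit_at_right_real by blast
  then show ?thesis by (simp add: D_def)
qed

text \<open>The equality of the ratios of positive roots at \<lambda> = w^(-N); the reciprocals of
  the large positive roots are small roots of the reflected walks. The common multiple
  \<open>N\<close> makes all four factors analytic in one variable w, and the identity theorem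
  extends the equation from positive w.\<close>

lemma zero_branch_identity:
  assumes Y1: "X.zero_branch \<rho> Y1" and Y2: "XR.zero_branch \<rho> Y2" and Y3: "Y.zero_branch \<rho> Y3" and Y4: "YR.zero_branch \<rho> Y4"
    and a: "a * e = N" "b * (degree p - e) = N" "c * d = N" "k * (degree q - d) = N" and N: "0 < N"
    and w: "w \<in> ball 0 \<rho>"
  shows "Y1 (w ^ a) * Y2 (w ^ b) = Y3 (w ^ c) * Y4 (w ^ k)"
proof -
  have pos: "0 < a" "0 < b" "0 < c" "0 < k" using a N by (auto intro: gr0I)
  have rho: "0 < \<rho>" "\<rho> < 1" using Y1 unfolding X.zero_branch_def by auto
  have hol: "Y1 holomorphic_on ball 0 \<rho>" "Y2 holomorphic_on ball 0 \<rho>" "Y3 holomorphic_on ball 0 \<rho>" "Y4 holomorphic_on ball 0 \<rho>"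
    by (fact X.zero_branchD(3)[OF Y1] XR.zero_branchD(3)[OF Y2] Y.zero_branchD(3)[OF Y3] YR.zero_branchD(3)[OF Y4])+
  have comp: "(\<lambda>w. F (w ^ m)) holomorphic_on ball 0 \<rho>" if "F holomorphic_on ball 0 \<rho>" "0 < m" for F :: "complex \<Rightarrow> complex" and m
  proof -
    have "F \<circ> (\<lambda>w. w ^ m) holomorphic_on ball 0 \<rho>"
      using power_in_ball rho that(2) by (intro holomorphic_on_compose_gen[OF _ that(1)] holomorphic_intros) blast
    then show ?thesis by (simp add: o_def)
  qed
  define D where "D w = Y1 (w ^ a) * Y2 (w ^ b) - Y3 (w ^ c) * Y4 (w ^ k)" for w
  have "D w = 0"
  proof (rule analytic_continuation[of D "ball 0 \<rho>" "complex_of_real ` {0<..<\<rho>}" 0 w])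
    show "D holomorphic_on ball 0 \<rho>" unfolding D_def by (intro holomorphic_intros comp hol pos)
    show "complex_of_real ` {0<..<\<rho>} \<subseteq> ball 0 \<rho>" by auto
    show "0 islimpt complex_of_real ` {0<..<\<rho>}" by (rule islimpt_of_real_pos) (use rho in simp)
    fix z assume "z \<in> complex_of_real ` {0<..<\<rho>}"
    then obtain v where v: "0 < v" "v < \<rho>" "z = of_real v" by auto
    define x where "x = sqrt (1 / v ^ N - 1)"
    have "v ^ N \<le> 1" using v rho by (intro power_le_one) auto
    then have "1 / v ^ N \<ge> 1" using v by simp
    then have x: "0 \<le> x" "1 + x\<^sup>2 = 1 / v ^ N" by (auto simp: x_def)
    have "Y1 (z ^ a) = of_real (tau p e (- x))" unfolding v(3)
      by (rule X.zero_branch_real[OF Y1 v(1,2) a(1) pos(1) x])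
    moreover have "Y2 (z ^ b) = of_real (1 / tau p e x)" unfolding v(3)
      using XR.zero_branch_real[OF Y2 v(1,2) a(2) pos(2) x] X.tau_reflect[of "- x"] by simp
    moreover have "Y3 (z ^ c) = of_real (tau q d (- x))" unfolding v(3)
      by (rule Y.zero_branch_real[OF Y3 v(1,2) a(3) pos(3) x])
    moreover have "Y4 (z ^ k) = of_real (1 / tau q d x)" unfolding v(3)
      using YR.zero_branch_real[OF Y4 v(1,2) a(4) pos(4) x] Y.tau_reflect[of "- x"] by simp
    moreover have "tau p e (- x) * (1 / tau p e x) = tau q d (- x) * (1 / tau q d x)"
      using tau_ratio[of x] X.tau_pos[of x] Y.tau_pos[of x] by (simp add: field_simps)
    ultimately show "D z = 0" unfolding D_def by (simp only: of_real_mult[symmetric] diff_self)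
  qed (use w rho in auto)
  then show ?thesis by (simp add: D_def)
qed

lemma common_zero_branches:
  "\<exists>\<rho> Y1 Y2 Y3 Y4. X.zero_branch \<rho> Y1 \<and> XR.zero_branch \<rho> Y2 \<and> Y.zero_branch \<rho> Y3 \<and> YR.zero_branch \<rho> Y4"
proof -
  obtain \<rho>1 Y1 where 1: "X.zero_branch \<rho>1 Y1" using X.branch_at_zero by blast
  obtain \<rho>2 Y2 where 2: "XR.zero_branch \<rho>2 Y2" using XR.branch_at_zero by blast
  obtain \<rho>3 Y3 where 3: "Y.zero_branch \<rho>3 Y3" using Y.branch_at_zero by blast
  obtain \<rho>4 Y4 where 4: "YR.zero_branch \<rho>4 Y4" using YR.branch_at_zero by blast
  define \<rho> where "\<rho> = Min {\<rho>1, \<rho>2, \<rho>3, \<rho>4}"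
  have "0 < \<rho>1" "0 < \<rho>2" "0 < \<rho>3" "0 < \<rho>4"
    by (fact X.zero_branchD(1)[OF 1] XR.zero_branchD(1)[OF 2] Y.zero_branchD(1)[OF 3] YR.zero_branchD(1)[OF 4])+
  then have "0 < \<rho>" "\<rho> \<le> \<rho>1" "\<rho> \<le> \<rho>2" "\<rho> \<le> \<rho>3" "\<rho> \<le> \<rho>4" by (auto simp: \<rho>_def)
  then show ?thesis
    using X.zero_branch_mono[OF 1] XR.zero_branch_mono[OF 2] Y.zero_branch_mono[OF 3] YR.zero_branch_mono[OF 4] by blast
qed

text \<open>Comparison of vanishing orders at w = 0: N/e + N/f = N/d + N/k, where f and k are the
  exponents of the reflected walks.\<close>

lemma degree_relation:
  "d * (degree q - d) * (e + (degree p - e)) = e * (degree p - e) * (d + (degree q - d))"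
proof -
  define f where "f = degree p - e"
  define k where "k = degree q - d"
  obtain \<rho> Y1 Y2 Y3 Y4 where Y: "X.zero_branch \<rho> Y1" "XR.zero_branch \<rho> Y2" "Y.zero_branch \<rho> Y3" "YR.zero_branch \<rho> Y4"
    using common_zero_branches by blast
  define N where "N = e * f * d * k"
  have pos: "0 < e" "0 < f" "0 < d" "0 < k" using X.e_pos XR.e_pos Y.e_pos YR.e_pos by (auto simp: f_def k_def)
  have N: "0 < N" using pos by (simp add: N_def)
  define a where "a = f * d * k"
  define b where "b = e * d * k"
  define c where "c = e * f * k"
  define m where "m = e * f * d"
  have mult: "a * e = N" "b * (degree p - e) = N" "c * d = N" "m * (degree q - d) = N"
    by (auto simp: a_def b_def c_def m_def N_def f_def k_def)
  have posa: "0 < a" "0 < b" "0 < c" "0 < m" using pos by (auto simp: a_def b_def c_def m_def)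
  have "0 < \<rho>" using Y(1) unfolding X.zero_branch_def by auto
  then have ev: "eventually (\<lambda>w. Y1 (w ^ a) * Y2 (w ^ b) = Y3 (w ^ c) * Y4 (w ^ m)) (at 0)"
    using zero_branch_identity[OF Y mult N] unfolding eventually_at
    by (intro exI[of _ \<rho>]) (auto simp: dist_commute)
  then have ev': "eventually (\<lambda>w. Y3 (w ^ c) * Y4 (w ^ m) = Y1 (w ^ a) * Y2 (w ^ b)) (at 0)"
    by (rule eventually_mono) simp
  note D = X.zero_branch_deriv[OF Y(1)] XR.zero_branch_deriv[OF Y(2)] Y.zero_branch_deriv[OF Y(3)] YR.zero_branch_deriv[OF Y(4)]
  have "c + m \<le> a + b"
    by (rule vanishing_order_le[OF D(1,4,7,10,3,6,9,12,2,5) posa ev])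
  moreover have "a + b \<le> c + m"
    by (rule vanishing_order_le[OF D(7,10,1,4,9,12,3,6,8,11) posa(3,4,1,2) ev'])
  ultimately have "a + b = c + m" by simp
  then show ?thesis unfolding f_def[symmetric] k_def[symmetric]
    by (simp add: a_def b_def c_def m_def algebra_simps)
qed

text \<open>Turning \<open>e\<close> times around \<open>\<lambda> = \<infinity>\<close> fixes \<open>t\<^sub>-\<close> but not \<open>t\<^sub>+\<close>. If it moved both positive roots of the
  second walk, then \<open>t\<^sub>- s = t s'\<close> for large roots \<open>t\<close>, \<open>s\<close> and a small root \<open>s'\<close> other than the positive ones.
  Continued through \<open>\<lambda> = 1\<close> back to \<open>\<infinity>\<close> this becomes \<open>t\<^sub>+ s = t s'\<close> with roots of the same kinds,
  which is impossible since \<open>t = O(t\<^sub>+)\<close>.\<close>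

lemma degree_dvd:
  assumes cop: "coprime e (degree p - e)" and f1: "degree p - e > 1"
  shows "d dvd e \<or> degree q - d dvd e"
proof (rule ccontr)
  assume neg: "\<not> ?thesis"
  define f where "f = degree p - e"
  define k where "k = degree q - d"
  obtain \<rho> Y1 Y2 Y3 Y4 where Y: "X.zero_branch \<rho> Y1" "XR.zero_branch \<rho> Y2" "Y.zero_branch \<rho> Y3" "YR.zero_branch \<rho> Y4"
    using common_zero_branches by blast
  have rho: "0 < \<rho>" "\<rho> < 1" using Y(1) unfolding X.zero_branch_def by auto
  define N where "N = e * f * d * k"
  have pos: "0 < e" "0 < f" "0 < d" "0 < k" using X.e_pos XR.e_pos Y.e_pos YR.e_pos by (auto simp: f_def k_def)
  have N: "0 < N" using pos by (simp add: N_def)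
  define a where "a = f * d * k"
  define b where "b = e * d * k"
  define c where "c = e * f * k"
  define m where "m = e * f * d"
  have mult: "a * e = N" "b * (degree p - e) = N" "c * d = N" "m * (degree q - d) = N"
    by (auto simp: a_def b_def c_def m_def N_def f_def k_def)
  have posa: "0 < a" "0 < b" "0 < c" "0 < m" using pos by (auto simp: a_def b_def c_def m_def)
  \<comment> \<open>Multiplying w by \<zeta> turns \<lambda> = w^(-N) around infinity e times. If i
    j = N, then \<zeta>^i = 1 exactly when j divides e; this decides which of the four positive
    roots are moved.\<close>
  define \<zeta> where "\<zeta> = exp (2 * of_real pi * \<i> * of_nat e / of_nat N)"
  have zpow: "\<zeta> ^ i = exp (2 * of_real pi * \<i> * of_nat e / of_nat j)" if "i * j = N" "0 < j" for i j
  proof -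
    have "0 < i" using that N by (auto intro: gr0I)
    have "\<zeta> ^ i = exp (of_nat i * (2 * of_real pi * \<i> * of_nat e / of_nat N))"
      unfolding \<zeta>_def by (rule exp_of_nat_mult[symmetric])
    also have "of_nat i * (2 * of_real pi * \<i> * of_nat e / of_nat N) = 2 * of_real pi * \<i> * of_nat e / of_nat j"
      using that \<open>0 < i\<close> by (simp add: that(1)[symmetric])
    finally show ?thesis .
  qed
  have z1: "\<zeta> ^ i = 1 \<longleftrightarrow> j dvd e" if "i * j = N" "0 < j" for i j
    unfolding zpow[OF that] using that by (intro complex_root_unity_eq_1) auto
  have zN: "(\<zeta> ^ i) ^ j = 1" if "i * j = N" "0 < j" for i j
  proof -
    have "\<zeta> ^ N = 1" using z1[of N 1] by simp
    then show ?thesis by (simp add: power_mult[symmetric] that(1))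
  qed
  have za: "\<zeta> ^ a = 1" using z1[OF mult(1) pos(1)] by simp
  have "\<not> f dvd e"
  proof
    assume "f dvd e"
    then have "f dvd 1" using cop unfolding f_def by (meson coprime_common_divisor dvd_refl)
    then show False using f1 unfolding f_def by simp
  qed
  then have zb: "\<zeta> ^ b \<noteq> 1" using z1[OF mult(2)] pos unfolding f_def by simp
  have zc: "\<zeta> ^ c \<noteq> 1" using z1[OF mult(3)] pos neg by simp
  have zm: "\<zeta> ^ m \<noteq> 1" using z1[OF mult(4)] pos neg unfolding k_def by simp
  have nz: "norm \<zeta> = 1" unfolding \<zeta>_def by (simp add: norm_exp_eq_Re)
  \<comment> \<open>Crossing x = 0 makes \<open>tau p e (- x)\<close> the large positive root, while
    the other three sets depend on x^2 only.\<close>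
  define Q where "Q x \<longleftrightarrow> (\<exists>t\<in>{complex_of_real (tau p e (- x))}. \<exists>al\<in>Y.other_large x.
     \<exists>i\<in>X.other_large x. \<exists>bs\<in>Y.other_small x. t * al = i * bs)" for x
  have rel: "branch_relation Q" unfolding Q_def[abs_def]
    by (rule branch_relation_product_eq[OF X.branch_family_tau_minus Y.branch_family_other_large
          X.branch_family_other_large Y.branch_family_other_small])
  have Qx: "Q x" if x: "1 / \<rho> ^ N < 1 + x\<^sup>2" "0 \<le> x" for x
  proof -
    define v where "v = root N (1 / (1 + x\<^sup>2))"
    have x1: "1 + x\<^sup>2 > 0" by (rule add_pos_nonneg) auto
    then have v: "0 < v" "v ^ N = 1 / (1 + x\<^sup>2)" using N by (auto simp: v_def real_root_gt_zero)
    have "v ^ N < \<rho> ^ N" using x(1) x1 rho unfolding v(2) by (simp add: field_simps)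
    then have v\<rho>: "v < \<rho>" by (rule power_less_imp_less_base) (use rho in simp)
    have xv: "1 + x\<^sup>2 = 1 / v ^ N" using x1 v(2) by simp
    define w where "w = complex_of_real v * \<zeta>"
    have wb: "w \<in> ball 0 \<rho>" using v v\<rho> nz by (simp add: w_def norm_mult)
    have wp: "w ^ i = of_real v ^ i * \<zeta> ^ i" for i by (simp add: w_def power_mult_distrib)
    have id: "Y1 (w ^ a) * Y2 (w ^ b) = Y3 (w ^ c) * Y4 (w ^ m)"
      by (rule zero_branch_identity[OF Y mult N wb])
    have t: "Y1 (w ^ a) = of_real (tau p e (- x))"
      using X.zero_branch_real[OF Y(1) v(1) v\<rho> mult(1) posa(1) x(2) xv] by (simp add: wp za)
    have nzi: "norm (\<zeta> ^ i) = 1" for i by (simp add: norm_power nz)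
    have i: "1 / Y2 (w ^ b) \<in> X.other_large x" unfolding wp
      by (rule X.other_small_reflect, rule XR.zero_branch_other_small[OF Y(2) v(1) v\<rho> mult(2) posa(2) zN[OF mult(2)] zb nzi x(2) xv])
        (use pos in \<open>simp add: f_def\<close>)
    have al: "1 / Y4 (w ^ m) \<in> Y.other_large x" unfolding wp
      by (rule Y.other_small_reflect, rule YR.zero_branch_other_small[OF Y(4) v(1) v\<rho> mult(4) posa(4) zN[OF mult(4)] zm nzi x(2) xv])
        (use pos in \<open>simp add: k_def\<close>)
    have bs: "Y3 (w ^ c) \<in> Y.other_small x" unfolding wp
      by (rule Y.zero_branch_other_small[OF Y(3) v(1) v\<rho> mult(3) posa(3) zN[OF mult(3)] zc nzi x(2) xv]) (rule pos(3))
    have "Y2 (w ^ b) \<noteq> 0" "Y4 (w ^ m) \<noteq> 0"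
      using i al unfolding X.other_large_def Y.other_large_def X.roots_def Y.roots_def by auto
    then have "of_real (tau p e (- x)) * (1 / Y4 (w ^ m)) = 1 / Y2 (w ^ b) * Y3 (w ^ c)"
      using id unfolding t by (simp add: field_simps)
    then show ?thesis unfolding Q_def using i al bs by blast
  qed
  define M where "M = 1 / \<rho> ^ N"
  have "1 / \<rho> ^ N < 1 + x\<^sup>2 \<and> 0 \<le> x" if "M + 1 < x" for x
  proof -
    have M0: "0 < M" using rho by (simp add: M_def)
    then have x1: "1 < x" using that by simp
    then have "x * 1 \<le> x * x" by (intro mult_left_mono) auto
    then have "x \<le> x\<^sup>2" by (simp add: power2_eq_square)
    then show ?thesis using that x1 unfolding M_def[symmetric] by linarith
  qed
  then have start: "Q x" if "M + 1 < x" "x < M + 2" for x using Qx that by blast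
  define C where "C = 2 / coeff p (degree p)"
  have C: "C > 0" using X.lead_pos by (simp add: C_def)
  \<comment> \<open>Far enough out for (C |bs|)^d \<le> C^d / (1 + x^2) \<le> 1. Then |i bs| is at
    most the large positive root, whereas |al| > 1. Continuation only reaches points just to the
    right of the chosen one, hence the slack of 1.\<close>
  define x0 where "x0 = - (C ^ d + 1)"
  obtain \<epsilon> where eps: "\<epsilon> > 0" "\<And>x. x0 - 1 < x \<Longrightarrow> x < x0 - 1 + \<epsilon> \<Longrightarrow> Q x"
    using branch_relation_propagate[OF rel, of "M + 1" "M + 2" "x0 - 1"] start by auto
  define s where "s = - (x0 - 1 + min \<epsilon> 1 / 2)"
  have s: "s \<ge> C ^ d + 1" "Q (- s)" using eps by (auto simp: s_def x0_def min_def)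
  then have s0: "s \<ge> 1" "s \<ge> C ^ d" using C by (auto intro: order_trans[rotated])
  obtain al i bs where r: "al \<in> Y.other_large (- s)" "i \<in> X.other_large (- s)" "bs \<in> Y.other_small (- s)"
     "of_real (tau p e s) * al = i * bs" using s(2) unfolding Q_def by auto
  have al1: "norm al > 1" using r(1) unfolding Y.other_large_def by auto
  have "i \<in> X.roots (of_real (1 + s\<^sup>2))" using r(2) unfolding X.other_large_def by simp
  then have iC: "norm i \<le> C * tau p e s" using X.large_root_bound s0 unfolding C_def by auto
  have "norm bs ^ d \<le> 1 / (1 + s\<^sup>2)"
  proof -
    have "norm (complex_of_real (1 + s\<^sup>2)) * norm bs ^ d \<le> 1"
      by (rule Y.small_root_bound) (use r(3) in \<open>auto simp: Y.other_small_def\<close>)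
    moreover have "norm (complex_of_real (1 + s\<^sup>2)) = 1 + s\<^sup>2"
      unfolding norm_of_real using zero_le_power2[of s] by linarith
    ultimately have "(1 + s\<^sup>2) * norm bs ^ d \<le> 1" by (simp only:)
    moreover have "1 + s\<^sup>2 > 0" by (rule add_pos_nonneg) auto
    ultimately show ?thesis by (simp add: pos_le_divide_eq mult.commute)
  qed
  then have "(C * norm bs) ^ d \<le> C ^ d * (1 / (1 + s\<^sup>2))"
    unfolding power_mult_distrib using C by (intro mult_left_mono) auto
  also have "\<dots> \<le> 1"
  proof -
    have "s * 1 \<le> s * s" using s0 by (intro mult_left_mono) auto
    then have "C ^ d \<le> 1 + s\<^sup>2" using s0 unfolding power2_eq_square by linarith
    then show ?thesis by (simp add: add_pos_nonneg)
  qed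
  finally have "(C * norm bs) ^ d \<le> 1 ^ d" by simp
  then have b1: "C * norm bs \<le> 1" using pos C by (subst (asm) power_mono_iff) auto
  have tp: "tau p e s > 0" by (rule X.tau_pos)
  have "tau p e s * norm al = norm (of_real (tau p e s) * al)" using tp by (simp add: norm_mult)
  also have "\<dots> = norm i * norm bs" unfolding r(4) by (simp add: norm_mult)
  also have "\<dots> \<le> C * tau p e s * norm bs" using iC by (intro mult_right_mono) auto
  also have "\<dots> = tau p e s * (C * norm bs)" by simp
  also have "\<dots> \<le> tau p e s * 1" using tp b1 by (intro mult_left_mono) auto
  finally have "tau p e s * norm al \<le> tau p e s * 1" .
  then have "norm al \<le> 1" using tp by simp
  then show False using al1 by simp
qed

text \<open>The quotient \<open>K = s\<^sub>- / t\<^sub>- = s\<^sub>+ / t\<^sub>+\<close> is a power series in \<open>\<lambda>\<^bsup>-1/e\<^esup>\<close> and in \<open>\<lambda>\<^bsup>-1/f\<^esup>\<close>, hence in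
  \<open>\<lambda>\<^sup>-\<^sup>1\<close>, and comparing \<open>J\<close> for the two walks at infinity shows that its derivative vanishes.\<close>

lemma equal_if_same_exponents:
  assumes cop: "coprime e (degree p - e)" and de: "d = e" and df: "degree q - d = degree p - e"
  shows "q = p"
proof -
  define f where "f = degree p - e"
  obtain \<rho> Y1 Y2 Y3 Y4 where Y: "X.zero_branch \<rho> Y1" "XR.zero_branch \<rho> Y2" "Y.zero_branch \<rho> Y3" "YR.zero_branch \<rho> Y4"
    using common_zero_branches by blast
  have rho: "0 < \<rho>" "\<rho> < 1" using Y(1) unfolding X.zero_branch_def by auto
  have pos: "0 < e" "0 < f" using X.e_pos XR.e_pos by (auto simp: f_def)
  have id: "Y1 (w ^ f) * Y2 (w ^ e) = Y3 (w ^ f) * Y4 (w ^ e)" if "w \<in> ball 0 \<rho>" for w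
    by (rule zero_branch_identity[OF Y, where N = "f * e"]) (use pos that de df in \<open>auto simp: f_def\<close>)
  \<comment> \<open>The radius is \<rho>^f so that f-th roots of points of \<open>S\<close> lie in
    the disc of radius \<rho>.\<close>
  define S where "S = ball (0::complex) (\<rho> ^ f) - {0}"
  have Ssub: "S \<subseteq> ball 0 \<rho> - {0}"
  proof -
    have "\<rho> ^ f \<le> \<rho> ^ 1" using rho pos by (intro power_decreasing) auto
    then show ?thesis by (auto simp: S_def)
  qed
  have openS: "open S" by (simp add: S_def open_delete)
  have connS: "connected S" unfolding S_def by (rule connected_open_delete) auto
  have nz: "Y1 v \<noteq> 0" "Y3 v \<noteq> 0" "Y2 v \<noteq> 0" "Y4 v \<noteq> 0" if "v \<in> ball 0 \<rho> - {0}" for v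
    by (fact X.zero_branchD(5)[OF Y(1) that] Y.zero_branchD(5)[OF Y(3) that]
        XR.zero_branchD(5)[OF Y(2) that] YR.zero_branchD(5)[OF Y(4) that])+
  have nzS: "Y1 v \<noteq> 0" "Y3 v \<noteq> 0" if "v \<in> S" for v
    using nz(1,2)[OF subsetD[OF Ssub that]] by simp_all
  have hol: "Y1 holomorphic_on S" "Y3 holomorphic_on S"
    using Y Ssub unfolding X.zero_branch_def Y.zero_branch_def by (meson Diff_subset holomorphic_on_subset subset_trans)+
  define K where "K v = Y3 v / Y1 v" for v
  have holK: "K holomorphic_on S" unfolding K_def using nzS by (intro holomorphic_intros hol) auto
  have Y3: "Y3 v = K v * Y1 v" if "v \<in> S" for v using nzS[OF that] by (simp add: K_def)
  have normu: "norm u = 1" if "u ^ e = 1" for u :: complex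
    using that pos by (metis norm_one norm_power norm_ge_zero power_eq_1_iff less_not_refl)
  have uS: "u * v \<in> S" if "u ^ e = 1" "v \<in> S" for u v
    using that normu[OF that(1)] by (auto simp: S_def norm_mult)
  \<comment> \<open>By \<open>id\<close>, the value of \<open>K\<close> at w^f is a function of w^e.
    Since f is invertible modulo e, multiplying w by a suitable e-th root of unity changes w^f by
    the factor \<open>u\<close> and leaves w^e alone.\<close>
  have Kinv: "K (u * v) = K v" if u: "u ^ e = 1" and v: "v \<in> S" for u v
  proof -
    obtain w where w: "w ^ f = v"
      using v pos exists_complex_root[of f v] by auto
    have wb: "w \<in> ball 0 \<rho> - {0}"
    proof -
      have "norm w ^ f < \<rho> ^ f" using v unfolding w[symmetric] S_def by (auto simp: norm_power)
      then have "norm w < \<rho>" by (rule power_less_imp_less_base) (use rho in simp)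
      moreover have "w \<noteq> 0" using w v pos by (auto simp: S_def zero_power)
      ultimately show ?thesis by simp
    qed
    have "gcd f e = 1" using cop by (simp add: f_def gcd.commute)
    then obtain g m where g: "f * g = e * m + 1" using bezout_nat[of f e] pos by auto
    have "u ^ (f * g) = u" unfolding g power_add power_mult u by simp
    then have uf: "(u ^ g) ^ f = u" by (simp add: power_mult[symmetric] mult.commute)
    have ue: "(u ^ g) ^ e = 1" using u by (metis mult.commute power_mult power_one)
    define w' where "w' = u ^ g * w"
    have w': "w' ^ f = u * v" "w' ^ e = w ^ e" using uf ue w by (auto simp: w'_def power_mult_distrib)
    have wb': "w' \<in> ball 0 \<rho> - {0}" using wb normu[OF u] by (auto simp: w'_def norm_mult norm_power)
    have quot: "K (z ^ f) = Y2 (z ^ e) / Y4 (z ^ e)" if z: "z \<in> ball 0 \<rho> - {0}" for z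
    proof -
      have "z ^ f \<in> ball 0 \<rho> - {0}" "z ^ e \<in> ball 0 \<rho> - {0}"
        using z rho pos power_in_ball[of z \<rho> f] power_in_ball[of z \<rho> e] by auto
      then show ?thesis using id[of z] nz[of "z ^ f"] nz[of "z ^ e"] z by (simp add: K_def field_simps)
    qed
    show ?thesis using quot[OF wb] quot[OF wb'] w w' by simp
  qed
  have dK: "(K has_field_derivative deriv K v) (at v)" if "v \<in> S" for v
    using holK openS that by (rule holomorphic_derivI)
  have dKinv: "u * deriv K (u * v) = deriv K v" if u: "u ^ e = 1" and v: "v \<in> S" for u v
  proof -
    have "((\<lambda>v. K (u * v)) has_field_derivative deriv K (u * v) * u) (at v)"
      by (rule DERIV_chain2[where g = "\<lambda>v. u * v", OF dK[OF uS[OF u v]]]) (auto intro!: derivative_eq_intros)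
    moreover have "((\<lambda>v. K (u * v)) has_field_derivative deriv K v) (at v)"
      by (rule has_field_derivative_transform_within_open[OF dK[OF v] openS v]) (use Kinv[OF u] in auto)
    ultimately show ?thesis using DERIV_unique by (metis mult.commute)
  qed
  \<comment> \<open>The quantity v K'(v) / K(v) is the same at all points u v, so the sums in
    \<open>J_near_infinity\<close> for the two walks differ by e times this quantity.\<close>
  have "deriv K v = 0" if v: "v \<in> S" for v
  proof -
    have vb: "v \<in> ball 0 \<rho> - {0}" using v Ssub by blast
    have summand: "u * v * deriv Y3 (u * v) / Y3 (u * v) = u * v * deriv Y1 (u * v) / Y1 (u * v) + v * deriv K v / K v"
      if u: "u ^ e = 1" for u
    proof -
      let ?z = "u * v"
      have z: "?z \<in> S" by (rule uS[OF u v])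
      have n: "Y1 ?z \<noteq> 0" "K ?z \<noteq> 0" "?z \<noteq> 0" using nzS[OF z] z by (simp_all add: K_def S_def)
      have "(Y1 has_field_derivative deriv Y1 ?z) (at ?z)" using hol(1) openS z by (rule holomorphic_derivI)
      then have "((\<lambda>z. K z * Y1 z) has_field_derivative deriv K ?z * Y1 ?z + deriv Y1 ?z * K ?z) (at ?z)"
        by (intro DERIV_mult dK z)
      then have "(Y3 has_field_derivative deriv K ?z * Y1 ?z + deriv Y1 ?z * K ?z) (at ?z)"
        by (rule has_field_derivative_transform_within_open[OF _ openS z]) (use Y3 in auto)
      then have d3: "deriv Y3 ?z = deriv K ?z * Y1 ?z + deriv Y1 ?z * K ?z" by (rule DERIV_imp_deriv)
      have "?z * deriv Y3 ?z / Y3 ?z = ?z * deriv Y1 ?z / Y1 ?z + ?z * deriv K ?z / K ?z"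
        unfolding d3 Y3[OF z] using n by (simp add: field_simps)
      also have "?z * deriv K ?z = v * deriv K v" using dKinv[OF u v] by (simp add: mult_ac)
      finally show ?thesis unfolding Kinv[OF u v] .
    qed
    have "J p e (1 / v ^ e) = J q d (1 / v ^ d)" using same_J de by simp
    then have "v ^ e / of_nat e * (\<Sum>u | u ^ e = 1. u * v * deriv Y1 (u * v) / Y1 (u * v))
       = v ^ e / of_nat e * (\<Sum>u | u ^ e = 1. u * v * deriv Y3 (u * v) / Y3 (u * v))"
      using X.J_near_infinity[OF Y(1) vb] Y.J_near_infinity[OF Y(3) vb] de by simp
    then have "(\<Sum>u | u ^ e = 1. u * v * deriv Y1 (u * v) / Y1 (u * v))
       = (\<Sum>u | u ^ e = 1. u * v * deriv Y3 (u * v) / Y3 (u * v))"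
      using vb pos by simp
    also have "\<dots> = (\<Sum>u | u ^ e = 1. u * v * deriv Y1 (u * v) / Y1 (u * v) + v * deriv K v / K v)"
      by (rule sum.cong) (use summand in auto)
    finally have "of_nat (card {u::complex. u ^ e = 1}) * (v * deriv K v / K v) = 0"
      by (simp add: sum.distrib)
    then have "v * deriv K v / K v = 0" using card_roots_unity_eq[OF pos(1)] pos(1) by simp
    moreover have "v \<noteq> 0" "K v \<noteq> 0" using nz[OF vb] vb by (auto simp: K_def)
    ultimately show ?thesis by simp
  qed
  then obtain \<kappa> where kap: "\<And>v. v \<in> S \<Longrightarrow> K v = \<kappa>"
    using DERIV_zero_connected_constant[OF connS openS finite.emptyI, of K] dK holomorphic_on_imp_continuous_on[OF holK]
    by (metis Diff_empty)
  define x1 where "x1 = sqrt (1 / (\<rho> ^ f) ^ e)"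
  have scale: "of_real (tau q d (- x)) = \<kappa> * of_real (tau p e (- x))" if x: "x1 < x" for x
  proof -
    have rf: "0 < (\<rho> ^ f) ^ e" using rho by simp
    have x0: "0 \<le> x1" unfolding x1_def using rf by simp
    then have "x1\<^sup>2 < x\<^sup>2" using x by (intro power_strict_mono) auto
    moreover have "x1\<^sup>2 = 1 / (\<rho> ^ f) ^ e" unfolding x1_def using rf by simp
    ultimately have big: "1 / (\<rho> ^ f) ^ e < 1 + x\<^sup>2" by linarith
    define v where "v = root e (1 / (1 + x\<^sup>2))"
    have x1: "1 + x\<^sup>2 > 0" by (rule add_pos_nonneg) auto
    then have v: "0 < v" "v ^ e = 1 / (1 + x\<^sup>2)" using pos by (auto simp: v_def real_root_gt_zero)
    have "v ^ e < (\<rho> ^ f) ^ e" using big x1 rf unfolding v(2) by (simp add: field_simps)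
    then have v\<rho>: "v < \<rho> ^ f" by (rule power_less_imp_less_base) (use rho in simp)
    then have vS: "complex_of_real v \<in> S" using v by (simp add: S_def)
    then have "complex_of_real v \<in> ball 0 \<rho> - {0}" using Ssub by blast
    then have vr: "v < \<rho>" using v by simp
    have xv: "1 + x\<^sup>2 = 1 / v ^ e" using x1 v(2) by simp
    have x0': "0 \<le> x" using x x0 by linarith
    have "Y1 (of_real v) = of_real (tau p e (- x))"
      using X.zero_branch_real[OF Y(1) v(1) vr, of 1 e x] x0' xv by simp
    moreover have "Y3 (of_real v) = of_real (tau q d (- x))"
      using Y.zero_branch_real[OF Y(3) v(1) vr, of 1 e x] x0' xv de by simp
    ultimately show ?thesis using Y3[OF vS] kap[OF vS] by simp
  qed
  define s where "s = tau q d (- (x1 + 1)) / tau p e (- (x1 + 1))"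
  have s0: "s > 0" using X.tau_pos Y.tau_pos by (simp add: s_def)
  have ks: "\<kappa> = of_real s"
    using scale[of "x1 + 1"] X.tau_pos[of "- (x1 + 1)"] by (simp add: s_def field_simps)
  have scale': "tau q d (- x) = s * tau p e (- x)" if "x1 < x" for x
    using scale[OF that] unfolding ks by (metis of_real_eq_iff of_real_mult)
  \<comment> \<open>Where the small positive roots are proportional, q(s t) = s^e p(t) at t =
    \<open>tau p e (- x)\<close>. These are infinitely many t, so this is a polynomial
    identity.\<close>
  define R where "R = pcompose q [:0, s:] - smult (s ^ e) p"
  have "R = 0"
  proof (rule ccontr)
    assume "R \<noteq> 0"
    then have fin: "finite {t. poly R t = 0}" by (rule poly_roots_finite)
    have "(\<lambda>x. tau p e (- x)) ` {x1<..} \<subseteq> {t. poly R t = 0}"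
    proof (rule image_subsetI)
      fix x assume x: "x \<in> {x1<..}"
      let ?t = "tau p e (- x)"
      have t: "?t > 0" by (rule X.tau_pos)
      have "rchi q d (s * ?t) = rchi p e ?t"
        using Y.rchi_tau[of "- x"] X.rchi_tau[of "- x"] scale'[of x] x by simp
      then have "poly q (s * ?t) / (s * ?t) ^ e = poly p ?t / ?t ^ e" unfolding rchi_def de .
      then have "poly q (s * ?t) = s ^ e * poly p ?t" using t s0 by (simp add: power_mult_distrib field_simps)
      then show "?t \<in> {t. poly R t = 0}" by (simp add: R_def poly_pcompose mult.commute)
    qed
    then have "finite ((\<lambda>x. tau p e (- x)) ` {x1<..})" using fin finite_subset by blast
    moreover have "inj_on (\<lambda>x. tau p e (- x)) {x1<..}"
      using X.tau_strict_mono by (intro inj_onI) (metis linorder_less_linear neg_equal_iff_equal order_less_irrefl)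
    ultimately have "finite {x1<..}" by (rule finite_imageD)
    then show False using infinite_Ioi by blast
  qed
  then have eq: "pcompose q [:0, s:] = smult (s ^ e) p" by (simp add: R_def)
  \<comment> \<open>At t = 1 the identity says that the second shape has value 1 at
    \<open>s\<close>, and on the positive axis it takes this value only at 1.\<close>
  have "poly q s = s ^ e"
    using arg_cong[OF eq, of "\<lambda>r. poly r 1"] X.total by (simp add: poly_pcompose)
  then have "rchi q d s = 1" using s0 de by (simp add: rchi_def)
  then have "s = 1" using Y.rchi_gt_1[of s] s0 by force
  then show ?thesis using eq by (simp add: pcompose_idR)
qed

end

section \<open>Uniqueness up to reflection, recurrence\<close>

lemma isospectral_reflect_left: "isospectral p e q d \<Longrightarrow> isospectral (reflect_poly p) (degree p - e) q d"
  unfolding isospectral_def isospectral_axioms_def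
  using walk_poly.reflect_walk walk_poly.return_coeff_reflect by metis

lemma isospectral_reflect_right: "isospectral p e q d \<Longrightarrow> isospectral p e (reflect_poly q) (degree q - d)"
  unfolding isospectral_def isospectral_axioms_def
  using walk_poly.reflect_walk walk_poly.return_coeff_reflect by metis

theorem isospectral_unique:
  assumes iso: "isospectral p e q d" and cop: "coprime e (degree p - e)"
  shows "(q = p \<and> d = e) \<or> (reflect_poly q = p \<and> degree q - d = e)"
proof -
  interpret isospectral p e q d by fact
  let ?f = "degree p - e" and ?k = "degree q - d"
  have pos: "0 < e" "0 < ?f" "0 < d" "0 < ?k" using X.e_pos XR.e_pos Y.e_pos YR.e_pos by auto
  have dr: "degree (reflect_poly p) - ?f = e" using X.degree_reflect X.e_less by simp
  \<comment> \<open>The divisibility statement for the reflected first walk, in which e and f have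
    changed places.\<close>
  have 2: "d dvd ?f \<or> ?k dvd ?f" if "e > 1"
    using isospectral.degree_dvd[OF isospectral_reflect_left[OF iso]] that cop
    unfolding dr by (simp add: coprime_commute)
  have "(d = e \<and> ?k = ?f) \<or> (d = ?f \<and> ?k = e)"
    by (rule egyptian_pair_unique[OF pos cop degree_relation]) (use degree_dvd[OF cop] 2 in auto)
  then show ?thesis
  proof
    assume h: "d = e \<and> ?k = ?f"
    then show ?thesis using equal_if_same_exponents[OF cop] by blast
  next
    assume h: "d = ?f \<and> ?k = e"
    have dr': "degree (reflect_poly q) - ?k = d" using Y.degree_reflect Y.e_less by simp
    have "reflect_poly q = p"
      by (rule isospectral.equal_if_same_exponents[OF isospectral_reflect_right[OF iso] cop])
        (use h dr' in auto)
    then show ?thesis using h by blast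
  qed
qed

text \<open>\<open>J\<close> is unbounded as \<open>\<lambda>\<close> tends to \<open>1\<close> from above: an unbiased walk is recurrent.\<close>

lemma (in walk_poly) no_geometric_decay:
  assumes mu: "0 \<le> \<mu>" "\<mu> < 1" and decay: "\<And>n. return_coeff p e n \<le> \<mu> ^ n"
  shows False
proof -
  obtain \<epsilon> g E where g: "\<epsilon> > 0" "g holomorphic_on ball 0 \<epsilon>" "E holomorphic_on ball 0 \<epsilon>"
    "\<forall>z\<in>ball 0 \<epsilon>. g z \<noteq> 0" "deriv g 0 \<noteq> 0"
    "\<forall>x. 0 < x \<longrightarrow> x < \<epsilon> \<longrightarrow> J p e (of_real (1 + x\<^sup>2)) =
        E (of_real x) + deriv g (of_real (- x)) / (2 * of_real x * g (of_real (- x)))"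
    using J_near_1 by blast
  have nonneg: "return_coeff p e n \<ge> 0" for n
  proof -
    have "coeff (p ^ n) k \<ge> 0" for k
      by (induction n arbitrary: k) (auto simp: coeff_mult coeff_nonneg intro!: sum_nonneg mult_nonneg_nonneg)
    then show ?thesis by (simp add: return_coeff_def)
  qed
  have Jb: "norm (J p e (of_real (1 + x\<^sup>2))) \<le> 1 / (1 - \<mu>)" for x
  proof -
    define w where "w = complex_of_real (1 + x\<^sup>2)"
    have nw: "norm w \<ge> 1" unfolding w_def norm_of_real using zero_le_power2[of x] by linarith
    have b: "norm (of_real (return_coeff p e n) / w ^ Suc n) \<le> \<mu> ^ n" for n
    proof -
      have "norm (of_real (return_coeff p e n) / w ^ Suc n) = return_coeff p e n / norm w ^ Suc n"
        using nonneg by (simp add: norm_divide norm_mult norm_power)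
      also have "\<dots> \<le> return_coeff p e n / 1"
        using nonneg nw one_le_power[OF nw, of "Suc n"] by (intro divide_left_mono) auto
      finally show ?thesis using decay[of n] by simp
    qed
    have "summable (\<lambda>n. \<mu> ^ n)" using mu by (simp add: summable_geometric)
    then have "norm (J p e w) \<le> suminf (\<lambda>n. \<mu> ^ n)"
      unfolding J_def using b by (intro norm_suminf_le) auto
    also have "suminf (\<lambda>n. \<mu> ^ n) = 1 / (1 - \<mu>)" using mu by (intro suminf_geometric) auto
    finally show ?thesis unfolding w_def .
  qed
  have cont: "isCont g 0" "isCont (deriv g) 0" "isCont E 0"
    using g(1,2,3) by (auto intro!: holomorphic_deriv holomorphic_on_imp_continuous_on[THEN continuous_on_interior] simp: interior_open)
  have lim: "((\<lambda>x. h (of_real (c * x))) \<longlongrightarrow> h 0) (at_right 0)" if "isCont h 0" for h :: "complex \<Rightarrow> complex" and c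
  proof (rule isCont_tendsto_compose[OF that])
    have "((\<lambda>x. complex_of_real (c * x)) \<longlongrightarrow> of_real (c * 0)) (at_right 0)" by (intro tendsto_intros)
    then show "((\<lambda>x. complex_of_real (c * x)) \<longlongrightarrow> 0) (at_right 0)" by simp
  qed
  have g0: "g 0 \<noteq> 0" using g(1,4) by simp
  have lim0: "((\<lambda>x. 2 * complex_of_real x) \<longlongrightarrow> 0) (at_right 0)"
  proof -
    have "((\<lambda>x. 2 * complex_of_real x) \<longlongrightarrow> 2 * of_real 0) (at_right 0)" by (intro tendsto_intros)
    then show ?thesis by simp
  qed
  \<comment> \<open>By \<open>J_near_1\<close>, 2 x J tends to g'(0) / g(0), which is nonzero, as x
    decreases to 0; boundedness of J would make this limit 0.\<close>
  have "((\<lambda>x. 2 * complex_of_real x * E (of_real (1 * x)) + deriv g (of_real (- 1 * x)) / g (of_real (- 1 * x)))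
     \<longlongrightarrow> 0 * E 0 + deriv g 0 / g 0) (at_right 0)"
    by (intro tendsto_intros lim0 lim cont g0)
  moreover have "eventually (\<lambda>x. 2 * complex_of_real x * E (of_real (1 * x)) + deriv g (of_real (- 1 * x)) / g (of_real (- 1 * x))
     = 2 * of_real x * J p e (of_real (1 + x\<^sup>2))) (at_right 0)"
    unfolding eventually_at_right_field
  proof (intro exI[of _ \<epsilon>] conjI allI impI)
    fix x :: real assume x: "x > 0" "x < \<epsilon>"
    have "J p e (of_real (1 + x\<^sup>2)) = E (of_real x) + deriv g (of_real (- x)) / (2 * of_real x * g (of_real (- x)))"
      using g(6) x by blast
    moreover have "g (of_real (- x)) \<noteq> 0" using g(4) x by simp
    ultimately show "2 * complex_of_real x * E (of_real (1 * x)) + deriv g (of_real (- 1 * x)) / g (of_real (- 1 * x))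
     = 2 * of_real x * J p e (of_real (1 + x\<^sup>2))" using x by (simp add: field_simps)
  qed (use g in simp)
  ultimately have "((\<lambda>x. 2 * of_real x * J p e (of_real (1 + x\<^sup>2))) \<longlongrightarrow> 0 * E 0 + deriv g 0 / g 0) (at_right 0)"
    by (rule Lim_transform_eventually)
  moreover have "((\<lambda>x. 2 * of_real x * J p e (of_real (1 + x\<^sup>2))) \<longlongrightarrow> 0) (at_right 0)"
  proof (rule Lim_null_comparison)
    show "eventually (\<lambda>x. norm (2 * of_real x * J p e (of_real (1 + x\<^sup>2))) \<le> norm (2 * complex_of_real x) * (1 / (1 - \<mu>))) (at_right 0)"
      using Jb by (intro always_eventually allI) (simp only: norm_mult[of "2 * complex_of_real _"], intro mult_left_mono, auto)
    have "((\<lambda>x. norm (2 * complex_of_real x) * (1 / (1 - \<mu>))) \<longlongrightarrow> norm (0::complex) * (1 / (1 - \<mu>))) (at_right 0)"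
      by (intro tendsto_intros lim0)
    then show "((\<lambda>x. norm (2 * complex_of_real x) * (1 / (1 - \<mu>))) \<longlongrightarrow> 0) (at_right 0)" by simp
  qed
  ultimately have "0 * E 0 + deriv g 0 / g 0 = 0"
    using tendsto_unique trivial_limit_at_right_real by blast
  then show False using g(5) g0 by simp
qed

lemma power_int_Gcd_eq_1:
  fixes y :: "'a::field"
  assumes "finite A" "y \<noteq> 0" "\<And>a. a \<in> A \<Longrightarrow> y powi a = 1"
  shows "y powi (Gcd A) = 1"
  using assms
proof (induction A rule: finite_induct)
  case (insert a A)
  obtain u v where uv: "u * a + v * Gcd A = gcd a (Gcd A)" using bezout_int by blast
  have "y powi (u * a + v * Gcd A) = (y powi a) powi u * (y powi (Gcd A)) powi v"
    using insert.prems(1) by (simp add: power_int_add power_int_mult[symmetric] mult.commute)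
  then show ?case using insert uv by simp
qed simp

subsection \<open>Return probabilities as coefficients\<close>

context random_walk
begin

lemma measurable_step: "1 \<le> i \<Longrightarrow> X i \<in> measurable M (count_space UNIV)"
  using indep unfolding indep_vars_def by auto

lemma step_sets: "1 \<le> i \<Longrightarrow> {x \<in> space M. X i x = k} \<in> events"
  using measurable_sets[OF measurable_step, of i "{k}"] by (simp add: vimage_def Int_def conj_commute)

lemma sum_sets: "{x \<in> space M. (\<Sum>i=1..n. X i x) = k} \<in> events"
proof -
  have "(\<lambda>x. \<Sum>i=1..n. X i x) \<in> measurable M (count_space UNIV)"
  proof (induction n)
    case (Suc n)
    have "(\<lambda>x. (\<lambda>x. \<Sum>i=1..n. X i x) x + X (Suc n) x) \<in> measurable M (count_space UNIV)"
      by (rule measurable_compose_countable[OF _ Suc])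
        (rule measurable_compose[OF measurable_step], auto)
    then show ?case by simp
  qed simp
  from measurable_sets[OF this, of "{k}"] show ?thesis by (simp add: vimage_def Int_def conj_commute)
qed

lemma prob_step: "1 \<le> i \<Longrightarrow> prob {x \<in> space M. X i x = k} = step_prob M X k"
proof -
  assume i: "1 \<le> i"
  have "measure (distr M (count_space UNIV) (X j)) {k} = prob {x \<in> space M. X j x = k}" if "1 \<le> j" for j
    using measurable_step[OF that] by (subst measure_distr) (auto intro!: arg_cong[where f = prob])
  from this[OF i] this[of 1] show ?thesis using ident[OF i] by (simp add: step_prob_def)
qed

lemma step_prob_nonneg: "step_prob M X k \<ge> 0"
  by (simp add: step_prob_def)

lemma step_prob_zero: "k \<notin> walk_support M X \<Longrightarrow> step_prob M X k = 0"
  using step_prob_nonneg[of k] by (simp add: walk_support_def)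

lemma AE_in_support: "1 \<le> i \<Longrightarrow> AE x in M. X i x \<in> walk_support M X"
proof -
  assume i: "1 \<le> i"
  have "AE x in M. k \<notin> walk_support M X \<longrightarrow> X i x \<noteq> k" for k
  proof (cases "k \<in> walk_support M X")
    case False
    then have "prob {x \<in> space M. X i x = k} = 0" using prob_step[OF i] step_prob_zero by simp
    then have "AE x in M. x \<notin> {x \<in> space M. X i x = k}"
      using step_sets[OF i] prob_eq_0 by blast
    then show ?thesis by (rule AE_mp) (rule AE_I2, auto)
  qed simp
  then have "AE x in M. \<forall>k. k \<notin> walk_support M X \<longrightarrow> X i x \<noteq> k" by (simp add: AE_all_countable)
  then show ?thesis by (rule AE_mp) (rule AE_I2, auto)
qed

lemma prob_split_step:
  assumes i: "1 \<le> i" and A: "A \<in> events"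
  shows "prob A = (\<Sum>k\<in>walk_support M X. prob (A \<inter> {x \<in> space M. X i x = k}))"
proof -
  have "prob A = prob (\<Union>k\<in>walk_support M X. A \<inter> {x \<in> space M. X i x = k})"
  proof (rule finite_measure_eq_AE)
    show "AE x in M. x \<in> A \<longleftrightarrow> x \<in> (\<Union>k\<in>walk_support M X. A \<inter> {x \<in> space M. X i x = k})"
      using AE_in_support[OF i] by (rule AE_mp) (rule AE_I2, auto)
    show "(\<Union>k\<in>walk_support M X. A \<inter> {x \<in> space M. X i x = k}) \<in> events"
      using finite_support A step_sets[OF i] by auto
  qed (rule A)
  also have "\<dots> = (\<Sum>k\<in>walk_support M X. prob (A \<inter> {x \<in> space M. X i x = k}))"
    using finite_support A step_sets[OF i]
    by (intro finite_measure_finite_Union) (auto simp: disjoint_family_on_def)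
  finally show ?thesis .
qed

lemma sum_step_prob: "(\<Sum>k\<in>walk_support M X. step_prob M X k) = 1"
proof -
  have "prob (space M) = (\<Sum>k\<in>walk_support M X. prob (space M \<inter> {x \<in> space M. X 1 x = k}))"
    by (rule prob_split_step) auto
  also have "\<dots> = (\<Sum>k\<in>walk_support M X. step_prob M X k)"
    by (rule sum.cong) (auto simp: step_prob_def intro!: arg_cong[where f = prob])
  finally show ?thesis using prob_space by simp
qed

lemma support_nonempty: "walk_support M X \<noteq> {}"
  using sum_step_prob by auto

lemma expectation_step: "expectation (\<lambda>x. real_of_int (X 1 x)) = (\<Sum>k\<in>walk_support M X. real_of_int k * step_prob M X k)"
proof -
  let ?I = "\<lambda>k x. real_of_int k * indicator {x \<in> space M. X 1 x = k} x"
  have "expectation (\<lambda>x. real_of_int (X 1 x)) = expectation (\<lambda>x. \<Sum>k\<in>walk_support M X. ?I k x)"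
  proof (rule integral_cong_AE)
    show "(\<lambda>x. real_of_int (X 1 x)) \<in> borel_measurable M"
      by (rule measurable_compose[OF measurable_step]) auto
    show "(\<lambda>x. \<Sum>k\<in>walk_support M X. ?I k x) \<in> borel_measurable M"
      using step_sets[of 1] by (intro borel_measurable_sum borel_measurable_times) auto
    show "AE x in M. real_of_int (X 1 x) = (\<Sum>k\<in>walk_support M X. ?I k x)"
    proof (rule AE_mp[OF AE_in_support[of 1]])
      show "AE x in M. X 1 x \<in> walk_support M X \<longrightarrow> real_of_int (X 1 x) = (\<Sum>k\<in>walk_support M X. ?I k x)"
      proof (rule AE_I2, rule impI)
        fix x assume x: "x \<in> space M" "X 1 x \<in> walk_support M X"
        have "(\<Sum>k\<in>walk_support M X. ?I k x) = (\<Sum>k\<in>walk_support M X. if X 1 x = k then real_of_int k else 0)"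
          using x(1) by (intro sum.cong) (auto simp: indicator_def)
        then show "real_of_int (X 1 x) = (\<Sum>k\<in>walk_support M X. ?I k x)"
          using x(2) finite_support by simp
      qed
    qed simp
  qed
  also have "\<dots> = (\<Sum>k\<in>walk_support M X. expectation (?I k))"
    using step_sets[of 1] by (intro Bochner_Integration.integral_sum integrable_mult_right) (auto intro!: integrable_real_indicator simp: emeasure_eq_measure)
  also have "\<dots> = (\<Sum>k\<in>walk_support M X. real_of_int k * step_prob M X k)"
    using step_sets[of 1] by (intro sum.cong) (auto simp: step_prob_def Int_def intro!: arg_cong[where f = prob])
  finally show ?thesis .
qed

text \<open>Convolution: the last step is independent of the earlier partial sum.\<close>

lemma prob_sum_Suc:
  "prob {x \<in> space M. (\<Sum>i=1..Suc n. X i x) = z}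
    = (\<Sum>k\<in>walk_support M X. step_prob M X k * prob {x \<in> space M. (\<Sum>i=1..n. X i x) = z - k})"
proof -
  have "prob {x \<in> space M. (\<Sum>i=1..Suc n. X i x) = z}
    = (\<Sum>k\<in>walk_support M X. prob ({x \<in> space M. (\<Sum>i=1..Suc n. X i x) = z} \<inter> {x \<in> space M. X (Suc n) x = k}))"
    by (rule prob_split_step[OF _ sum_sets]) simp
  also have "\<dots> = (\<Sum>k\<in>walk_support M X. step_prob M X k * prob {x \<in> space M. (\<Sum>i=1..n. X i x) = z - k})"
  proof (rule sum.cong)
    fix k
    let ?X = "\<lambda>i x. real_of_int (X i x)"
    have "indep_vars (\<lambda>_. count_space UNIV) X (insert (Suc n) {1..n})"
      by (rule indep_vars_subset[OF indep]) auto
    then have "indep_vars (\<lambda>_. borel) ?X (insert (Suc n) {1..n})"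
      by (rule indep_vars_compose2[where Y = "\<lambda>_. real_of_int"]) auto
    then have ind: "indep_var borel (?X (Suc n)) borel (\<lambda>x. \<Sum>i=1..n. ?X i x)"
      by (intro indep_vars_sum) auto
    have "prob ((\<lambda>x. (?X (Suc n) x, \<Sum>i=1..n. ?X i x)) -` ({of_int k} \<times> {of_int (z - k)}) \<inter> space M)
      = prob (?X (Suc n) -` {of_int k} \<inter> space M) * prob ((\<lambda>x. \<Sum>i=1..n. ?X i x) -` {of_int (z - k)} \<inter> space M)"
      by (rule indep_varD[OF ind]) auto
    moreover have "(\<lambda>x. (?X (Suc n) x, \<Sum>i=1..n. ?X i x)) -` ({of_int k} \<times> {of_int (z - k)}) \<inter> space M
      = {x \<in> space M. (\<Sum>i=1..Suc n. X i x) = z} \<inter> {x \<in> space M. X (Suc n) x = k}"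
      by (auto simp del: of_int_sum simp flip: of_int_sum of_int_diff)
    moreover have "?X (Suc n) -` {of_int k} \<inter> space M = {x \<in> space M. X (Suc n) x = k}" by auto
    moreover have "(\<lambda>x. \<Sum>i=1..n. ?X i x) -` {of_int (z - k)} \<inter> space M = {x \<in> space M. (\<Sum>i=1..n. X i x) = z - k}"
      by (auto simp del: of_int_sum simp flip: of_int_sum of_int_diff)
    ultimately show "prob ({x \<in> space M. (\<Sum>i=1..Suc n. X i x) = z} \<inter> {x \<in> space M. X (Suc n) x = k})
       = step_prob M X k * prob {x \<in> space M. (\<Sum>i=1..n. X i x) = z - k}"
      using prob_step[of "Suc n" k] by simp
  qed simp
  finally show ?thesis .
qed

text \<open>The shape with t^g replaced by t, multiplied by t^B. In the context below g divides the
  support and -B bounds the quotients from below, so \<open>div\<close> is exact and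
  \<open>nat\<close> never truncates.\<close>

definition step_poly :: "int \<Rightarrow> nat \<Rightarrow> real poly" where
  "step_poly g B = (\<Sum>k\<in>walk_support M X. monom (step_prob M X k) (nat (k div g + int B)))"

context
  fixes g :: int and B :: nat
  assumes g: "0 < g" and dvd: "\<And>k. k \<in> walk_support M X \<Longrightarrow> g dvd k"
    and lower: "\<And>k. k \<in> walk_support M X \<Longrightarrow> - int B \<le> k div g"
begin

lemma coeff_step_poly: "coeff (step_poly g B) j = step_prob M X (g * (int j - int B))"
proof -
  have iff: "nat (k div g + int B) = j \<longleftrightarrow> k = g * (int j - int B)" if k: "k \<in> walk_support M X" for k
  proof -
    obtain m where m: "k = g * m" using dvd[OF k] by blast
    then have "k div g = m" using g by simp
    then show ?thesis using lower[OF k] g m by auto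
  qed
  have "coeff (step_poly g B) j = (\<Sum>k\<in>walk_support M X. if k = g * (int j - int B) then step_prob M X k else 0)"
    unfolding step_poly_def coeff_sum coeff_monom by (rule sum.cong) (use iff in auto)
  also have "\<dots> = step_prob M X (g * (int j - int B))"
    using finite_support step_prob_zero by (simp add: if_distrib cong: if_cong)
  finally show ?thesis .
qed

text \<open>The case of a negative exponent, with probability 0, belongs to the statement because
  subtracting a step in the induction can lead there.\<close>

lemma prob_sum_eq_coeff:
  "prob {x \<in> space M. (\<Sum>i=1..n. X i x) = g * w}
    = (if 0 \<le> w + int n * int B then coeff (step_poly g B ^ n) (nat (w + int n * int B)) else 0)"
proof (induction n arbitrary: w)
  case 0
  have "{x \<in> space M. (\<Sum>i=1..0. X i x) = g * w} = (if w = 0 then space M else {})" using g by auto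
  then show ?case using prob_space by (auto simp: one_poly_eq_simps coeff_1 coeff_pCons split: nat.splits)
next
  case (Suc n)
  let ?P = "step_poly g B"
  define m where "m = w + int (Suc n) * int B"
  have IH: "prob {x \<in> space M. (\<Sum>i=1..n. X i x) = g * w - k}
     = (if nat (k div g + int B) \<le> m then coeff (?P ^ n) (nat (m - (k div g + int B))) else 0)"
    if k: "k \<in> walk_support M X" for k
  proof -
    have "g * w - k = g * (w - k div g)" using dvd[OF k] by (simp add: right_diff_distrib)
    moreover have "(w - k div g) + int n * int B = m - (k div g + int B)" by (simp add: m_def algebra_simps)
    ultimately have "prob {x \<in> space M. (\<Sum>i=1..n. X i x) = g * w - k}
      = (if 0 \<le> m - (k div g + int B) then coeff (?P ^ n) (nat (m - (k div g + int B))) else 0)"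
      by (simp only: Suc.IH)
    then show ?thesis using lower[OF k] by simp
  qed
  have "prob {x \<in> space M. (\<Sum>i=1..Suc n. X i x) = g * w}
     = (\<Sum>k\<in>walk_support M X. step_prob M X k *
        (if nat (k div g + int B) \<le> m then coeff (?P ^ n) (nat (m - (k div g + int B))) else 0))"
    unfolding prob_sum_Suc by (rule sum.cong) (use IH in auto)
  also have "\<dots> = (if 0 \<le> m then coeff (?P ^ Suc n) (nat m) else 0)"
  proof (cases "0 \<le> m")
    case True
    have "?P ^ Suc n = (\<Sum>k\<in>walk_support M X. monom (step_prob M X k) (nat (k div g + int B)) * ?P ^ n)"
      by (simp add: step_poly_def sum_distrib_right)
    then have "coeff (?P ^ Suc n) (nat m) = (\<Sum>k\<in>walk_support M X. coeff (monom (step_prob M X k) (nat (k div g + int B)) * ?P ^ n) (nat m))"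
      by (simp add: coeff_sum)
    also have "\<dots> = (\<Sum>k\<in>walk_support M X. step_prob M X k *
        (if nat (k div g + int B) \<le> m then coeff (?P ^ n) (nat (m - (k div g + int B))) else 0))"
    proof (rule sum.cong)
      fix k assume "k \<in> walk_support M X"
      then have "nat m - nat (k div g + int B) = nat (m - (k div g + int B))" using lower[of k] by (simp add: nat_diff_distrib')
      then show "coeff (monom (step_prob M X k) (nat (k div g + int B)) * ?P ^ n) (nat m) = step_prob M X k *
        (if nat (k div g + int B) \<le> m then coeff (?P ^ n) (nat (m - (k div g + int B))) else 0)"
        using True by (simp only: coeff_monom_mult le_nat_iff) simp
    qed simp
    finally show ?thesis using True by simp
  next
    case False
    then show ?thesis by (auto intro!: sum.neutral)
  qed
  finally show ?case unfolding m_def .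
qed

lemma return_prob_eq_coeff: "return_prob M X n = return_coeff (step_poly g B) B n"
  using prob_sum_eq_coeff[of n 0] by (simp add: return_prob_def return_coeff_def nat_mult_distrib)

lemma poly_step_poly: "poly (step_poly g B) t = (\<Sum>k\<in>walk_support M X. step_prob M X k * t ^ nat (k div g + int B))"
  by (simp add: step_poly_def poly_sum poly_monom)

lemma poly_pderiv_step_poly_1:
  "poly (pderiv (step_poly g B)) 1 = real B + (\<Sum>k\<in>walk_support M X. real_of_int k * step_prob M X k) / g"
proof -
  have "pderiv (\<Sum>k\<in>A. h k) = (\<Sum>k\<in>A. pderiv (h k))" for A :: "int set" and h :: "int \<Rightarrow> real poly"
    by (induction A rule: infinite_finite_induct) (auto simp: pderiv_add)
  then have "poly (pderiv (step_poly g B)) 1 = (\<Sum>k\<in>walk_support M X. step_prob M X k * real (nat (k div g + int B)))"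
    by (simp add: step_poly_def poly_sum pderiv_monom poly_monom mult.commute)
  also have "\<dots> = (\<Sum>k\<in>walk_support M X. real_of_int k * step_prob M X k / g + step_prob M X k * real B)"
  proof (rule sum.cong)
    fix k assume k: "k \<in> walk_support M X"
    have "real (nat (k div g + int B)) = real_of_int (k div g) + real B" using lower[OF k] by simp
    also have "real_of_int (k div g) = real_of_int k / g" using dvd[OF k] by (simp add: real_of_int_div)
    finally show "step_prob M X k * real (nat (k div g + int B)) = real_of_int k * step_prob M X k / g + step_prob M X k * real B"
      by (simp add: algebra_simps)
  qed simp
  also have "\<dots> = real B + (\<Sum>k\<in>walk_support M X. real_of_int k * step_prob M X k) / g"
    using sum_step_prob by (simp add: sum.distrib sum_divide_distrib sum_distrib_right[symmetric])
  finally show ?thesis .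
qed

lemma walk_poly_step_poly:
  assumes drift: "(\<Sum>k\<in>walk_support M X. real_of_int k * step_prob M X k) = 0"
    and B: "0 < B" "- g * int B \<in> walk_support M X"
    and m: "0 < m" "g * m \<in> walk_support M X"
    and ap: "\<And>y::complex. norm y = 1 \<Longrightarrow> (\<And>k. k \<in> walk_support M X \<Longrightarrow> y powi (k div g) = 1) \<Longrightarrow> y = 1"
  shows "walk_poly (step_poly g B) B"
proof
  show "coeff (step_poly g B) k \<ge> 0" for k by (simp add: coeff_step_poly step_prob_nonneg)
  show "poly (step_poly g B) 1 = 1" using sum_step_prob by (simp add: poly_step_poly)
  show "poly (pderiv (step_poly g B)) 1 = real B" by (simp add: poly_pderiv_step_poly_1 drift)
  show "coeff (step_poly g B) 0 > 0" using B by (simp add: coeff_step_poly walk_support_def)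
  show "0 < B" by (rule B)
  have "coeff (step_poly g B) (B + nat m) \<noteq> 0" using m by (simp add: coeff_step_poly walk_support_def)
  then have "B + nat m \<le> degree (step_poly g B)" by (rule le_degree)
  then show "B < degree (step_poly g B)" using m by simp
  fix y :: complex
  assume y: "norm y = 1" and all: "\<And>k. coeff (step_poly g B) k \<noteq> 0 \<Longrightarrow> y ^ k = y ^ B"
  have y0: "y \<noteq> 0" using y by auto
  show "y = 1"
  proof (rule ap[OF y])
    fix k assume k: "k \<in> walk_support M X"
    define j where "j = nat (k div g + int B)"
    have j: "int j = k div g + int B" using lower[OF k] by (simp add: j_def)
    then have "g * (int j - int B) = k" using dvd[OF k] by simp
    then have "coeff (step_poly g B) j \<noteq> 0" using k by (simp add: coeff_step_poly walk_support_def)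
    then have "y ^ j = y ^ B" by (rule all)
    then have "y powi (int j - int B) = 1" using y0 by (simp add: power_int_diff)
    then show "y powi (k div g) = 1" using j by simp
  qed
qed

end

end

section \<open>Substitution in Laurent polynomials and the comparison of the two walks\<close>

lemma lookup_subst_power:
  assumes "d \<noteq> 0"
  shows "Poly_Mapping.lookup (subst_power d P) z = (if d dvd z then Poly_Mapping.lookup P (z div d) else 0)"
proof -
  have "Poly_Mapping.lookup (subst_power d P) z
     = (\<Sum>k\<in>Poly_Mapping.keys P. if d * k = z then Poly_Mapping.lookup P k else 0)"
    by (simp add: subst_power_def lookup_sum lookup_single when_def)
  also have "\<dots> = (if d dvd z then Poly_Mapping.lookup P (z div d) else 0)"
  proof (cases "d dvd z")
    case True
    then obtain m where m: "z = d * m" by blast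
    have "(\<Sum>k\<in>Poly_Mapping.keys P. if d * k = z then Poly_Mapping.lookup P k else 0)
       = (\<Sum>k\<in>Poly_Mapping.keys P. if k = m then Poly_Mapping.lookup P k else 0)"
      by (rule sum.cong) (use m assms in auto)
    also have "\<dots> = Poly_Mapping.lookup P m" by (simp add: in_keys_iff)
    finally show ?thesis using m assms by simp
  next
    case False
    then show ?thesis by (auto intro!: sum.neutral)
  qed
  finally show ?thesis .
qed

lemma shape_eq_subst_power:
  assumes M: "random_walk M X" and N: "random_walk N Y" and d: "d \<noteq> 0"
    and dvd: "\<And>k. k \<in> walk_support N Y \<Longrightarrow> d dvd k"
    and eq: "\<And>m. step_prob N Y (d * m) = step_prob M X m"
  shows "shape N Y = subst_power d (shape M X)"
proof (rule poly_mapping_eqI)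
  fix z
  show "Poly_Mapping.lookup (shape N Y) z = Poly_Mapping.lookup (subst_power d (shape M X)) z"
  proof (cases "d dvd z")
    case True
    then obtain m where "z = d * m" by blast
    then show ?thesis using eq d
      by (simp add: lookup_subst_power random_walk.lookup_shape[OF M] random_walk.lookup_shape[OF N])
  next
    case False
    then have "step_prob N Y z = 0" using dvd random_walk.step_prob_zero[OF N] by blast
    then show ?thesis using False d by (simp add: lookup_subst_power random_walk.lookup_shape[OF N])
  qed
qed

theorem theorem1p3:
  fixes M :: "'a measure" and X :: "nat \<Rightarrow> 'a \<Rightarrow> int"
    and N :: "'b measure" and Y :: "nat \<Rightarrow> 'b \<Rightarrow> int"
    and e f :: int
  assumes "random_walk M X"
    and "unbiased M X"
    and "Min (walk_support M X) = - e"
    and "Max (walk_support M X) = f"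
    and "gcd e f = 1"
    and "random_walk N Y"
    and "\<And>n. n \<ge> 1 \<Longrightarrow> return_prob N Y n = return_prob M X n"
  shows "\<exists>d::int. shape N Y = subst_power d (shape M X)"
proof -
  interpret M: random_walk M X by fact
  interpret N: random_walk N Y by fact
  let ?S = "walk_support M X" and ?T = "walk_support N Y"
  \<comment> \<open>J also has a term for n = 0; there both return probabilities are 1.\<close>
  have same: "return_prob N Y n = return_prob M X n" for n
    using assms(7)[of n] M.prob_space N.prob_space by (cases "n = 0") (auto simp: return_prob_def)
  have driftM: "(\<Sum>k\<in>?S. real_of_int k * step_prob M X k) = 0"
    using assms(2) M.expectation_step unfolding unbiased_def by auto
  have bounds: "- e \<in> ?S" "f \<in> ?S" "\<And>k. k \<in> ?S \<Longrightarrow> - e \<le> k" "\<And>k. k \<in> ?S \<Longrightarrow> k \<le> f"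
    using Min_in[OF M.finite_support M.support_nonempty] Max_in[OF M.finite_support M.support_nonempty]
      Min_le[OF M.finite_support] Max_ge[OF M.finite_support] assms(3,4) by auto
  have pos_of_drift: "(\<exists>k\<in>A. k < 0) \<and> (\<exists>k\<in>A. 0 < k)"
    if A: "finite A" "\<And>k. k \<in> A \<Longrightarrow> c k > 0" "(\<Sum>k\<in>A. real_of_int k * c k) = 0" "k0 \<in> A" "k0 \<noteq> 0" for A and c :: "int \<Rightarrow> real" and k0
  proof (rule ccontr)
    assume "\<not> ?thesis"
    then consider "\<forall>k\<in>A. 0 \<le> k" | "\<forall>k\<in>A. k \<le> 0" by force
    then have "real_of_int k0 * c k0 = 0"
    proof cases
      case 1
      then have "0 \<le> real_of_int k * c k" if "k \<in> A" for k using A(2)[OF that] that by simp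
      then show ?thesis using A sum_nonneg_eq_0_iff[of A "\<lambda>k. real_of_int k * c k"] by auto
    next
      case 2
      then have "0 \<le> - (real_of_int k * c k)" if "k \<in> A" for k
        using A(2)[OF that] that by (simp add: mult_nonpos_nonneg)
      moreover have "(\<Sum>k\<in>A. - (real_of_int k * c k)) = 0" using A(3) by (simp add: sum_negf)
      ultimately show ?thesis using A(1,4) sum_nonneg_eq_0_iff[of A "\<lambda>k. - (real_of_int k * c k)"] by auto
    qed
    then show False using A(2)[OF A(4)] A(5) by simp
  qed
  have posM: "step_prob M X k > 0" if "k \<in> ?S" for k using that by (simp add: walk_support_def)
  have posN: "step_prob N Y k > 0" if "k \<in> ?T" for k using that by (simp add: walk_support_def)
  have "e \<noteq> 0 \<or> f \<noteq> 0" using assms(5) by auto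
  then obtain k0 where "k0 \<in> ?S" "k0 \<noteq> 0" using bounds(1,2) by force
  then obtain k1 k2 where "k1 \<in> ?S" "k1 < 0" "k2 \<in> ?S" "0 < k2"
    using pos_of_drift[OF M.finite_support posM driftM, of k0] by blast
  then have ef: "0 < e" "0 < f" using bounds(3)[of k1] bounds(4)[of k2] by simp_all
  define E where "E = nat e"
  have E: "int E = e" "0 < E" using ef by (auto simp: E_def)
  have ctxM: "(0::int) < 1" "\<And>k. k \<in> ?S \<Longrightarrow> 1 dvd k" "\<And>k. k \<in> ?S \<Longrightarrow> - int E \<le> k div 1"
    using bounds E by auto
  define p where "p = M.step_poly 1 E"
  have coeff_p: "coeff p j = step_prob M X (int j - e)" for j
    unfolding p_def using M.coeff_step_poly[OF ctxM] E by simp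
  have wp: "walk_poly p E" unfolding p_def
  proof (rule M.walk_poly_step_poly[OF ctxM driftM])
    show "0 < E" "- 1 * int E \<in> ?S" "0 < f" "1 * f \<in> ?S" using E bounds ef by auto
    fix y :: complex assume y: "norm y = 1" and all: "\<And>k. k \<in> ?S \<Longrightarrow> y powi (k div 1) = 1"
    have y0: "y \<noteq> 0" using y by auto
    have "y powi (Gcd {- e, f}) = 1"
      using all[OF bounds(1)] all[OF bounds(2)] by (intro power_int_Gcd_eq_1 y0) auto
    then show "y = 1" using assms(5) by simp
  qed
  interpret P: walk_poly p E by (rule wp)
  have deg_p: "degree p = E + nat f"
  proof (rule antisym)
    show "degree p \<le> E + nat f"
    proof (rule degree_le, intro allI impI)
      fix j assume "E + nat f < j"
      then have "int j - e \<notin> ?S" using bounds(4)[of "int j - e"] E ef by auto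
      then show "coeff p j = 0" using M.step_prob_zero by (simp add: coeff_p)
    qed
    show "E + nat f \<le> degree p"
      by (rule le_degree) (use posM[OF bounds(2)] E ef in \<open>simp add: coeff_p\<close>)
  qed
  have cop: "coprime E (degree p - E)"
  proof -
    have "coprime (int E) (int (nat f))" using assms(5) ef E by (simp add: coprime_iff_gcd_eq_1)
    then show ?thesis unfolding deg_p by (simp only: coprime_int_iff add_diff_cancel_left')
  qed
  have retM: "return_prob M X n = return_coeff p E n" for n
    unfolding p_def by (rule M.return_prob_eq_coeff[OF ctxM])
  \<comment> \<open>If the mean D of the second walk were nonzero, its shape \<omega> would have
    slope D at t = 1 and so take a value below 1 at some t > 0. The constant term of \<omega>^n is
    at most \<omega>(t)^n, and this geometric decay contradicts the recurrence of the first
    walk.\<close>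
  have driftN: "(\<Sum>k\<in>?T. real_of_int k * step_prob N Y k) = 0"
  proof (rule ccontr)
    assume nz: "(\<Sum>k\<in>?T. real_of_int k * step_prob N Y k) \<noteq> 0"
    define B where "B = nat (- Min ?T)"
    have "- int B \<le> k" if "k \<in> ?T" for k using Min_le[OF N.finite_support that] by (simp add: B_def)
    then have ctxN: "(0::int) < 1" "\<And>k. k \<in> ?T \<Longrightarrow> 1 dvd k" "\<And>k. k \<in> ?T \<Longrightarrow> - int B \<le> k div 1"
      by auto
    define r where "r = N.step_poly 1 B"
    define D where "D = (\<Sum>k\<in>?T. real_of_int k * step_prob N Y k)"
    have r1: "poly r 1 = 1" using N.poly_step_poly[OF ctxN, of 1] N.sum_step_prob by (simp add: r_def)
    have dr: "poly (pderiv r) 1 = real B + D" using N.poly_pderiv_step_poly_1[OF ctxN] by (simp add: r_def D_def)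
    have "(rchi r B has_real_derivative (poly (pderiv r) 1 * 1 ^ B - poly r 1 * (real B * 1 ^ (B - 1))) / (1 ^ B * 1 ^ B)) (at 1)"
      unfolding rchi_def by (auto intro!: derivative_eq_intros)
    then have der: "(rchi r B has_real_derivative D) (at 1)" by (simp add: r1 dr)
    have rc1: "rchi r B 1 = 1" by (simp add: rchi_def r1)
    have "\<exists>t. 0 < t \<and> rchi r B t < 1"
    proof (cases "D > 0")
      case True
      then obtain \<delta> where \<delta>: "\<delta> > 0" "\<forall>h>0. h < \<delta> \<longrightarrow> rchi r B (1 - h) < rchi r B 1"
        using DERIV_pos_inc_left[OF der] by blast
      then show ?thesis using rc1 by (intro exI[of _ "1 - min \<delta> 1 / 2"]) (auto simp: min_def)
    next
      case False
      then have "D < 0" using nz D_def by simp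
      then obtain \<delta> where \<delta>: "\<delta> > 0" "\<forall>h>0. h < \<delta> \<longrightarrow> rchi r B (1 + h) < rchi r B 1"
        using DERIV_neg_dec_right[OF der] by blast
      then show ?thesis using rc1 by (intro exI[of _ "1 + \<delta> / 2"]) auto
    qed
    then obtain t where t: "0 < t" "rchi r B t < 1" by blast
    have cn: "coeff (r ^ n) k \<ge> 0" for n k
    proof (induction n arbitrary: k)
      case (Suc n)
      then show ?case
        by (auto simp: coeff_mult r_def N.coeff_step_poly[OF ctxN] N.step_prob_nonneg intro!: sum_nonneg mult_nonneg_nonneg)
    qed (simp add: coeff_1)
    show False
    proof (rule P.no_geometric_decay[of "rchi r B t"])
      have "poly r t \<ge> 0" using cn[of 1] t by (auto simp: poly_altdef intro!: sum_nonneg mult_nonneg_nonneg)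
      then show "0 \<le> rchi r B t" using t by (simp add: rchi_def)
      fix n
      have "return_coeff p E n = coeff (r ^ n) (n * B)"
        using retM[of n] same[of n] N.return_prob_eq_coeff[OF ctxN, of n] by (simp add: r_def return_coeff_def)
      moreover have "coeff (r ^ n) (n * B) * t ^ (n * B) \<le> poly (r ^ n) t"
      proof (cases "n * B \<le> degree (r ^ n)")
        case True
        then show ?thesis unfolding poly_altdef using cn t
          by (intro member_le_sum[of "n * B" _ "\<lambda>i. coeff (r ^ n) i * t ^ i"]) auto
      next
        case False
        then have "coeff (r ^ n) (n * B) = 0" by (simp add: coeff_eq_0)
        then show ?thesis using cn t by (auto simp: poly_altdef simp del: poly_power intro!: sum_nonneg mult_nonneg_nonneg)
      qed
      ultimately show "return_coeff p E n \<le> rchi r B t ^ n"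
        using t by (simp add: rchi_def power_divide pos_le_divide_eq power_mult[symmetric] mult.commute[of B])
    qed (rule t)
  qed
  \<comment> \<open>A walk that never moves has first return probability 1, whereas the first walk
    makes the step -e with positive probability.\<close>
  have "\<exists>k\<in>?T. k \<noteq> 0"
  proof (rule ccontr)
    assume "\<not> ?thesis"
    then have "?T = {0}" using N.support_nonempty by auto
    then have "step_prob N Y 0 = 1" using N.sum_step_prob by simp
    then have "return_prob N Y 1 = 1" by (simp add: return_prob_def step_prob_def)
    then have "step_prob M X 0 = 1" using same[of 1] by (simp add: return_prob_def step_prob_def)
    moreover have "step_prob M X (- e) + step_prob M X 0 \<le> 1"
    proof (cases "0 \<in> ?S")
      case True
      have "(\<Sum>k\<in>{- e, 0}. step_prob M X k) \<le> (\<Sum>k\<in>?S. step_prob M X k)"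
        using True bounds(1) M.finite_support M.step_prob_nonneg by (intro sum_mono2) auto
      then show ?thesis using M.sum_step_prob ef by simp
    next
      case False
      then show ?thesis using M.step_prob_zero[of 0] M.prob_le_1 by (simp add: step_prob_def)
    qed
    ultimately show False using posM[OF bounds(1)] by simp
  qed
  then have two: "(\<exists>k\<in>?T. k < 0) \<and> (\<exists>k\<in>?T. 0 < k)"
    using pos_of_drift[OF N.finite_support posN driftN] by blast
  \<comment> \<open>Dividing by the gcd makes the second walk aperiodic; up to sign this is the
    integer d of the conclusion.\<close>
  define g where "g = Gcd ?T"
  have gdvd: "g dvd k" if "k \<in> ?T" for k using that by (simp add: g_def)
  have "g \<noteq> 0" using two gdvd by force
  then have g0: "0 < g" unfolding g_def using Gcd_int_greater_eq_0[of ?T] by linarith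
  define B where "B = nat (- (Min ?T div g))"
  have minT: "Min ?T \<in> ?T" "\<And>k. k \<in> ?T \<Longrightarrow> Min ?T \<le> k"
    using Min_in[OF N.finite_support N.support_nonempty] Min_le[OF N.finite_support] by auto
  then have minneg: "Min ?T < 0" using two by force
  obtain m0 where m0: "Min ?T = g * m0" using gdvd[OF minT(1)] by blast
  have m0neg: "m0 < 0" using minneg g0 unfolding m0 by (simp add: mult_less_0_iff)
  have B: "0 < B" "int B = - m0" "- g * int B = Min ?T" using m0 m0neg g0 by (auto simp: B_def)
  have lowT: "- int B \<le> k div g" if "k \<in> ?T" for k
    using minT(2)[OF that] zdiv_mono1[OF _ g0, of "Min ?T" k] m0 g0 B(2) by simp
  obtain k1 where k1: "k1 \<in> ?T" "0 < k1" using two by blast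
  obtain m1 where m1: "k1 = g * m1" using gdvd[OF k1(1)] by blast
  define q where "q = N.step_poly g B"
  have coeff_q: "coeff q j = step_prob N Y (g * (int j - int B))" for j
    unfolding q_def by (rule N.coeff_step_poly[OF g0 gdvd lowT])
  have wq: "walk_poly q B" unfolding q_def
  proof (rule N.walk_poly_step_poly[OF g0 gdvd lowT driftN B(1)])
    show "- g * int B \<in> ?T" using B minT by simp
    show "0 < m1" using k1 m1 g0 by (simp add: zero_less_mult_iff)
    show "g * m1 \<in> ?T" using k1 m1 by simp
    fix y :: complex assume y: "norm y = 1" and all: "\<And>k. k \<in> ?T \<Longrightarrow> y powi (k div g) = 1"
    have y0: "y \<noteq> 0" using y by auto
    \<comment> \<open>A g-th root of \<open>y\<close> translates the condition on the quotients k /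
      g into z^k = 1 on the support, whence y = z^g = 1.\<close>
    obtain z where z: "z ^ nat g = y" using exists_complex_root[of "nat g" y] g0 by auto
    have z0: "z \<noteq> 0" using z y0 g0 by (auto simp: zero_power)
    have zg: "z powi g = y" using z g0 by (simp add: power_int_def)
    have "z powi (Gcd ?T) = 1"
    proof (rule power_int_Gcd_eq_1[OF N.finite_support z0])
      fix k assume k: "k \<in> ?T"
      have "z powi (g * (k div g)) = y powi (k div g)" unfolding power_int_mult zg ..
      then show "z powi k = 1" using all[OF k] gdvd[OF k] by simp
    qed
    then show "y = 1" using zg unfolding g_def by simp
  qed auto
  have "isospectral p E q B"
    unfolding isospectral_def isospectral_axioms_def
    using wp wq retM same N.return_prob_eq_coeff[OF g0 gdvd lowT] by (simp add: q_def)
  then consider "q = p" "B = E" | "reflect_poly q = p" "degree q - B = E"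
    using isospectral_unique cop by blast
  then show ?thesis
  proof cases
    case 1
    \<comment> \<open>Coefficients of p and q reach only exponents from -e upwards; below that both
      probabilities vanish.\<close>
    have "step_prob N Y (g * m) = step_prob M X m" for m
    proof (cases "- e \<le> m")
      case True
      have "coeff q (nat (m + e)) = coeff p (nat (m + e))" by (simp only: 1(1))
      then have "step_prob N Y (g * (int (nat (m + e)) - int B)) = step_prob M X (int (nat (m + e)) - e)"
        unfolding coeff_p coeff_q .
      then show ?thesis using True 1(2) E by simp
    next
      case False
      then have "m \<notin> ?S" using bounds(3) by auto
      moreover have "g * m < Min ?T" using False g0 B 1 E by (simp add: mult_less_cancel_left_pos m0)
      then have "g * m \<notin> ?T" using minT(2) by force
      ultimately show ?thesis using M.step_prob_zero N.step_prob_zero by simp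
    qed
    then have "shape N Y = subst_power g (shape M X)"
      by (intro shape_eq_subst_power[OF assms(1,6)]) (use g0 gdvd in auto)
    then show ?thesis by blast
  next
    case 2
    interpret Q: walk_poly q B by (rule wq)
    have degq: "degree q = B + E" using 2 Q.e_less by simp
    \<comment> \<open>Reflection matches the exponent m of the first shape with -m of the reduced
      second one, hence d = -g. Outside the range from -e to B both probabilities vanish.\<close>
    have "step_prob N Y (- g * m) = step_prob M X m" for m
    proof (cases "- e \<le> m \<and> m \<le> int B")
      case True
      define j where "j = nat (m + e)"
      have j: "int j = m + e" "j \<le> degree q" using True E by (auto simp: j_def degq)
      have "coeff p j = coeff q (degree q - j)" using j(2) unfolding 2(1)[symmetric] by (simp add: coeff_reflect_poly)
      moreover have "int (degree q - j) - int B = - m" using j E by (simp add: degq of_nat_diff)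
      ultimately show ?thesis using j(1) by (simp add: coeff_p coeff_q)
    next
      case False
      then consider "m < - e" | "int B < m" by linarith
      then have "m \<notin> ?S \<and> - g * m \<notin> ?T"
      proof cases
        case 1
        then have a: "m \<notin> ?S" using bounds(3)[of m] by auto
        define j where "j = nat (- m + int B)"
        have "degree q < j" using 1 E by (auto simp: j_def degq)
        then have "coeff q j = 0" by (rule coeff_eq_0)
        moreover have "int j - int B = - m" using 1 ef by (simp add: j_def)
        ultimately have "step_prob N Y (- g * m) = 0" by (simp add: coeff_q)
        then show ?thesis using a by (simp add: walk_support_def)
      next
        case 2
        have "- g * m < - g * int B" using 2 g0 by simp
        then have b: "- g * m \<notin> ?T" using minT(2) B(3) by force
        have "degree p < nat (m + e)"
          using 2 E degq \<open>reflect_poly q = p\<close> Q.degree_reflect by auto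
        then have "coeff p (nat (m + e)) = 0" by (rule coeff_eq_0)
        then have "step_prob M X m = 0" using 2 ef by (simp add: coeff_p)
        then show ?thesis using b by (simp add: walk_support_def)
      qed
      then show ?thesis using M.step_prob_zero N.step_prob_zero by simp
    qed
    then have "shape N Y = subst_power (- g) (shape M X)"
      by (intro shape_eq_subst_power[OF assms(1,6)]) (use g0 gdvd in auto)
    then show ?thesis by blast
  qed
qed

end
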